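(* Let $J$ be a semi-infinite complex Jacobi matrix. (a) If $J\in\mathcal{P}(\beta)$ with $0<\beta<\frac12$, then $E_J\subset[-1,1]$ is a closed set of Lebesgue measure zero, and $$\dim E_J\le \tau(E_J)\le \frac{1-2\beta}{1-\beta},$$ where $\dim E_J$ is the Hausdorff dimension of $E_J$ and $\tau(E_J)$ is its convergence exponent. (b) If $J\in\mathcal{P}(\frac12)$, then $E_J=\emptyset$, i.e. the discrete spectrum $\sigma_d(J)$ is finite.
   Context: A semi-infinite complex Jacobi matrix is a tridiagonal matrix $J$ with rows and columns indexed by $\mathbb{Z}_+=\{0,1,2,\dots\}$, with diagonal entries $J_{n,n}=b_n$, superdiagonal entries $J_{n,n+1}=c_n$, subdiagonal entries $J_{n+1,n}=a_n$ ($n\ge 0$), where $a_n,b_n,c_n\in\mathbb{C}$, and all other entries zero. For $0<\beta<1$, $J\in\mathcal{P}(\beta)$ means that there are constants $C_1,C_2>0$ with $|a_n-\frac12|+|c_n-\frac12|+|b_n|\le C_1\exp(-C_2 n^\beta)$ for all $n\geq 0$. Such a $J$ defines a bounded operator on $\ell^2(\mathbb{Z}_+)$ that is a compact perturbation of the discrete Laplacian $J_0$ ($a_n=c_n=\frac12$, $b_n=0$). By Weyl's theorem its spectrum is $\sigma(J)=[-1,1]\cup\sigma_d(J)$, where the discrete spectrum $\sigma_d(J)=\sigma(J)\setminus[-1,1]$ is an at most countable set of eigenvalues of finite algebraic multiplicity, whose accumulation points can lie only in $[-1,1]$. $E_J:=\{\sigma_d(J)\}'$ denotes the set of accumulation points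 of $\sigma_d(J)$ in $\mathbb{C}$. For a closed set $F\subset[-1,1]$, the convergence exponent (Taylor–Besicovitch index) is $\tau(F):=\inf\{\varepsilon>0:\ \sum_j |l_j|^\varepsilon<\infty\}$, where $\{l_j\}$ are the adjacent intervals of $F$ (the connected components of $[-1,1]\setminus F$) and $|l_j|$ is the length of $l_j$. *)

theory Defs
  imports "HOL-Analysis.Analysis"
begin

section \<open>Bounded operators on the space of square-summable sequences\<close>

definition ell2 :: "(nat \<Rightarrow> complex) set" where
  "ell2 = {x. summable (\<lambda>n. (cmod (x n))\<^sup>2)}"

definition ell2_norm :: "(nat \<Rightarrow> complex) \<Rightarrow> real" where
  "ell2_norm x = sqrt (\<Sum>n. (cmod (x n))\<^sup>2)"

text \<open>Operators are total functions on sequences; only their values on \<^const>\<open>ell2\<close> matter.\<close>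

definition bounded_operator :: "((nat \<Rightarrow> complex) \<Rightarrow> (nat \<Rightarrow> complex)) \<Rightarrow> bool" where
  "bounded_operator T \<longleftrightarrow>
     (\<forall>x\<in>ell2. T x \<in> ell2) \<and>
     (\<forall>x\<in>ell2. \<forall>y\<in>ell2. T (\<lambda>n. x n + y n) = (\<lambda>n. T x n + T y n)) \<and>
     (\<forall>z. \<forall>x\<in>ell2. T (\<lambda>n. z * x n) = (\<lambda>n. z * T x n)) \<and>
     (\<exists>K. \<forall>x\<in>ell2. ell2_norm (T x) \<le> K * ell2_norm x)"

text \<open>Meant for \<open>T\<close> bounded: otherwise \<open>T x - z x\<close> may leave \<^const>\<open>ell2\<close>, where \<open>R\<close> is
  unconstrained.\<close>

definition op_spectrum :: "((nat \<Rightarrow> complex) \<Rightarrow> (nat \<Rightarrow> complex)) \<Rightarrow> complex set" where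
  "op_spectrum T =
     {z. \<not> (\<exists>R. bounded_operator R \<and>
               (\<forall>x\<in>ell2. R (\<lambda>n. T x n - z * x n) = x \<and>
                          (\<lambda>n. T (R x) n - z * R x n) = x))}"


section \<open>Jacobi matrices\<close>

definition jacobi_matrix :: "(nat \<Rightarrow> nat \<Rightarrow> complex) \<Rightarrow> bool" where
  "jacobi_matrix J \<longleftrightarrow> (\<forall>m n. m > Suc n \<or> n > Suc m \<longrightarrow> J m n = 0)"

text \<open>For a Jacobi matrix the series below has at most three nonzero terms.\<close>

definition matrix_operator :: "(nat \<Rightarrow> nat \<Rightarrow> complex) \<Rightarrow> (nat \<Rightarrow> complex) \<Rightarrow> (nat \<Rightarrow> complex)" where
  "matrix_operator J x = (\<lambda>m. \<Sum>n. J m n * x n)"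

text \<open>The class \<open>\<P>(\<beta>)\<close>, where \<open>a\<^sub>n = J (Suc n) n\<close>, \<open>b\<^sub>n = J n n\<close> and \<open>c\<^sub>n = J n (Suc n)\<close>.
  For \<open>n = 0\<close> the exponent is \<open>0\<close>, since \<open>0 powr \<beta> = 0\<close>.\<close>

definition jacobi_class :: "real \<Rightarrow> (nat \<Rightarrow> nat \<Rightarrow> complex) set" where
  "jacobi_class \<beta> =
     {J. jacobi_matrix J \<and>
         (\<exists>C1>0. \<exists>C2>0. \<forall>n.
            cmod (J (Suc n) n - 1/2) + cmod (J n (Suc n) - 1/2) + cmod (J n n)
              \<le> C1 * exp (- C2 * real n powr \<beta>))}"

definition discrete_spectrum :: "(nat \<Rightarrow> nat \<Rightarrow> complex) \<Rightarrow> complex set" where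
  "discrete_spectrum J = op_spectrum (matrix_operator J) - complex_of_real ` {-1..1}"

definition spectral_limit_set :: "(nat \<Rightarrow> nat \<Rightarrow> complex) \<Rightarrow> complex set" where
  "spectral_limit_set J = {z. z islimpt discrete_spectrum J}"


section \<open>Hausdorff dimension\<close>

text \<open>The convention \<open>(diam U)\<^sup>0 = 1\<close> for nonempty \<open>U\<close> has to be made explicit, because
  \<open>0 powr 0 = 0\<close>.\<close>

definition diam_power :: "real \<Rightarrow> 'a::metric_space set \<Rightarrow> ennreal" where
  "diam_power s U = (if U = {} then 0 else if s = 0 then 1 else ennreal (diameter U powr s))"

text \<open>\<^const>\<open>diameter\<close> is meaningful only for bounded sets, hence the explicit boundedness
  requirement.\<close>

definition hausdorff_premeasure :: "real \<Rightarrow> real \<Rightarrow> 'a::metric_space set \<Rightarrow> ennreal" where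
  "hausdorff_premeasure s \<delta> S =
     (INF U \<in> {U :: nat \<Rightarrow> 'a set. S \<subseteq> (\<Union>i. U i) \<and> (\<forall>i. bounded (U i) \<and> diameter (U i) \<le> \<delta>)}.
        \<Sum>i. diam_power s (U i))"

definition hausdorff_measure :: "real \<Rightarrow> 'a::metric_space set \<Rightarrow> ennreal" where
  "hausdorff_measure s S = (SUP \<delta>\<in>{0<..}. hausdorff_premeasure s \<delta> S)"

definition hausdorff_dim :: "'a::metric_space set \<Rightarrow> ereal" where
  "hausdorff_dim S = Inf {ereal s | s. s \<ge> 0 \<and> hausdorff_measure s S = 0}"


section \<open>Convergence exponent of a closed subset of \<open>[-1,1]\<close>\<close>

definition adjacent_intervals :: "real set \<Rightarrow> real set set" where
  "adjacent_intervals F = components ({-1..1} - F)"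

definition convergence_exponent :: "real set \<Rightarrow> ereal" where
  "convergence_exponent F =
     Inf {ereal \<epsilon> | \<epsilon>. \<epsilon> > 0 \<and>
            (\<lambda>l. measure lborel l powr \<epsilon>) summable_on adjacent_intervals F}"

end

theory Submission
  imports Defs "HOL-Complex_Analysis.Complex_Analysis"
begin

text \<open>Off \<open>[-1,1]\<close> put \<open>z = (\<lambda> + 1 / \<lambda>) / 2\<close> with \<open>\<bar>\<lambda>\<bar> < 1\<close>. The Jost function \<open>f\<close> of \<open>J\<close> is a power series
  in \<open>\<lambda>\<close> with \<open>f 0 = 1\<close>, and Green's kernel has denominator \<open>f\<close>, so that \<open>z\<close> belongs to the
  resolvent set unless \<open>f \<lambda> = 0\<close>. Cutting off the perturbation at \<open>M\<close> approximates \<open>f\<close> by polynomials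
  of degree \<open>2 * M\<close> up to \<open>exp (- \<tau> * M powr \<beta>)\<close>; hence \<open>f\<close> has Gevrey regularity on the closed disk.
  At a limit point \<open>w\<close> of zeros, which lies on the circle, one can divide out arbitrarily many zeros,
  and the optimal choice gives \<open>\<bar>f \<lambda>\<bar> \<le> exp (L - \<kappa> * \<bar>\<lambda> - w\<bar> powr (- \<gamma>))\<close> with
  \<open>\<gamma> = \<beta> / (1 - \<beta>)\<close>. By Jensen's inequality the distance to the set of limit points has an
  integrable power of exponent \<open>-\<gamma>\<close>. For \<open>\<gamma> = 1\<close> this is impossible near a limit point; for
  \<open>\<gamma> < 1\<close> the set is null and the powers \<open>1 - \<gamma> = (1 - 2 * \<beta>) / (1 - \<beta>)\<close> of the lengths of its gaps
  are summable.\<close>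

section \<open>Power series with many zeros in the closed disk\<close>

text \<open>The exponent \<gamma> arises as follows. An error
  \<open>exp (- \<tau> * M powr \<beta>)\<close> on a polynomial of degree \<open>2 * M\<close>,
  weighted by \<open>2 * M choose k\<close>, is of order \<open>(A * k powr \<sigma>) ^ k\<close>
  with \<open>\<sigma> = 1 / \<beta> - 1\<close>. Dividing out k zeros near w therefore leaves
  \<open>(A * k powr \<sigma> * \<bar>\<lambda> - w\<bar>) ^ k\<close>, which is smallest for k of
  order \<open>\<bar>\<lambda> - w\<bar> powr (- 1 / \<sigma>)\<close>, and
  \<open>1 / \<sigma> = \<gamma>\<close>. The value \<beta> = 1/2, that is \<gamma> = 1, is where
  this singularity ceases to be integrable. A gap of length l has an end in the limit set, so the
  distance is at most l on it and the gap contributes at least \<open>l powr (1 - \<gamma>)\<close>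
  to the integral. The obstacle is that w lies on the circle: zeros reach it from inside, and f has
  no convergent expansion there. All estimates are therefore made on the coefficients at 0, where
  division by \<open>\<lambda> - z\<close> is exact for every zero z in the closed disk. Likewise
  the logarithmic integral of a function that may vanish on the circle is replaced by finite
  products.\<close>

lemma sum_binomial_tail:
  fixes u :: "nat \<Rightarrow> real"
  assumes "summable u"
  shows "(\<Sum>i<N. real (i choose j) * (\<Sum>m. u (m + Suc i)))
    = (\<Sum>m<Suc N. u m * real (m choose Suc j)) + real (N choose Suc j) * (\<Sum>m. u (m + Suc N))"
proof (induction N)
  case 0
  then show ?case by simp
next
  case (Suc N)
  have "(\<Sum>m. u (m + Suc N)) = u (Suc N) + (\<Sum>m. u (m + Suc (Suc N)))"
    using suminf_split_head[OF summable_ignore_initial_segment[OF assms, of "Suc N"]] by simp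
  then show ?case using Suc by (simp add: algebra_simps)
qed

text \<open>By the hockey-stick identity \<open>u m\<close> is counted \<open>m choose Suc j\<close>
  times for m up to N; for larger m the count \<open>N choose Suc j\<close> only gets bigger when N
  is replaced by m. This is the price of one division by a zero: the lower index rises by
  one.\<close>

lemma sum_binomial_tail_le:
  fixes u :: "nat \<Rightarrow> real"
  assumes "\<And>m. u m \<ge> 0" and "\<And>j. summable (\<lambda>m. u m * real (m choose j))"
  shows "(\<Sum>i<N. real (i choose j) * (\<Sum>m. u (m + Suc i))) \<le> (\<Sum>m. u m * real (m choose Suc j))"
proof -
  have u: "summable u" using assms(2)[of 0] by simp
  have "real (N choose Suc j) * (\<Sum>m. u (m + Suc N))
      = (\<Sum>m. real (N choose Suc j) * u (m + Suc N))"
    by (rule suminf_mult[OF summable_ignore_initial_segment[OF u], symmetric])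
  also have "\<dots> \<le> (\<Sum>m. u (m + Suc N) * real ((m + Suc N) choose Suc j))"
  proof (rule suminf_le)
    fix m
    have "real (N choose Suc j) \<le> real ((m + Suc N) choose Suc j)"
      by (intro of_nat_mono binomial_right_mono) simp
    then show "real (N choose Suc j) * u (m + Suc N) \<le> u (m + Suc N) * real ((m + Suc N) choose Suc j)"
      using assms(1) by (metis mult.commute mult_left_mono)
  next
    show "summable (\<lambda>m. real (N choose Suc j) * u (m + Suc N))"
      by (intro summable_mult summable_ignore_initial_segment u)
    show "summable (\<lambda>m. u (m + Suc N) * real ((m + Suc N) choose Suc j))"
      using summable_ignore_initial_segment[OF assms(2)[of "Suc j"], of "Suc N"] by simp
  qed
  finally show ?thesis
    unfolding sum_binomial_tail[OF u]
    using suminf_split_initial_segment[OF assms(2)[of "Suc j"], of "Suc N"] by linarith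
qed

lemma summable_power_series_cball:
  fixes c :: "nat \<Rightarrow> complex"
  assumes "summable (\<lambda>m. cmod (c m))" "cmod z \<le> 1"
  shows "summable (\<lambda>m. c m * z ^ m)" "summable (\<lambda>m. cmod (c m * z ^ m))"
proof -
  have "cmod (c m * z ^ m) \<le> cmod (c m)" for m
    using assms(2) by (simp add: norm_mult norm_power mult_left_le power_le_one)
  then show *: "summable (\<lambda>m. cmod (c m * z ^ m))"
    by (intro summable_comparison_test'[OF assms(1), of 0]) auto
  then show "summable (\<lambda>m. c m * z ^ m)" by (rule summable_norm_cancel)
qed

text \<open>Each zero \<open>z\<close> is divided out: the quotient has the coefficients
  \<open>\<Sum>m. c (m + Suc i) * z ^ m\<close>, and weighting by binomial coefficients turns the resulting
  loss of summability into a shift of the lower index.\<close>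

lemma power_series_le_prod_zeros:
  fixes c :: "nat \<Rightarrow> complex"
  assumes "finite Z" "Z \<subseteq> cball 0 1" "\<And>z. z \<in> Z \<Longrightarrow> (\<Sum>m. c m * z ^ m) = 0"
    and "\<And>j. summable (\<lambda>m. cmod (c m) * real (m choose j))" and "cmod x \<le> 1"
  shows "cmod (\<Sum>m. c m * x ^ m)
    \<le> (\<Prod>z\<in>Z. cmod (x - z)) * (\<Sum>m. cmod (c m) * real (m choose card Z))"
  using assms(1-4)
proof (induction Z arbitrary: c rule: finite_induct)
  case empty
  have s: "summable (\<lambda>m. cmod (c m))" using empty(3)[of 0] by simp
  have "cmod (\<Sum>m. c m * x ^ m) \<le> (\<Sum>m. cmod (c m * x ^ m))"
    by (intro summable_norm summable_power_series_cball s assms)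
  also have "\<dots> \<le> (\<Sum>m. cmod (c m))"
    by (intro suminf_le summable_power_series_cball s assms)
       (use assms(5) in \<open>simp add: norm_mult norm_power mult_left_le power_le_one\<close>)
  finally show ?case by simp
next
  case (insert w Z)
  define g where "g i = (\<Sum>m. c (m + Suc i) * w ^ m)" for i
  define G where "G i = (\<Sum>m. cmod (c (m + Suc i)))" for i
  have w: "cmod w \<le> 1" using insert.prems(1) by simp
  have s: "summable (\<lambda>m. cmod (c m))" using insert.prems(3)[of 0] by simp
  have s': "summable (\<lambda>m. cmod (c (m + i)))" for i
    using summable_ignore_initial_segment[OF s] by simp
  have sw: "summable (\<lambda>m. c (m + i) * w ^ m)" for i
    using summable_power_series_cball(1)[OF s' w] by simp
  have gG: "cmod (g i) \<le> G i" for i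
  proof -
    have "cmod (g i) \<le> (\<Sum>m. cmod (c (m + Suc i) * w ^ m))"
      unfolding g_def by (intro summable_norm summable_power_series_cball(2)[OF s' w])
    also have "\<dots> \<le> G i" unfolding G_def
      by (intro suminf_le summable_power_series_cball(2)[OF s' w] s')
       (use w in \<open>simp add: norm_mult norm_power mult_left_le power_le_one\<close>)
    finally show ?thesis .
  qed
  have rec: "c (Suc i) + w * g (Suc i) = g i" for i
    using suminf_split_head[OF sw[of "Suc i"]] suminf_mult[OF sw[of "Suc (Suc i)"], of w]
    by (simp add: g_def algebra_simps)
  \<comment> \<open>The zero at w enters here: it makes the constant coefficients agree, so that
    division by \<open>y - w\<close> leaves no remainder.\<close>
  have "(\<Sum>m. c m * w ^ m) = 0" using insert.prems(2) by simp
  then have rec0: "c 0 + w * g 0 = 0"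
    using suminf_split_head[OF sw[of 0]] suminf_mult[OF sw[of "Suc 0"], of w]
    by (simp add: g_def algebra_simps eq_neg_iff_add_eq_0 neg_eq_iff_add_eq_0)
  have gsum: "(\<Sum>i<N. cmod (g i) * real (i choose j)) \<le> (\<Sum>m. cmod (c m) * real (m choose Suc j))" for N j
  proof -
    have "(\<Sum>i<N. cmod (g i) * real (i choose j)) \<le> (\<Sum>i<N. real (i choose j) * G i)"
      by (intro sum_mono) (metis gG mult.commute mult_left_mono of_nat_0_le_iff)
    also have "\<dots> \<le> (\<Sum>m. cmod (c m) * real (m choose Suc j))"
      unfolding G_def using sum_binomial_tail_le[of "\<lambda>m. cmod (c m)" j N] insert.prems(3) by simp
    finally show ?thesis .
  qed
  have gs: "summable (\<lambda>m. cmod (g m) * real (m choose j))" for j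
    by (rule summableI_nonneg_bounded[OF _ gsum[of j]]) simp
  have gle: "(\<Sum>m. cmod (g m) * real (m choose j)) \<le> (\<Sum>m. cmod (c m) * real (m choose Suc j))" for j
    by (rule suminf_le_const[OF gs gsum])
  have gs0: "summable (\<lambda>m. cmod (g m))" using gs[of 0] by simp
  have factor: "(\<Sum>m. c m * y ^ m) = (y - w) * (\<Sum>m. g m * y ^ m)" if y: "cmod y \<le> 1" for y
  proof -
    have sg: "(\<lambda>m. g m * y ^ m) sums (\<Sum>m. g m * y ^ m)"
      using summable_power_series_cball(1)[OF gs0 y] by (rule summable_sums)
    have "(\<lambda>m. g m * y ^ Suc m) sums (y * (\<Sum>m. g m * y ^ m))"
      using sums_mult[OF sg, of y] by (simp add: algebra_simps)
    then have "(\<lambda>m. case m of 0 \<Rightarrow> 0 | Suc i \<Rightarrow> g i * y ^ Suc i) sums (y * (\<Sum>m. g m * y ^ m))"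
      using sums_Suc_iff[of "\<lambda>m. case m of 0 \<Rightarrow> 0 | Suc i \<Rightarrow> g i * y ^ Suc i"] by simp
    from sums_diff[OF this sums_mult[OF sg, of w]]
    have "(\<lambda>m. (case m of 0 \<Rightarrow> 0 | Suc i \<Rightarrow> g i * y ^ Suc i) - w * (g m * y ^ m)) sums
        ((y - w) * (\<Sum>m. g m * y ^ m))" by (simp add: algebra_simps)
    moreover have "(case m of 0 \<Rightarrow> 0 | Suc i \<Rightarrow> g i * y ^ Suc i) - w * (g m * y ^ m) = c m * y ^ m" for m
    proof (cases m)
      case 0
      have "c 0 = - (w * g 0)" using rec0 by (simp add: eq_neg_iff_add_eq_0)
      then show ?thesis using 0 by simp
    next
      case (Suc i)
      show ?thesis using rec[of i, symmetric] unfolding Suc by (simp add: algebra_simps)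
    qed
    ultimately show ?thesis by (simp add: sums_iff)
  qed
  have zg: "(\<Sum>m. g m * z ^ m) = 0" if "z \<in> Z" for z
  proof -
    have "z \<noteq> w" "cmod z \<le> 1" using that insert by auto
    then show ?thesis using factor[of z] insert.prems(2)[of z] that by simp
  qed
  have "cmod (\<Sum>m. c m * x ^ m) = cmod (x - w) * cmod (\<Sum>m. g m * x ^ m)"
    using factor[OF assms(5)] by (simp add: norm_mult)
  also have "\<dots> \<le> cmod (x - w) * ((\<Prod>z\<in>Z. cmod (x - z)) * (\<Sum>m. cmod (g m) * real (m choose card Z)))"
    by (intro mult_left_mono insert.IH) (use insert.prems(1) zg gs in auto)
  also have "\<dots> \<le> cmod (x - w) * ((\<Prod>z\<in>Z. cmod (x - z)) * (\<Sum>m. cmod (c m) * real (m choose Suc (card Z))))"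
    by (intro mult_left_mono gle prod_nonneg) auto
  finally show ?case using insert.hyps by (simp add: mult.assoc)
qed

text \<open>Every ball around w contains k distinct zeros, and the bound from dividing them out
  depends on them only through their distances to x; then the radius tends to 0. This plays the role
  of Taylor's formula at a boundary point where all derivatives vanish.\<close>

lemma power_series_flat_at_limit_of_zeros:
  fixes c :: "nat \<Rightarrow> complex"
  assumes "\<And>j. summable (\<lambda>m. cmod (c m) * real (m choose j))"
    and "Z \<subseteq> cball 0 1" "\<And>z. z \<in> Z \<Longrightarrow> (\<Sum>m. c m * z ^ m) = 0" "w islimpt Z" "cmod x \<le> 1"
  shows "cmod (\<Sum>m. c m * x ^ m) \<le> cmod (x - w) ^ k * (\<Sum>m. cmod (c m) * real (m choose k))"
proof -
  define S where "S = (\<Sum>m. cmod (c m) * real (m choose k))"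
  have S: "S \<ge> 0" unfolding S_def by (intro suminf_nonneg assms(1)) auto
  have "cmod (\<Sum>m. c m * x ^ m) \<le> (cmod (x - w) + e) ^ k * S" if "e > 0" for e
  proof -
    have "infinite (Z \<inter> ball w e)" using assms(4) that islimpt_eq_infinite_ball by blast
    then obtain T where T: "T \<subseteq> Z \<inter> ball w e" "finite T" "card T = k"
      using infinite_arbitrarily_large by blast
    have "cmod (\<Sum>m. c m * x ^ m) \<le> (\<Prod>z\<in>T. cmod (x - z)) * S"
      unfolding S_def T(3)[symmetric]
      by (rule power_series_le_prod_zeros) (use T assms in auto)
    also have "\<dots> \<le> (\<Prod>z\<in>T. cmod (x - w) + e) * S"
    proof (intro mult_right_mono S prod_mono conjI)
      fix z assume "z \<in> T"
      then have "cmod (w - z) < e" using T(1) by (auto simp: dist_norm)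
      then show "cmod (x - z) \<le> cmod (x - w) + e"
        using norm_triangle_ineq[of "x - w" "w - z"] by simp
    qed auto
    finally show ?thesis using T(3) by simp
  qed
  then have ev: "\<forall>\<^sub>F e in at_right 0. cmod (\<Sum>m. c m * x ^ m) \<le> (cmod (x - w) + e) ^ k * S"
    using eventually_at_right_less[of "0::real"] by (rule eventually_mono[rotated])
  have "((\<lambda>e. (cmod (x - w) + e) ^ k * S) \<longlongrightarrow> (cmod (x - w) + 0) ^ k * S) (at_right 0)"
    by (intro tendsto_intros)
  from tendsto_lowerbound[OF this ev] show ?thesis by (simp add: S_def)
qed

section \<open>A discrete form of Jensen's inequality\<close>

text \<open>The product F of the rotations of g by all n-th roots of unity has modulus at least 1 at
  0, hence by the maximum principle at some point of the circle. F is invariant under these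
  rotations, so that point can be moved to an argument in the first n-th of the circle. Zeros of g
  do no harm, since no logarithm is taken.\<close>

lemma exists_equidistributed_large_product:
  fixes g :: "complex \<Rightarrow> complex"
  assumes cont: "continuous_on (cball 0 1) g" and hol: "g holomorphic_on ball 0 1"
    and g0: "cmod (g 0) \<ge> 1" and n: "n > 0"
  obtains t where "0 \<le> t" "t < 2 * pi / real n"
    "(\<Prod>k<n. cmod (g (cis (t + 2 * pi * real k / real n)))) \<ge> 1"
proof -
  define w where "w k = cis (2 * pi * real k / real n)" for k :: nat
  define F where "F z = (\<Prod>k<n. g (z * w k))" for z
  have w1: "cmod (w k) = 1" for k by (simp add: w_def)
  have contF: "continuous_on (cball 0 1) F" unfolding F_def
    by (intro continuous_on_prod continuous_on_compose2[OF cont] continuous_intros)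
       (auto simp: norm_mult w1)
  have holF: "F holomorphic_on ball 0 1" unfolding F_def
    by (intro holomorphic_on_prod holomorphic_on_compose_gen[OF _ hol, unfolded o_def] holomorphic_intros)
       (auto simp: norm_mult w1)
  obtain z0 where z0: "z0 \<in> sphere 0 1" "\<And>z. z \<in> sphere 0 1 \<Longrightarrow> cmod (F z) \<le> cmod (F z0)"
  proof -
    have "\<exists>x\<in>sphere 0 1. \<forall>y\<in>sphere (0::complex) 1. cmod (F y) \<le> cmod (F x)"
      by (intro continuous_attains_sup continuous_on_norm continuous_on_subset[OF contF])
         (auto intro: exI[of _ 1])
    then show ?thesis using that by blast
  qed
  have "cmod (F 0) \<le> cmod (F z0)"
    by (rule maximum_modulus_frontier[of F "cball 0 1"]) (use holF contF z0 in \<open>auto simp: frontier_cball\<close>)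
  moreover have "cmod (F 0) \<ge> 1" using g0 by (simp add: F_def norm_power one_le_power)
  ultimately have F1: "cmod (F z0) \<ge> 1" by linarith
  have step: "F (z * w 1) = F z" for z
  proof -
    obtain m where m: "n = Suc m" using n by (cases n) auto
    have ws: "w 1 * w k = w (Suc k)" for k
      using n by (simp add: w_def cis_mult field_simps)
    have wn: "w n = w 0" using n by (simp add: w_def)
    have "F (z * w 1) = (\<Prod>k<Suc m. g (z * w (Suc k)))"
      unfolding F_def m[symmetric] by (simp only: mult.assoc ws)
    also have "\<dots> = (\<Prod>k<m. g (z * w (Suc k))) * g (z * w 0)" using wn m by simp
    also have "\<dots> = F z" unfolding F_def m by (simp add: prod.lessThan_Suc_shift del: prod.lessThan_Suc)
    finally show ?thesis .
  qed
  have steps: "F (z * w 1 ^ j) = F z" for z j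
    by (induction j arbitrary: z) (simp_all add: step[unfolded One_nat_def] mult.assoc[symmetric])
  define th where "th = Arg2pi z0"
  have th: "0 \<le> th" "z0 = cis th"
    using z0(1) Arg2pi[of z0] by (auto simp: th_def cis_conv_exp is_Arg_def)
  define j where "j = nat \<lfloor>th * real n / (2 * pi)\<rfloor>"
  define t where "t = th - 2 * pi * real j / real n"
  have j: "real j \<le> th * real n / (2 * pi)" "th * real n / (2 * pi) < real j + 1"
    using th unfolding j_def by (simp_all add: of_nat_nat)
  have "t + real j * (2 * pi * real 1 / real n) = th" by (simp add: t_def)
  then have "cis t * w 1 ^ j = z0" by (simp only: w_def Complex.DeMoivre cis_mult th(2))
  then have "cmod (F (cis t)) \<ge> 1" using F1 steps[of "cis t" j] by simp
  then have "(\<Prod>k<n. cmod (g (cis (t + 2 * pi * real k / real n)))) \<ge> 1"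
    by (simp add: F_def w_def prod_norm cis_mult)
  moreover have "t = (th * real n / (2 * pi) - real j) * (2 * pi / real n)"
    using n by (simp add: t_def left_diff_distrib diff_divide_distrib)
  then have "0 \<le> t" "t < 2 * pi / real n"
    using j n mult_strict_right_mono[of "th * real n / (2 * pi) - real j" 1 "2 * pi / real n"] by simp_all
  ultimately show ?thesis using that by blast
qed

text \<open>After rescaling, the indices are the integers in an open interval \<open>(u, v)\<close>
  of length \<open>real n * (\<beta> - \<alpha>) / (2 * pi)\<close>, and there are at least
  \<open>v - u - 1\<close> of them. The bounds on t, \<alpha> and \<beta> give \<open>u > -1\<close>
  and \<open>v \<le> n\<close>, so all these integers are legitimate indices.\<close>

lemma card_equidistributed_in_interval:
  assumes n: "n > 0" and t: "0 \<le> t" "t < 2 * pi / real n" and "0 \<le> \<alpha>" "\<beta> \<le> 2 * pi"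
  shows "real n * (\<beta> - \<alpha>) / (2 * pi) - 1
    \<le> real (card {k. k < n \<and> \<alpha> < t + 2 * pi * real k / real n \<and> t + 2 * pi * real k / real n < \<beta>})"
    (is "_ \<le> real (card ?A)")
proof -
  define s where "s = real n / (2 * pi)"
  have s: "s > 0" using n by (simp add: s_def)
  have xs: "2 * pi * x / real n = x / s" for x by (simp add: s_def)
  have ts: "t * s < 1"
    using mult_strict_right_mono[OF t(2) s] n by (simp add: s_def)
  define u where "u = (\<alpha> - t) * s"
  define v where "v = (\<beta> - t) * s"
  have "0 \<le> \<alpha> * s" using assms s by simp
  then have u: "u > -1" using ts by (simp add: u_def left_diff_distrib)
  have "v \<le> 2 * pi * s" unfolding v_def using assms s by (intro mult_right_mono) auto
  then have v: "v \<le> real n" by (simp add: s_def)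
  have iff: "\<alpha> < t + 2 * pi * x / real n \<longleftrightarrow> u < x" "t + 2 * pi * x / real n < \<beta> \<longleftrightarrow> x < v" for x
    unfolding xs u_def v_def using pos_less_divide_eq[OF s, of "\<alpha> - t" x] pos_divide_less_eq[OF s, of x "\<beta> - t"]
    by linarith+
  have sub: "nat ` {\<lfloor>u\<rfloor><..<\<lceil>v\<rceil>} \<subseteq> ?A"
  proof
    fix k assume "k \<in> nat ` {\<lfloor>u\<rfloor><..<\<lceil>v\<rceil>}"
    then obtain i where i: "k = nat i" "\<lfloor>u\<rfloor> < i" "i < \<lceil>v\<rceil>" by auto
    have "i \<ge> 0" using u i(2) by linarith
    moreover have "u < of_int i" "of_int i < v" using i by linarith+
    ultimately show "k \<in> ?A" using v iff[of "real k"] i(1) by auto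
  qed
  have inj: "inj_on nat {\<lfloor>u\<rfloor><..<\<lceil>v\<rceil>}"
  proof (rule inj_onI)
    fix i j assume "i \<in> {\<lfloor>u\<rfloor><..<\<lceil>v\<rceil>}" "j \<in> {\<lfloor>u\<rfloor><..<\<lceil>v\<rceil>}" "nat i = nat j"
    moreover from this u have "i \<ge> 0" "j \<ge> 0" by (simp_all, linarith+)
    ultimately show "i = j" by simp
  qed
  have "v - u - 1 \<le> of_int (\<lceil>v\<rceil> - \<lfloor>u\<rfloor> - 1)" by linarith
  also have "\<dots> \<le> real (nat (\<lceil>v\<rceil> - \<lfloor>u\<rfloor> - 1))" by linarith
  also have "\<dots> = real (card (nat ` {\<lfloor>u\<rfloor><..<\<lceil>v\<rceil>}))"
    using inj by (simp add: card_image algebra_simps)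
  also have "\<dots> \<le> real (card ?A)" by (intro of_nat_mono card_mono sub) simp
  finally show ?thesis by (simp add: u_def v_def s_def left_diff_distrib diff_divide_distrib algebra_simps)
qed

text \<open>\<open>\<Theta>\<close> holds the angles at which g is flat. The bound is stated for
  every \<open>R > 0\<close> above the distance rather than for the distance itself: at
  \<open>x = y\<close> the value \<open>0 powr (- \<gamma>) = 0\<close> would give no decay, and one
  R then serves a whole interval.\<close>

locale flat_on_circle =
  fixes g :: "complex \<Rightarrow> complex" and \<Theta> :: "real set" and \<gamma> A c :: real
  assumes cont: "continuous_on (cball 0 1) g" and hol: "g holomorphic_on ball 0 1"
    and g0: "cmod (g 0) \<ge> 1" and c: "c > 0"
    and bound: "\<And>x. cmod (g (cis x)) \<le> exp A"
    and flat: "\<And>x y R. y \<in> \<Theta> \<Longrightarrow> \<bar>x - y\<bar> \<le> R \<Longrightarrow> R > 0 \<Longrightarrow> cmod (g (cis x)) \<le> exp (A - c * R powr (- \<gamma>))"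
begin

text \<open>A substitute for Jensen's inequality \<open>\<integral> ln \<bar>g\<bar> \<ge> 0\<close> on the circle: the product of \<open>\<bar>g\<bar>\<close>
  over \<open>n\<close> suitably rotated equidistributed points is at least \<open>1\<close>; then let \<open>n\<close> tend to
  infinity.\<close>

lemma sum_intervals_le:
  fixes \<alpha> \<beta> R :: "'i \<Rightarrow> real"
  assumes I: "finite I" "disjoint_family_on (\<lambda>i. {\<alpha> i<..<\<beta> i}) I"
    and ab: "\<And>i. i \<in> I \<Longrightarrow> 0 \<le> \<alpha> i" "\<And>i. i \<in> I \<Longrightarrow> \<beta> i \<le> 2 * pi"
    and R: "\<And>i. i \<in> I \<Longrightarrow> R i > 0"
    and near: "\<And>i x. i \<in> I \<Longrightarrow> \<alpha> i < x \<Longrightarrow> x < \<beta> i \<Longrightarrow> \<exists>y\<in>\<Theta>. \<bar>x - y\<bar> \<le> R i"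
  shows "(\<Sum>i\<in>I. (\<beta> i - \<alpha> i) * R i powr (- \<gamma>)) \<le> 2 * pi * A / c"
proof -
  define h where "h i = c * R i powr (- \<gamma>)" for i
  define \<psi> where "\<psi> x = (\<Sum>i\<in>I. if x \<in> {\<alpha> i<..<\<beta> i} then h i else 0)" for x
  have h0: "h i \<ge> 0" for i using c by (simp add: h_def)
  have psi: "cmod (g (cis x)) \<le> exp (A - \<psi> x)" for x
  proof (cases "\<exists>i\<in>I. x \<in> {\<alpha> i<..<\<beta> i}")
    case True
    then obtain i where i: "i \<in> I" "x \<in> {\<alpha> i<..<\<beta> i}" by blast
    have eq: "j = i" if "j \<in> I" "x \<in> {\<alpha> j<..<\<beta> j}" for j
    proof (rule ccontr)
      assume "j \<noteq> i"
      then have "{\<alpha> j<..<\<beta> j} \<inter> {\<alpha> i<..<\<beta> i} = {}"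
        using disjoint_family_onD[OF I(2) that(1) i(1)] by simp
      then show False using that(2) i(2) by blast
    qed
    have "(if x \<in> {\<alpha> j<..<\<beta> j} then h j else 0) = (if j = i then h i else 0)" if "j \<in> I" for j
      using eq[OF that] i(2) by (cases "j = i") auto
    then have "\<psi> x = (\<Sum>j\<in>I. if j = i then h i else 0)"
      unfolding \<psi>_def by (intro sum.cong) auto
    then have "\<psi> x = h i" using I(1) i(1) by simp
    moreover obtain y where "y \<in> \<Theta>" "\<bar>x - y\<bar> \<le> R i"
      using near[OF i(1), of x] i(2) by auto
    ultimately show ?thesis using flat[OF _ _ R[OF i(1)], of y x] by (simp add: h_def)
  next
    case False
    then have "\<psi> x = 0" by (auto simp: \<psi>_def intro!: sum.neutral)
    then show ?thesis using bound by simp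
  qed
  \<comment> \<open>Counting the sample points loses at most one per interval, which costs
    \<open>(\<Sum>i\<in>I. h i) / real n\<close> and disappears in the limit.\<close>
  have main: "(\<Sum>i\<in>I. (\<beta> i - \<alpha> i) * h i) / (2 * pi) \<le> A + (\<Sum>i\<in>I. h i) / real n" if n: "n > 0" for n
  proof -
    obtain t where t: "0 \<le> t" "t < 2 * pi / real n"
      and prod: "(\<Prod>k<n. cmod (g (cis (t + 2 * pi * real k / real n)))) \<ge> 1"
      using exists_equidistributed_large_product[OF cont hol g0 n] .
    define x where "x k = t + 2 * pi * real k / real n" for k :: nat
    have "1 \<le> (\<Prod>k<n. cmod (g (cis (x k))))" using prod by (simp add: x_def)
    also have "\<dots> \<le> (\<Prod>k<n. exp (A - \<psi> (x k)))" by (intro prod_mono) (auto simp: psi)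
    also have "\<dots> = exp (\<Sum>k<n. A - \<psi> (x k))" by (simp add: exp_sum)
    finally have "(\<Sum>k<n. \<psi> (x k)) \<le> real n * A" by (simp add: sum_subtractf)
    moreover have "(\<Sum>k<n. \<psi> (x k)) = (\<Sum>i\<in>I. \<Sum>k<n. if x k \<in> {\<alpha> i<..<\<beta> i} then h i else 0)"
      unfolding \<psi>_def by (rule sum.swap)
    moreover have "(\<Sum>k<n. if x k \<in> {\<alpha> i<..<\<beta> i} then h i else 0)
        = h i * real (card {k. k < n \<and> \<alpha> i < x k \<and> x k < \<beta> i})" for i
      by (subst sum.inter_filter[symmetric]) (auto simp: conj_ac)
    ultimately have "(\<Sum>i\<in>I. h i * real (card {k. k < n \<and> \<alpha> i < x k \<and> x k < \<beta> i})) \<le> real n * A"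
      by simp
    moreover have "(\<Sum>i\<in>I. h i * (real n * (\<beta> i - \<alpha> i) / (2 * pi) - 1))
        \<le> (\<Sum>i\<in>I. h i * real (card {k. k < n \<and> \<alpha> i < x k \<and> x k < \<beta> i}))"
      unfolding x_def by (intro sum_mono mult_left_mono h0 card_equidistributed_in_interval n t ab)
    ultimately have "(\<Sum>i\<in>I. h i * (real n * (\<beta> i - \<alpha> i) / (2 * pi) - 1)) \<le> real n * A" by linarith
    moreover have "(\<Sum>i\<in>I. h i * (real n * (\<beta> i - \<alpha> i) / (2 * pi) - 1))
        = real n * ((\<Sum>i\<in>I. (\<beta> i - \<alpha> i) * h i) / (2 * pi)) - (\<Sum>i\<in>I. h i)"
    proof -
      have "h i * (real n * (\<beta> i - \<alpha> i) / (2 * pi) - 1) = real n / (2 * pi) * ((\<beta> i - \<alpha> i) * h i) - h i" for i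
        by (simp add: right_diff_distrib diff_divide_distrib mult_ac)
      then show ?thesis by (simp add: sum_subtractf sum_divide_distrib[symmetric] sum_distrib_left[symmetric])
    qed
    ultimately have "real n * ((\<Sum>i\<in>I. (\<beta> i - \<alpha> i) * h i) / (2 * pi)) \<le> real n * A + (\<Sum>i\<in>I. h i)"
      by linarith
    also have "\<dots> = real n * (A + (\<Sum>i\<in>I. h i) / real n)" using n by (simp add: distrib_left)
    finally show ?thesis by (rule mult_left_le_imp_le) (use n in simp)
  qed
  have "(\<lambda>n. A + (\<Sum>i\<in>I. h i) / real n) \<longlonglongrightarrow> A + 0"
    by (intro tendsto_intros tendsto_divide_0[OF tendsto_const] filterlim_at_top_imp_at_infinity
        filterlim_real_sequentially)
  moreover have "\<forall>\<^sub>F n in sequentially. (\<Sum>i\<in>I. (\<beta> i - \<alpha> i) * h i) / (2 * pi) \<le> A + (\<Sum>i\<in>I. h i) / real n"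
    using eventually_gt_at_top[of 0] by eventually_elim (rule main)
  ultimately have "(\<Sum>i\<in>I. (\<beta> i - \<alpha> i) * h i) / (2 * pi) \<le> A"
    using tendsto_lowerbound[of "\<lambda>n. A + (\<Sum>i\<in>I. h i) / real n" A sequentially] by simp
  moreover have "(\<Sum>i\<in>I. (\<beta> i - \<alpha> i) * h i) = c * (\<Sum>i\<in>I. (\<beta> i - \<alpha> i) * R i powr (- \<gamma>))"
    by (simp add: h_def sum_distrib_left mult.left_commute)
  ultimately have "c * (\<Sum>i\<in>I. (\<beta> i - \<alpha> i) * R i powr (- \<gamma>)) \<le> 2 * pi * A"
    by (simp add: pos_divide_le_eq mult.commute)
  then show ?thesis using c by (simp add: pos_le_divide_eq mult.commute)
qed

end

section \<open>Gaps of closed sets and Hausdorff dimension\<close>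

text \<open>A component of \<open>{-1..1} - F\<close> may contain -1 or 1, so gaps are not always
  open. They are handled through \<open>Inf\<close> and \<open>Sup\<close>, from whose open interval
  they differ by at most two points.\<close>

lemma connected_bounded_real:
  fixes l :: "real set"
  assumes "connected l" "bounded l" "l \<noteq> {}"
  shows "{Inf l<..<Sup l} \<subseteq> l" "l \<subseteq> {Inf l..Sup l}" "l \<in> sets borel"
    "measure lborel l = Sup l - Inf l"
proof -
  have bdd: "bdd_above l" "bdd_below l"
    using assms(2) by (auto simp: bounded_imp_bdd_above bounded_imp_bdd_below)
  show 1: "{Inf l<..<Sup l} \<subseteq> l"
  proof
    fix x assume "x \<in> {Inf l<..<Sup l}"
    then obtain y z where "y \<in> l" "y < x" "z \<in> l" "x < z"
      using assms(3) bdd by (auto simp: cInf_less_iff less_cSup_iff)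
    then show "x \<in> l" using connectedD_interval[OF assms(1), of y z x] by auto
  qed
  show 2: "l \<subseteq> {Inf l..Sup l}" using bdd by (auto intro: cInf_lower cSup_upper)
  have l: "l = {Inf l<..<Sup l} \<union> (l \<inter> {Inf l, Sup l})" using 1 2 by force
  moreover have "finite (l \<inter> {Inf l, Sup l})" by simp
  then have "l \<inter> {Inf l, Sup l} \<in> sets borel" using finite_imp_closed borel_closed by blast
  ultimately show m: "l \<in> sets borel" by (metis borel_open open_greaterThanLessThan sets.Un)
  have le: "Inf l \<le> Sup l" using assms(3) 2 by force
  have "measure lborel {Inf l<..<Sup l} \<le> measure lborel l"
    by (intro measure_mono_fmeasurable 1 fmeasurableI2[OF _ 2])
       (use m le in \<open>auto simp: fmeasurable_def\<close>)
  moreover have "measure lborel l \<le> measure lborel {Inf l..Sup l}"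
    by (intro measure_mono_fmeasurable 2) (use m le in \<open>auto simp: fmeasurable_def\<close>)
  ultimately show "measure lborel l = Sup l - Inf l" using le by simp
qed

section \<open>The gaps of a closed subset of the interval\<close>

context
  fixes F :: "real set"
  assumes F: "closed F" "F \<subseteq> {-1..1}"
begin

lemma adjacent_interval_props:
  assumes "l \<in> adjacent_intervals F"
  shows "connected l" "l \<noteq> {}" "l \<subseteq> {-1..1}" "l \<inter> F = {}" "bounded l"
    "l \<in> sets borel" "l \<in> fmeasurable lborel"
proof -
  show *: "connected l" "l \<noteq> {}" and l: "l \<subseteq> {-1..1}" "l \<inter> F = {}"
    using assms in_components_connected in_components_nonempty in_components_subset
    unfolding adjacent_intervals_def by blast+
  show b: "bounded l" using l(1) bounded_subset bounded_closed_interval by blast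
  show s: "l \<in> sets borel" using connected_bounded_real[OF * (1) b *(2)] by simp
  then show "l \<in> fmeasurable lborel"
    by (intro fmeasurableI2[OF _ l(1)]) (auto simp: fmeasurable_def)
qed

lemma adjacent_intervals_disjoint:
  assumes "l \<in> adjacent_intervals F" "l' \<in> adjacent_intervals F" "l \<noteq> l'"
  shows "l \<inter> l' = {}"
  using assms components_nonoverlap unfolding adjacent_intervals_def by blast

lemma subset_adjacent_interval:
  assumes "connected c" "c \<subseteq> {-1..1} - F" "x \<in> c" "x \<in> l" "l \<in> adjacent_intervals F"
  shows "c \<subseteq> l"
  using assms components_maximal unfolding adjacent_intervals_def by blast

text \<open>A neighbourhood of a point of l that avoids F stays inside l after intersection with
  \<open>{-1..1}\<close>; even at an end of \<open>{-1..1}\<close> this intersection has interior.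
  Countability of the gaps and positivity of their lengths rest on this.\<close>

lemma interior_adjacent_interval:
  assumes "l \<in> adjacent_intervals F"
  shows "interior l \<noteq> {}"
proof -
  obtain x where x: "x \<in> l" using adjacent_interval_props[OF assms] by auto
  then have "x \<in> -F" "x \<in> {-1..1}" using adjacent_interval_props[OF assms] by auto
  then obtain e where e: "e > 0" "ball x e \<subseteq> -F"
    using F(1) open_contains_ball[of "-F"] by auto
  have "connected ({x-e<..<x+e} \<inter> {-1..1})"
    by (intro convex_connected convex_Int) (auto simp: convex_real_interval)
  then have "{x-e<..<x+e} \<inter> {-1..1} \<subseteq> l"
    by (rule subset_adjacent_interval[OF _ _ _ x assms])
       (use e \<open>x \<in> {-1..1}\<close> in \<open>auto simp: ball_eq_greaterThanLessThan\<close>)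
  then have sub: "{x-e<..<x+e} \<inter> {-1<..<1} \<subseteq> interior l"
    by (intro interior_maximal open_Int) auto
  have "max (x - e) (-1) < min (x + e) 1" using e \<open>x \<in> {-1..1}\<close> by auto
  then obtain y where "max (x - e) (-1) < y" "y < min (x + e) 1" using dense by blast
  then have "y \<in> {x-e<..<x+e} \<inter> {-1<..<1}" by auto
  then show ?thesis using sub by blast
qed

lemma countable_adjacent_intervals: "countable (adjacent_intervals F)"
  by (rule countable_disjoint_nonempty_interior_subsets)
     (auto simp: pairwise_def disjnt_def adjacent_intervals_disjoint interior_adjacent_interval)

text \<open>A gap that meets \<open>{x..y}\<close> and leaves it would, being connected, contain x
  or y.\<close>

lemma adjacent_interval_between:
  assumes "x \<in> F" "y \<in> F" "u \<in> {x..y}" "u \<notin> F"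
  obtains l where "l \<in> adjacent_intervals F" "l \<subseteq> {x..y}" "u \<in> l"
proof -
  have "u \<in> {-1..1} - F" using assms F by auto
  then obtain l where l: "l \<in> adjacent_intervals F" "u \<in> l"
    unfolding adjacent_intervals_def by (metis UnionE Union_components)
  have "v \<in> {x..y}" if "v \<in> l" for v
  proof (rule ccontr)
    assume v: "v \<notin> {x..y}"
    have "x \<in> l \<or> y \<in> l"
      using connectedD_interval[OF adjacent_interval_props(1)[OF l(1)]] that l(2) v assms(3)
      by (cases "v < x") (metis atLeastAtMost_iff less_imp_le not_le)+
    then show False using adjacent_interval_props(4)[OF l(1)] assms by auto
  qed
  then show ?thesis using l that by blast
qed

text \<open>On the side of a point of l where F has a point, the nearest point of F is an end of l.
  One end is all that can be had, as a gap may reach -1 or 1, and F must be nonempty because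
  otherwise the only gap is \<open>{-1..1}\<close>.\<close>

lemma endpoint_in_closed_set:
  assumes l: "l \<in> adjacent_intervals F" and "F \<noteq> {}"
  shows "Inf l \<in> F \<or> Sup l \<in> F"
proof -
  note p = adjacent_interval_props[OF l]
  obtain x where x: "x \<in> l" using p by auto
  obtain f where f: "f \<in> F" using assms by auto
  have "f \<noteq> x" using p x f by auto
  then consider "f < x" | "x < f" by linarith
  then show ?thesis
  proof cases
    case 1
    define s where "s = Sup (F \<inter> {..x})"
    have ne: "F \<inter> {..x} \<noteq> {}" "bdd_above (F \<inter> {..x})" using f 1 by auto
    have s: "s \<in> F \<inter> {..x}" unfolding s_def
      using F(1) ne by (intro closed_contains_Sup) auto
    have up: "z \<le> s" if "z \<in> F" "z \<le> x" for z
      unfolding s_def using that ne by (intro cSup_upper) auto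
    have sx: "s < x" using s x p by (metis IntD1 IntD2 atMost_iff disjoint_iff order_less_le)
    have "{s<..x} \<subseteq> {-1..1} - F"
    proof
      fix z assume z: "z \<in> {s<..x}"
      then have "z \<notin> F" using up[of z] by auto
      then show "z \<in> {-1..1} - F" using z s F(2) x p(3) by fastforce
    qed
    then have "{s<..x} \<subseteq> l"
      using sx by (intro subset_adjacent_interval[OF _ _ _ x l]) (auto intro: convex_connected)
    then have in_l: "w \<in> l" if "s < w" "w < x" for w using that by auto
    have "s \<le> z" if "z \<in> l" for z
      using connectedD_interval[OF p(1) that x, of s] sx s p(4) by (metis IntD1 IntI empty_iff less_imp_le not_le)
    then have "Inf l = s"
      by (intro cInf_eq_non_empty p dense_ge_bounded[OF sx]) (auto simp: in_l)
    then show ?thesis using s by simp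
  next
    case 2
    define s where "s = Inf (F \<inter> {x..})"
    have ne: "F \<inter> {x..} \<noteq> {}" "bdd_below (F \<inter> {x..})" using f 2 by auto
    have s: "s \<in> F \<inter> {x..}" unfolding s_def
      using F(1) ne by (intro closed_contains_Inf) auto
    have up: "s \<le> z" if "z \<in> F" "x \<le> z" for z
      unfolding s_def using that ne by (intro cInf_lower) auto
    have sx: "x < s" using s x p by (metis IntD1 IntD2 atLeast_iff disjoint_iff order_less_le)
    have "{x..<s} \<subseteq> {-1..1} - F"
    proof
      fix z assume z: "z \<in> {x..<s}"
      then have "z \<notin> F" using up[of z] by auto
      then show "z \<in> {-1..1} - F" using z s F(2) x p(3) by fastforce
    qed
    then have "{x..<s} \<subseteq> l"
      using sx by (intro subset_adjacent_interval[OF _ _ _ x l]) (auto intro: convex_connected)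
    then have in_l: "w \<in> l" if "x < w" "w < s" for w using that by auto
    have "z \<le> s" if "z \<in> l" for z
      using connectedD_interval[OF p(1) x that, of s] sx s p(4) by (metis IntD1 IntI empty_iff less_imp_le not_le)
    then have "Sup l = s"
      by (intro cSup_eq_non_empty p dense_le_bounded[OF sx]) (auto simp: in_l)
    then show ?thesis using s by simp
  qed
qed

lemma summable_on_adjacent_intervals: "measure lborel summable_on adjacent_intervals F"
proof (rule nonneg_bdd_above_summable_on)
  have "sum (measure lborel) L \<le> 2" if "L \<subseteq> adjacent_intervals F" "finite L" for L
  proof -
    have "sum (measure lborel) L = measure lborel (\<Union>L)"
      using measure_UNION'[OF that(2), of "\<lambda>l. l" lborel] adjacent_interval_props(7) adjacent_intervals_disjoint that
      by (fastforce simp: pairwise_def disjnt_def)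
    also have "\<dots> \<le> measure lborel {-1..1::real}"
    proof (rule measure_mono_fmeasurable)
      show "\<Union>L \<subseteq> {-1..1}" using adjacent_interval_props(3) that by blast
      show "\<Union>L \<in> sets lborel"
        using adjacent_interval_props(6) that by (intro sets.finite_Union) auto
    qed (auto simp: fmeasurable_def)
    finally show ?thesis by simp
  qed
  then show "bdd_above (sum (measure lborel) ` {L. L \<subseteq> adjacent_intervals F \<and> finite L})"
    by (auto simp: bdd_above_def)
qed auto

text \<open>As \<open>\<epsilon> \<le> 1\<close>, every length is at most \<open>measure l powr \<epsilon> * S powr ((1 - \<epsilon>) / \<epsilon>)\<close> with
  \<open>S\<close> the sum of the \<open>\<epsilon>\<close>-th powers.\<close>

lemma dist_le_infsum_adjacent_intervals:
  assumes null: "F \<in> null_sets lborel" and xy: "x \<in> F" "y \<in> F" "x \<le> y"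
    and eps: "0 < \<epsilon>" "\<epsilon> \<le> 1"
    and sum: "(\<lambda>l. measure lborel l powr \<epsilon>) summable_on adjacent_intervals F"
  defines "S \<equiv> (\<Sum>\<^sub>\<infinity>l\<in>{l \<in> adjacent_intervals F. l \<subseteq> {x..y}}. measure lborel l powr \<epsilon>)"
  shows "y - x \<le> S powr (1 / \<epsilon>)"
proof -
  let ?M = "{l \<in> adjacent_intervals F. l \<subseteq> {x..y}}"
  have sM: "(\<lambda>l. measure lborel l powr \<epsilon>) summable_on ?M"
    using sum by (rule summable_on_subset_banach) auto
  have S0: "S \<ge> 0" unfolding S_def by (intro infsum_nonneg) auto
  have one: "measure lborel l \<le> measure lborel l powr \<epsilon> * S powr ((1 - \<epsilon>) / \<epsilon>)" if "l \<in> ?M" for l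
  proof -
    have "measure lborel l powr \<epsilon> \<le> S"
      using finite_sum_le_infsum[OF sM, of "{l}"] that by (simp add: S_def)
    then have "(measure lborel l powr \<epsilon>) powr ((1 - \<epsilon>) / \<epsilon>) \<le> S powr ((1 - \<epsilon>) / \<epsilon>)"
      using eps by (intro powr_mono2) auto
    then have "measure lborel l powr (1 - \<epsilon>) \<le> S powr ((1 - \<epsilon>) / \<epsilon>)"
      using eps by (simp add: powr_powr)
    then have "measure lborel l powr \<epsilon> * measure lborel l powr (1 - \<epsilon>)
        \<le> measure lborel l powr \<epsilon> * S powr ((1 - \<epsilon>) / \<epsilon>)"
      by (intro mult_left_mono) auto
    then show ?thesis by (simp flip: powr_add)
  qed
  have fin: "measure lborel (\<Union>L) \<le> S powr (1 / \<epsilon>)" if L: "L \<subseteq> ?M" "finite L" for L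
  proof -
    have "measure lborel (\<Union>L) \<le> (\<Sum>l\<in>L. measure lborel l)"
      using L adjacent_interval_props(6) by (intro measure_Union_le) auto
    also have "\<dots> \<le> (\<Sum>l\<in>L. measure lborel l powr \<epsilon> * S powr ((1 - \<epsilon>) / \<epsilon>))"
      using L one by (intro sum_mono) blast
    also have "\<dots> = (\<Sum>l\<in>L. measure lborel l powr \<epsilon>) * S powr ((1 - \<epsilon>) / \<epsilon>)"
      by (simp add: sum_distrib_right)
    also have "\<dots> \<le> S * S powr ((1 - \<epsilon>) / \<epsilon>)"
      unfolding S_def using L by (intro mult_right_mono finite_sum_le_infsum sM) auto
    also have "\<dots> = S powr (1 / \<epsilon>)"
    proof (cases "S = 0")
      case False
      then have "S * S powr ((1 - \<epsilon>) / \<epsilon>) = S powr (1 + (1 - \<epsilon>) / \<epsilon>)" using S0 by (simp add: powr_add)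
      also have "1 + (1 - \<epsilon>) / \<epsilon> = 1 / \<epsilon>" using eps by (simp add: field_simps)
      finally show ?thesis .
    qed simp
    finally show ?thesis .
  qed
  have cM: "countable ?M" using countable_adjacent_intervals by (rule countable_subset[rotated]) auto
  have fm: "\<Union>?M \<in> fmeasurable lborel" and le: "measure lborel (\<Union>?M) \<le> S powr (1 / \<epsilon>)"
    using fmeasurable_Union_bound[OF cM _ fin] measure_Union_bound[OF cM _ fin] adjacent_interval_props(7) by auto
  \<comment> \<open>Since F is null, the gaps inside \<open>{x..y}\<close> carry its whole
    length.\<close>
  have "{x..y} \<subseteq> \<Union>?M \<union> F"
    using adjacent_interval_between[OF xy(1,2)] by blast
  moreover have "\<Union>?M \<union> F \<in> fmeasurable lborel"
    using fm null by (auto simp: fmeasurable_def emeasure_Un_null_set)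
  ultimately have "measure lborel {x..y} \<le> measure lborel (\<Union>?M \<union> F)"
    by (intro measure_mono_fmeasurable) auto
  also have "\<dots> = measure lborel (\<Union>?M)"
    using fm null by (intro measure_Un_null_set) auto
  finally show ?thesis using le xy(3) by simp
qed

end

section \<open>From summable gap lengths to Hausdorff measure zero\<close>

lemma infsum_UN_disjoint_finite:
  fixes f :: "'a \<Rightarrow> real"
  assumes "finite I" "disjoint_family_on A I" "f summable_on B" "\<And>i. i \<in> I \<Longrightarrow> A i \<subseteq> B"
  shows "(\<Sum>\<^sub>\<infinity>x\<in>(\<Union>i\<in>I. A i). f x) = (\<Sum>i\<in>I. \<Sum>\<^sub>\<infinity>x\<in>A i. f x)"
  using assms
proof (induction I rule: finite_induct)
  case (insert i I)
  have "A i \<inter> (\<Union>j\<in>I. A j) = {}"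
    using insert.hyps insert.prems(1) unfolding disjoint_family_on_def by fastforce
  moreover have "f summable_on A i" "f summable_on (\<Union>j\<in>I. A j)"
    using insert.prems by (auto intro: summable_on_subset_banach[of f B])
  moreover have "disjoint_family_on A I"
    using insert.prems(1) by (auto simp: disjoint_family_on_def)
  ultimately show ?case
    using insert by (simp add: infsum_Un_disjoint)
qed simp

text \<open>The covering of \<open>E\<close> consists of its parts which are not separated by the gaps of a finite
  set \<open>G\<close> carrying almost the whole sum.\<close>

lemma hausdorff_measure_eq_0_of_summable:
  fixes E :: "real set"
  assumes E: "closed E" "E \<subseteq> {-1..1}" "E \<in> null_sets lborel"
    and eps: "0 < \<epsilon>" "\<epsilon> \<le> 1"
    and sum: "(\<lambda>l. measure lborel l powr \<epsilon>) summable_on adjacent_intervals E"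
  shows "hausdorff_measure \<epsilon> (complex_of_real ` E) = 0"
proof -
  let ?L = "adjacent_intervals E" and ?f = "\<lambda>l. measure lborel l powr \<epsilon>"
  have le: "hausdorff_premeasure \<epsilon> \<delta> (complex_of_real ` E) \<le> ennreal \<eta>" if "\<delta> > 0" "\<eta> > 0" for \<delta> \<eta>
  proof -
    \<comment> \<open>One threshold with two tasks: staying below \<eta> bounds the premeasure, and
      staying below \<open>\<delta> powr \<epsilon>\<close> forces every piece of the covering to
      have diameter at most \<delta>.\<close>
    have "min \<eta> (\<delta> powr \<epsilon>) > 0" using that by simp
    then have "min \<eta> (\<delta> powr \<epsilon>) / 2 > 0" by simp
    from infsum_finite_approximation[OF sum this]
    obtain G where G: "finite G" "G \<subseteq> ?L" "dist (sum ?f G) (infsum ?f ?L) \<le> min \<eta> (\<delta> powr \<epsilon>) / 2"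
      by blast
    have "dist (sum ?f G) (infsum ?f ?L) < min \<eta> (\<delta> powr \<epsilon>)" using G(3) \<open>min \<eta> (\<delta> powr \<epsilon>) > 0\<close> by linarith
    have "infsum ?f ?L = infsum ?f (?L - G) + infsum ?f G"
      using infsum_Un_disjoint[OF summable_on_cofin_subset[OF sum G(1)] summable_on_finite[OF G(1)]] G(2)
      by (simp add: Un_absorb2 Diff_disjoint Int_commute)
    then have small: "infsum ?f (?L - G) < min \<eta> (\<delta> powr \<epsilon>)"
      using G(1) \<open>dist _ _ < _\<close> by (simp add: dist_real_def abs_less_iff)
    \<comment> \<open>For x in E each gap lies on one side of x, so \<open>left x\<close> is the set
      of gaps of G to the left of x. Points with the same record have no gap of G between them, and
      \<open>M T\<close> collects the remaining gaps lying between two points of the piece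
      \<open>P T\<close>.\<close>
    define left where "left x = {l \<in> G. \<exists>u\<in>l. u < x}" for x
    define P where "P T = {x \<in> E. left x = T}" for T
    define M where "M T = {l \<in> ?L - G. \<exists>x\<in>P T. \<exists>y\<in>P T. l \<subseteq> {x..y}}" for T
    define S where "S T = infsum ?f (M T)" for T
    have sM: "?f summable_on M T" for T
      using sum by (rule summable_on_subset_banach) (auto simp: M_def)
    have S0: "S T \<ge> 0" for T unfolding S_def by (intro infsum_nonneg) auto
    have dist_le: "y - x \<le> S T powr (1 / \<epsilon>)" if xy: "x \<in> P T" "y \<in> P T" "x \<le> y" for x y T
    proof -
      have "{l \<in> ?L. l \<subseteq> {x..y}} \<subseteq> M T"
      proof
        fix l assume l: "l \<in> {l \<in> ?L. l \<subseteq> {x..y}}"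
        have "l \<notin> G"
        proof
          assume "l \<in> G"
          obtain u where u: "u \<in> l" using adjacent_interval_props(2)[OF E(1,2)] l by blast
          have "u \<noteq> y" using adjacent_interval_props(4)[OF E(1,2)] l u xy by (auto simp: P_def)
          then have "u < y" using u l by fastforce
          then have "l \<in> left y" using \<open>l \<in> G\<close> u by (auto simp: left_def)
          moreover have "l \<notin> left x" using l by (fastforce simp: left_def)
          ultimately show False using xy by (auto simp: P_def)
        qed
        then show "l \<in> M T" using l xy by (auto simp: M_def)
      qed
      then have "infsum ?f {l \<in> ?L. l \<subseteq> {x..y}} \<le> S T" unfolding S_def
        by (intro infsum_mono2 sM summable_on_subset_banach[OF sum]) auto
      then have "infsum ?f {l \<in> ?L. l \<subseteq> {x..y}} powr (1 / \<epsilon>) \<le> S T powr (1 / \<epsilon>)"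
        using eps by (intro powr_mono2 infsum_nonneg) auto
      moreover have "y - x \<le> infsum ?f {l \<in> ?L. l \<subseteq> {x..y}} powr (1 / \<epsilon>)"
        using xy by (intro dist_le_infsum_adjacent_intervals[OF E(1,2,3)] eps sum) (auto simp: P_def)
      ultimately show ?thesis by linarith
    qed
    have diam: "diameter (complex_of_real ` P T) \<le> S T powr (1 / \<epsilon>)" for T
    proof (rule diameter_le)
      fix a b assume "a \<in> complex_of_real ` P T" "b \<in> complex_of_real ` P T"
      then obtain x y where "a = of_real x" "b = of_real y" "x \<in> P T" "y \<in> P T" by auto
      then show "norm (a - b) \<le> S T powr (1 / \<epsilon>)"
        using dist_le[of x T y] dist_le[of y T x] by (cases "x \<le> y") (auto simp flip: of_real_diff)
    qed auto
    \<comment> \<open>A gap l between two points of a piece determines the record of that piece.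
      Hence no gap belongs to two of the sets \<open>M T\<close>, and their sums add up to at most
      the tail outside G.\<close>
    have same_left: "left x = {m \<in> G. \<exists>u\<in>m. \<exists>v\<in>l. u < v}"
      if "x \<in> P T" "y \<in> P T" "l \<subseteq> {x..y}" "l \<noteq> {}" for x y l T
    proof
      show "left x \<subseteq> {m \<in> G. \<exists>u\<in>m. \<exists>v\<in>l. u < v}"
        using that(3,4) by (force simp: left_def)
      have "{m \<in> G. \<exists>u\<in>m. \<exists>v\<in>l. u < v} \<subseteq> left y"
        using that(3) by (force simp: left_def)
      then show "{m \<in> G. \<exists>u\<in>m. \<exists>v\<in>l. u < v} \<subseteq> left x" using that by (simp add: P_def)
    qed
    have "disjoint_family_on M (Pow G)"
    proof (unfold disjoint_family_on_def, intro ballI impI, rule ccontr)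
      fix T T' assume "T \<noteq> T'" "M T \<inter> M T' \<noteq> {}"
      then obtain l where "l \<in> M T" "l \<in> M T'" by blast
      then obtain x y x' y' where l: "l \<in> ?L" "x \<in> P T" "y \<in> P T" "l \<subseteq> {x..y}"
        "x' \<in> P T'" "y' \<in> P T'" "l \<subseteq> {x'..y'}" by (auto simp: M_def)
      have "l \<noteq> {}" using adjacent_interval_props(2)[OF E(1,2)] l(1) by blast
      then have "left x = left x'" using same_left l by simp
      then show False using l(2,5) \<open>T \<noteq> T'\<close> by (auto simp: P_def)
    qed
    moreover have "M T \<subseteq> ?L" for T by (auto simp: M_def)
    ultimately have "(\<Sum>T\<in>Pow G. S T) = infsum ?f (\<Union>T\<in>Pow G. M T)"
      unfolding S_def using G(1) sum by (intro infsum_UN_disjoint_finite[symmetric, where B="?L"]) auto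
    also have "\<dots> \<le> infsum ?f (?L - G)"
      by (intro infsum_mono2 summable_on_subset_banach[OF sum]) (auto simp: M_def)
    finally have total: "(\<Sum>T\<in>Pow G. S T) < min \<eta> (\<delta> powr \<epsilon>)" using small by simp
    obtain h where h: "bij_betw h {0..<card (Pow G)} (Pow G)"
      using ex_bij_betw_nat_finite[of "Pow G"] G(1) by auto
    \<comment> \<open>The pieces are enumerated by all subsets of G, many of them empty; the
      sequence is continued by empty sets, which contribute 0 by the convention in
      \<open>diam_power\<close>.\<close>
    define U where "U i = (if i < card (Pow G) then complex_of_real ` P (h i) else {})" for i
    have "complex_of_real ` E \<subseteq> (\<Union>i. U i)"
    proof
      fix z assume "z \<in> complex_of_real ` E"
      then obtain x where x: "x \<in> E" "z = of_real x" by auto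
      have "left x \<in> Pow G" by (auto simp: left_def)
      then obtain i where "i < card (Pow G)" "h i = left x"
        using h unfolding bij_betw_def by (metis (no_types, lifting) atLeastLessThan_iff imageE)
      then have "z \<in> U i" using x by (auto simp: U_def P_def)
      then show "z \<in> (\<Union>i. U i)" by blast
    qed
    moreover have "bounded (U i)" for i
    proof (rule bounded_subset)
      show "bounded (cball (0::complex) 1)" by simp
      have "cmod (of_real x) \<le> 1" if "x \<in> E" for x
        using subsetD[OF E(2) that] by (simp add: abs_le_iff)
      then show "U i \<subseteq> cball 0 1" by (auto simp: U_def P_def)
    qed
    moreover have "diameter (U i) \<le> \<delta>" for i
    proof (cases "i < card (Pow G)")
      case True
      then have "h i \<in> Pow G" using h by (auto simp: bij_betw_def)
      then have "S (h i) \<le> (\<Sum>T\<in>Pow G. S T)" using G(1) S0 by (intro member_le_sum) auto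
      then have "S (h i) powr (1 / \<epsilon>) \<le> (\<delta> powr \<epsilon>) powr (1 / \<epsilon>)"
        using total S0 eps by (intro powr_mono2) auto
      then show ?thesis using diam[of "h i"] True eps \<open>\<delta> > 0\<close> by (simp add: U_def powr_powr)
    qed (use \<open>\<delta> > 0\<close> in \<open>simp add: U_def\<close>)
    ultimately have "hausdorff_premeasure \<epsilon> \<delta> (complex_of_real ` E) \<le> (\<Sum>i. diam_power \<epsilon> (U i))"
      unfolding hausdorff_premeasure_def by (intro INF_lower) auto
    also have "\<dots> = (\<Sum>i<card (Pow G). diam_power \<epsilon> (U i))"
      by (intro suminf_finite) (auto simp: U_def diam_power_def)
    also have "\<dots> \<le> (\<Sum>i<card (Pow G). ennreal (S (h i)))"
    proof (intro sum_mono)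
      fix i assume "i \<in> {..<card (Pow G)}"
      then have "diameter (U i) powr \<epsilon> \<le> (S (h i) powr (1 / \<epsilon>)) powr \<epsilon>"
        using diam[of "h i"] eps diameter_ge_0[OF \<open>bounded (U i)\<close>] by (intro powr_mono2) (auto simp: U_def)
      then have "diameter (U i) powr \<epsilon> \<le> S (h i)" using eps S0 by (simp add: powr_powr)
      then show "diam_power \<epsilon> (U i) \<le> ennreal (S (h i))"
        using eps by (auto simp: diam_power_def intro: ennreal_leI)
    qed
    also have "\<dots> = ennreal (\<Sum>i<card (Pow G). S (h i))" by (simp add: S0 sum_ennreal)
    also have "(\<Sum>i<card (Pow G). S (h i)) = (\<Sum>T\<in>Pow G. S T)"
      using sum.reindex_bij_betw[OF h, of S] by (simp add: atLeast0LessThan)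
    also have "ennreal \<dots> \<le> ennreal \<eta>" using total by (intro ennreal_leI) simp
    finally show ?thesis .
  qed
  have "hausdorff_premeasure \<epsilon> \<delta> (complex_of_real ` E) \<le> 0" if "\<delta> > 0" for \<delta>
    by (rule ennreal_le_epsilon) (use le[OF that] in simp)
  then show ?thesis unfolding hausdorff_measure_def by simp
qed

text \<open>Exponents up to 1 are covered by the vanishing of the measure. The exponent 1 itself is
  always admissible, because the lengths of the gaps have sum at most 2, and it settles all larger
  exponents.\<close>

lemma hausdorff_dim_le_convergence_exponent:
  fixes E :: "real set"
  assumes E: "closed E" "E \<subseteq> {-1..1}" "E \<in> null_sets lborel"
  shows "hausdorff_dim (complex_of_real ` E) \<le> convergence_exponent E"
proof -
  have dim: "hausdorff_dim (complex_of_real ` E) \<le> ereal \<epsilon>"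
    if "0 < \<epsilon>" "\<epsilon> \<le> 1" "(\<lambda>l. measure lborel l powr \<epsilon>) summable_on adjacent_intervals E" for \<epsilon>
    unfolding hausdorff_dim_def
    using hausdorff_measure_eq_0_of_summable[OF E that] that(1) by (intro Inf_lower) auto
  have one: "hausdorff_dim (complex_of_real ` E) \<le> ereal 1"
    using summable_on_adjacent_intervals[OF E(1,2)] by (intro dim) auto
  have "hausdorff_dim (complex_of_real ` E) \<le> ereal \<epsilon>"
    if "0 < \<epsilon>" "(\<lambda>l. measure lborel l powr \<epsilon>) summable_on adjacent_intervals E" for \<epsilon>
  proof (cases "\<epsilon> \<le> 1")
    case False
    then show ?thesis by (intro order.trans[OF one]) simp
  qed (use dim that in blast)
  then show ?thesis unfolding convergence_exponent_def by (intro Inf_greatest) auto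
qed

section \<open>Boundary sets on which a bounded analytic function is flat\<close>

lemma abs_cos_diff_le: "\<bar>cos x - cos y\<bar> \<le> \<bar>x - y\<bar>" for x y :: real
proof -
  have "\<bar>cos x - cos y\<bar> = 2 * \<bar>sin ((x + y) / 2)\<bar> * \<bar>sin ((y - x) / 2)\<bar>"
    by (simp add: cos_diff_cos abs_mult)
  also have "\<dots> \<le> 2 * 1 * \<bar>(y - x) / 2\<bar>"
    by (intro mult_mono abs_sin_x_le_abs_x) auto
  finally show ?thesis by (simp add: abs_minus_commute)
qed

context flat_on_circle
begin

text \<open>A discrete form of the divergence of the integral of \<open>1 / x\<close> at 0: on each
  dyadic interval to the right of y the product of length and inverse distance bound is 1/2, so N of
  them contribute \<open>N / 2\<close> against a fixed bound.\<close>

lemma exponent_one_imp_empty: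
  assumes "\<gamma> = 1" "\<Theta> \<subseteq> {0..pi}"
  shows "\<Theta> = {}"
proof (rule ccontr)
  assume "\<Theta> \<noteq> {}"
  then obtain y where y: "y \<in> \<Theta>" "0 \<le> y" "y \<le> pi" using assms(2) by fastforce
  have "real N / 2 \<le> 2 * pi * A / c" for N
  proof -
    define \<alpha> where "\<alpha> i = y + (1/2) ^ Suc i" for i
    define \<beta> where "\<beta> i = y + (1/2) ^ i" for i
    have mono: "\<beta> j \<le> \<alpha> i" if "i < j" for i j
      using that unfolding \<alpha>_def \<beta>_def by (intro add_left_mono power_decreasing) auto
    have "(\<Sum>i<N. (\<beta> i - \<alpha> i) * ((1/2) ^ i) powr (- \<gamma>)) \<le> 2 * pi * A / c"
    proof (rule sum_intervals_le)
      show "disjoint_family_on (\<lambda>i. {\<alpha> i<..<\<beta> i}) {..<N}"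
      proof (unfold disjoint_family_on_def, intro ballI impI)
        fix i j :: nat assume "i \<noteq> j"
        then consider "i < j" | "j < i" by linarith
        then show "{\<alpha> i<..<\<beta> i} \<inter> {\<alpha> j<..<\<beta> j} = {}" by cases (use mono in fastforce)+
      qed
      show "0 \<le> \<alpha> i" for i using y by (simp add: \<alpha>_def)
      have "(1/2::real) ^ i \<le> 1" for i by (simp add: power_le_one)
      then show "\<beta> i \<le> 2 * pi" for i using y pi_gt3 unfolding \<beta>_def by (smt (verit))
      show "\<exists>z\<in>\<Theta>. \<bar>x - z\<bar> \<le> (1/2) ^ i" if "\<alpha> i < x" "x < \<beta> i" for i x
      proof (rule bexI[OF _ y(1)])
        have "0 < (1/2::real) ^ Suc i" by simp
        then show "\<bar>x - y\<bar> \<le> (1/2) ^ i" using that unfolding \<alpha>_def \<beta>_def by linarith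
      qed
    qed auto
    moreover have "(\<beta> i - \<alpha> i) * ((1/2) ^ i) powr (- \<gamma>) = 1/2" for i
      by (simp add: \<alpha>_def \<beta>_def assms(1) powr_minus)
    ultimately show ?thesis by simp
  qed
  moreover obtain N where "real N > 2 * (2 * pi * A / c)" using reals_Archimedean2 by blast
  ultimately show False by (smt (verit) field_sum_of_halves)
qed

text \<open>A grid cell of length s that meets \<open>\<Theta>\<close> contributes
  \<open>s * s powr (- \<gamma>)\<close>. So the number of such cells times s is of order
  \<open>s powr \<gamma>\<close>, and the cosine, being 1-Lipschitz, does not enlarge the covering
  by more than a constant.\<close>

lemma null_sets_cos_image:
  assumes "\<gamma> > 0" "\<Theta> \<subseteq> {0..pi}" "closed (cos ` \<Theta>)"
  shows "cos ` \<Theta> \<in> null_sets lborel"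
proof -
  have comp: "compact (cos ` \<Theta>)"
    using assms(3) bounded_subset[of "{-1..1::real}" "cos ` \<Theta>"] by (simp add: compact_eq_bounded_closed image_subset_iff)
  have le: "measure lborel (cos ` \<Theta>) \<le> 4 * pi * A / c * (pi / real N) powr \<gamma>" if N: "N > 0" for N
  proof -
    define s where "s = pi / real N"
    have s: "s > 0" using N by (simp add: s_def)
    define K where "K = {i. i < N \<and> \<Theta> \<inter> {real i * s..real (Suc i) * s} \<noteq> {}}"
    have K: "finite K" by (simp add: K_def)
    have "(\<Sum>i\<in>K. (real (Suc i) * s - real i * s) * s powr (- \<gamma>)) \<le> 2 * pi * A / c"
    proof (rule sum_intervals_le[OF K])
      show "disjoint_family_on (\<lambda>i. {real i * s<..<real (Suc i) * s}) K"
      proof (unfold disjoint_family_on_def, intro ballI impI)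
        have *: "real (Suc i) * s \<le> real j * s" if "i < j" for i j
          using that s by (intro mult_right_mono) auto
        fix i j :: nat assume "i \<noteq> j"
        then consider "i < j" | "j < i" by linarith
        then show "{real i * s<..<real (Suc i) * s} \<inter> {real j * s<..<real (Suc j) * s} = {}"
          by cases (use * in fastforce)+
      qed
      show "0 \<le> real i * s" for i using s by simp
      show "real (Suc i) * s \<le> 2 * pi" if "i \<in> K" for i
      proof -
        have "real (Suc i) * s \<le> real N * s" using that s by (intro mult_right_mono) (auto simp: K_def)
        also have "\<dots> \<le> 2 * pi" using N by (simp add: s_def)
        finally show ?thesis .
      qed
      show "\<exists>y\<in>\<Theta>. \<bar>x - y\<bar> \<le> s" if iK: "i \<in> K" and "real i * s < x" "x < real (Suc i) * s" for i x
      proof -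
        obtain y where y: "y \<in> \<Theta>" "real i * s \<le> y" "y \<le> real (Suc i) * s"
          using iK unfolding K_def by auto
        have "real (Suc i) * s = real i * s + s" by (simp add: algebra_simps)
        then have "\<bar>x - y\<bar> \<le> s" using y that by linarith
        then show ?thesis using y(1) by blast
      qed
    qed (use s in auto)
    then have cardK: "real (card K) * (s * s powr (- \<gamma>)) \<le> 2 * pi * A / c"
      by (simp add: algebra_simps)
    have "cos ` \<Theta> \<subseteq> (\<Union>i\<in>K. cball (cos (real i * s)) s)"
    proof
      fix x assume "x \<in> cos ` \<Theta>"
      then obtain y where y: "y \<in> \<Theta>" "x = cos y" "0 \<le> y" "y \<le> pi" using assms(2) by auto
      obtain i where i: "i < N" "real i * s \<le> y" "y \<le> real (Suc i) * s"
      proof (cases "y = pi")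
        case True
        have "real (Suc (N - 1)) * s = pi" using N by (simp add: s_def)
        moreover have "real (N - 1) * s \<le> real (Suc (N - 1)) * s" using s by (intro mult_right_mono) auto
        ultimately show ?thesis using True N that[of "N - 1"] by simp
      next
        case False
        define i where "i = nat \<lfloor>y / s\<rfloor>"
        have "real i \<le> y / s" "y / s < real i + 1"
          using y s unfolding i_def by (auto simp: of_nat_nat)
        then have b: "real i * s \<le> y" "y \<le> real (Suc i) * s"
          using s by (auto simp: field_simps)
        have "y / s < pi / s" using False y s by (intro divide_strict_right_mono) auto
        then have "real i < real N" using \<open>real i \<le> y / s\<close> N by (simp add: s_def)
        then show ?thesis using b that by simp
      qed
      have "real (Suc i) * s = real i * s + s" by (simp add: algebra_simps)
      then have "\<bar>real i * s - y\<bar> \<le> s" using i by linarith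
      then have "x \<in> cball (cos (real i * s)) s"
        using abs_cos_diff_le[of "real i * s" y] y(2) by (simp add: dist_real_def)
      moreover have "i \<in> K" using i y(1) by (auto simp: K_def)
      ultimately show "x \<in> (\<Union>i\<in>K. cball (cos (real i * s)) s)" by blast
    qed
    then have "measure lborel (cos ` \<Theta>) \<le> measure lborel (\<Union>i\<in>K. cball (cos (real i * s)) s)"
      using K comp by (intro measure_mono_fmeasurable fmeasurable_compact compact_UN) (auto intro: borel_compact)
    also have "\<dots> \<le> (\<Sum>i\<in>K. measure lborel (cball (cos (real i * s)) s))"
      using K by (intro measure_UNION_le) auto
    also have "\<dots> = real (card K) * (2 * s)" using s by (simp add: cball_eq_atLeastAtMost)
    also have "\<dots> = 2 * s powr \<gamma> * (real (card K) * (s * s powr (- \<gamma>)))"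
      using s by (simp add: powr_minus field_simps)
    also have "\<dots> \<le> 2 * s powr \<gamma> * (2 * pi * A / c)" by (intro mult_left_mono cardK) auto
    finally show ?thesis by (simp add: s_def mult_ac)
  qed
  have "(\<lambda>N. (pi / real N) powr \<gamma>) \<longlonglongrightarrow> 0"
    by (rule tendsto_zero_powrI[OF lim_const_over_n tendsto_const _ assms(1)]) simp
  from tendsto_mult_right_zero[OF this]
  have "(\<lambda>N. 4 * pi * A / c * (pi / real N) powr \<gamma>) \<longlonglongrightarrow> 0" .
  moreover have "\<forall>\<^sub>F N in sequentially. measure lborel (cos ` \<Theta>) \<le> 4 * pi * A / c * (pi / real N) powr \<gamma>"
    using eventually_gt_at_top[of 0] by eventually_elim (rule le)
  ultimately have "measure lborel (cos ` \<Theta>) \<le> 0"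
    using tendsto_lowerbound[of "\<lambda>N. 4 * pi * A / c * (pi / real N) powr \<gamma>" 0 sequentially] by simp
  then have "measure lborel (cos ` \<Theta>) = 0" by (rule antisym) simp
  moreover have fm: "cos ` \<Theta> \<in> fmeasurable lborel" using comp by (rule fmeasurable_compact)
  ultimately have "emeasure lborel (cos ` \<Theta>) = 0" by (simp only: emeasure_eq_measure2 ennreal_0)
  with fmeasurableD[OF fm] show ?thesis by (rule null_setsI[rotated])
qed

text \<open>Each gap is pulled back to an interval of angles; \<open>arccos\<close> is decreasing,
  so \<open>Sup l\<close> gives the left end. One of the two ends lies in \<open>\<Theta>\<close>,
  which permits R to be the length of the angle interval, and that length is at least the length of
  l.\<close>

lemma sum_adjacent_intervals_le:
  assumes "0 < \<gamma>" "\<gamma> < 1" "\<Theta> \<subseteq> {0..pi}" "closed (cos ` \<Theta>)" "\<Theta> \<noteq> {}"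
    and L: "finite L" "L \<subseteq> adjacent_intervals (cos ` \<Theta>)"
  shows "(\<Sum>l\<in>L. measure lborel l powr (1 - \<gamma>)) \<le> 2 * pi * A / c"
proof -
  have F: "closed (cos ` \<Theta>)" "cos ` \<Theta> \<subseteq> {-1..1}" using assms by auto
  note props = adjacent_interval_props[OF F]
  define \<alpha> where "\<alpha> l = arccos (Sup l)" for l :: "real set"
  define \<beta> where "\<beta> l = arccos (Inf l)" for l :: "real set"
  have basic: "-1 \<le> Inf l" "Inf l < Sup l" "Sup l \<le> 1" "{Inf l<..<Sup l} \<subseteq> l"
    "measure lborel l = Sup l - Inf l" if "l \<in> L" for l
  proof -
    have l: "l \<in> adjacent_intervals (cos ` \<Theta>)" using that L by auto
    note p = props[OF l]
    show "-1 \<le> Inf l" "Sup l \<le> 1" using p(2,3) by (auto intro!: cInf_greatest cSup_least)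
    note c = connected_bounded_real[OF p(1,5,2)]
    show "{Inf l<..<Sup l} \<subseteq> l" "measure lborel l = Sup l - Inf l" using c by auto
    have "interior l \<noteq> {}" by (rule interior_adjacent_interval[OF F l])
    then have "interior {Inf l..Sup l} \<noteq> {}" using interior_mono[OF c(2)] by auto
    then show "Inf l < Sup l" by (simp add: interior_atLeastAtMost_real)
  qed
  have ends: "0 \<le> \<alpha> l" "\<alpha> l < \<beta> l" "\<beta> l \<le> pi" "cos (\<alpha> l) = Sup l" "cos (\<beta> l) = Inf l" if "l \<in> L" for l
    using basic[OF that] by (auto simp: \<alpha>_def \<beta>_def intro!: arccos_lbound arccos_ubound arccos_less_arccos)
  have inside: "cos x \<in> l" if "l \<in> L" "\<alpha> l < x" "x < \<beta> l" for l x
  proof -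
    have "cos x < cos (\<alpha> l)" "cos (\<beta> l) < cos x"
      using ends(1,3)[OF that(1)] that(2,3) by (intro cos_monotone_0_pi; linarith)+
    then show ?thesis using ends[OF that(1)] basic(4)[OF that(1)] by auto
  qed
  have "(\<Sum>l\<in>L. (\<beta> l - \<alpha> l) * (\<beta> l - \<alpha> l) powr (- \<gamma>)) \<le> 2 * pi * A / c"
  proof (rule sum_intervals_le[OF L(1)])
    show "disjoint_family_on (\<lambda>l. {\<alpha> l<..<\<beta> l}) L"
    proof (unfold disjoint_family_on_def, intro ballI impI)
      fix l l' assume "l \<in> L" "l' \<in> L" "l \<noteq> l'"
      then have "l \<inter> l' = {}" using adjacent_intervals_disjoint[OF F] L by blast
      then have "x \<notin> {\<alpha> l'<..<\<beta> l'}" if "x \<in> {\<alpha> l<..<\<beta> l}" for x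
        using inside[OF \<open>l \<in> L\<close>, of x] inside[OF \<open>l' \<in> L\<close>, of x] that by auto
      then show "{\<alpha> l<..<\<beta> l} \<inter> {\<alpha> l'<..<\<beta> l'} = {}" by blast
    qed
    fix l assume l: "l \<in> L"
    show "0 \<le> \<alpha> l" "\<beta> l \<le> 2 * pi" "\<beta> l - \<alpha> l > 0" using ends[OF l] pi_gt_zero by auto
    fix x assume x: "\<alpha> l < x" "x < \<beta> l"
    have "cos ` \<Theta> \<noteq> {}" using assms by simp
    then have "Inf l \<in> cos ` \<Theta> \<or> Sup l \<in> cos ` \<Theta>"
      using endpoint_in_closed_set[OF F] l L by blast
    then show "\<exists>y\<in>\<Theta>. \<bar>x - y\<bar> \<le> \<beta> l - \<alpha> l"
    proof
      assume "Inf l \<in> cos ` \<Theta>"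
      then obtain y where y: "y \<in> \<Theta>" "Inf l = cos y" by auto
      then have "\<beta> l = y" using assms(3) by (auto simp: \<beta>_def arccos_cos)
      then show ?thesis using y x by (intro bexI[of _ y]) auto
    next
      assume "Sup l \<in> cos ` \<Theta>"
      then obtain y where y: "y \<in> \<Theta>" "Sup l = cos y" by auto
      then have "\<alpha> l = y" using assms(3) by (auto simp: \<alpha>_def arccos_cos)
      then show ?thesis using y x by (intro bexI[of _ y]) auto
    qed
  qed
  moreover have "measure lborel l powr (1 - \<gamma>) \<le> (\<beta> l - \<alpha> l) * (\<beta> l - \<alpha> l) powr (- \<gamma>)" if l: "l \<in> L" for l
  proof -
    have "measure lborel l \<le> \<beta> l - \<alpha> l"
      using abs_cos_diff_le[of "\<alpha> l" "\<beta> l"] ends[OF l] basic[OF l] by simp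
    then have "measure lborel l powr (1 - \<gamma>) \<le> (\<beta> l - \<alpha> l) powr (1 + - \<gamma>)"
      using assms by (simp add: powr_mono2)
    also have "\<dots> = (\<beta> l - \<alpha> l) * (\<beta> l - \<alpha> l) powr (- \<gamma>)"
      using ends[OF l] by (subst powr_add) auto
    finally show ?thesis .
  qed
  then have "(\<Sum>l\<in>L. measure lborel l powr (1 - \<gamma>)) \<le> (\<Sum>l\<in>L. (\<beta> l - \<alpha> l) * (\<beta> l - \<alpha> l) powr (- \<gamma>))"
    by (rule sum_mono)
  ultimately show ?thesis by linarith
qed

lemma convergence_exponent_le:
  assumes "0 < \<gamma>" "\<gamma> < 1" "\<Theta> \<subseteq> {0..pi}" "closed (cos ` \<Theta>)"
  shows "convergence_exponent (cos ` \<Theta>) \<le> ereal (1 - \<gamma>)"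
proof -
  have "(\<lambda>l. measure lborel l powr (1 - \<gamma>)) summable_on adjacent_intervals (cos ` \<Theta>)"
  proof (cases "\<Theta> = {}")
    case True
    \<comment> \<open>With an empty set no gap has an end in it; there is just one gap, so the sum
      is finite.\<close>
    have "components {-1..1::real} = {{-1..1}}"
      by (subst components_eq_sing_iff) (simp add: convex_connected)
    then show ?thesis using True by (simp add: adjacent_intervals_def)
  next
    case False
    show ?thesis
      by (intro nonneg_bdd_above_summable_on)
         (use sum_adjacent_intervals_le[OF assms False] in \<open>auto simp: bdd_above_def\<close>)
  qed
  then show ?thesis unfolding convergence_exponent_def using assms by (intro Inf_lower) auto
qed

end

section \<open>The Jost function\<close>

text \<open>The sum norm of the coefficients, cut off at N to remain a finite sum. Multiplication by
  the variable does not increase it, and a bound uniform in N controls both the single coefficients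
  and the values on the closed disk.\<close>

definition coeff_norm :: "nat \<Rightarrow> complex poly \<Rightarrow> real" where
  "coeff_norm N p = (\<Sum>i<N. cmod (coeff p i))"

lemma coeff_norm_nonneg [simp]: "coeff_norm N p \<ge> 0"
  by (simp add: coeff_norm_def sum_nonneg)

lemma coeff_norm_0 [simp]: "coeff_norm N 0 = 0"
  by (simp add: coeff_norm_def)

lemma coeff_norm_add: "coeff_norm N (p + q) \<le> coeff_norm N p + coeff_norm N q"
  unfolding coeff_norm_def sum.distrib[symmetric] by (intro sum_mono) (simp add: norm_triangle_ineq)

lemma coeff_norm_diff: "coeff_norm N (p - q) \<le> coeff_norm N p + coeff_norm N q"
  unfolding coeff_norm_def sum.distrib[symmetric] by (intro sum_mono) (simp add: norm_triangle_ineq4)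

lemma coeff_norm_smult [simp]: "coeff_norm N (smult z p) = cmod z * coeff_norm N p"
  by (simp add: coeff_norm_def sum_distrib_left norm_mult)

lemma coeff_norm_pCons_0: "coeff_norm N (pCons 0 p) \<le> coeff_norm N p"
proof (cases N)
  case (Suc M)
  show ?thesis unfolding coeff_norm_def Suc by (subst sum.lessThan_Suc_shift) simp
qed (simp add: coeff_norm_def)

lemma coeff_norm_1_le: "coeff_norm N 1 \<le> 1"
proof -
  have "coeff_norm N 1 = (\<Sum>i<N. if i = 0 then 1 else 0)"
    unfolding coeff_norm_def by (intro sum.cong) (auto simp: coeff_1 of_bool_def)
  then show ?thesis by (simp add: sum.delta)
qed

lemma norm_coeff_le_coeff_norm: "cmod (coeff p i) \<le> coeff_norm (Suc i) p"
  unfolding coeff_norm_def by (intro member_le_sum) auto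

lemma norm_poly_le:
  assumes "\<And>N. coeff_norm N p \<le> B" "cmod z \<le> 1"
  shows "cmod (poly p z) \<le> B"
proof -
  have "cmod (poly p z) \<le> (\<Sum>i<Suc (degree p). cmod (coeff p i * z ^ i))"
    unfolding poly_altdef lessThan_Suc_atMost by (rule norm_sum)
  also have "\<dots> \<le> coeff_norm (Suc (degree p)) p" unfolding coeff_norm_def
    using assms(2) by (intro sum_mono) (simp add: norm_mult norm_power mult_left_le power_le_one)
  finally show ?thesis using assms(1) by (rule order.trans)
qed

lemma binomial_le_fact: "real (n choose k) \<le> real n ^ k / fact k"
  using binomial_fact_pow[of n k]
  by (simp add: pos_le_divide_eq) (metis of_nat_fact of_nat_le_iff of_nat_mult of_nat_power)

text \<open>With \<open>\<lambda>\<close> in the unit disk, \<open>z = (\<lambda> + 1 / \<lambda>) / 2\<close> and \<open>U n = (2 * \<lambda>) ^ n * v n\<close>, the recursion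
  \<open>U n = (z - b n) * U (n + 1) - a n * c n * U (n + 2)\<close> becomes a recursion with polynomial
  coefficients in \<open>\<lambda>\<close>, which does not require the off-diagonal entries to be nonzero.\<close>

locale decaying_jacobi =
  fixes a b c :: "nat \<Rightarrow> complex" and \<delta> :: "nat \<Rightarrow> real"
  assumes b: "2 * cmod (b n) \<le> \<delta> n"
    and ac: "cmod (1 - 4 * a n * c n) \<le> \<delta> n"
    and a: "cmod (2 * a n - 1) \<le> \<delta> n"
    and c: "cmod (2 * c n - 1) \<le> \<delta> n"
    and summable_\<delta>: "summable (\<lambda>n. real (Suc n) ^ k * \<delta> n)"
begin

lemma \<delta>_nonneg: "\<delta> n \<ge> 0"
  using b[of n] norm_ge_zero[of "b n"] by linarith

text \<open>This is \<open>(1 + \<lambda>\<^sup>2 - 2 * b n * \<lambda>) * p - 4 * a n * c n *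
  \<lambda>\<^sup>2 * q\<close>, arranged as the free step plus two terms whose factors are bounded
  by \<open>\<delta> n\<close>. The free step fixes the constant pair
  \<open>p = q = 1\<close>.\<close>

definition jstep :: "nat \<Rightarrow> complex poly \<Rightarrow> complex poly \<Rightarrow> complex poly" where
  "jstep n p q = p + pCons 0 (pCons 0 (p - q)) - smult (2 * b n) (pCons 0 p)
    + smult (1 - 4 * a n * c n) (pCons 0 (pCons 0 q))"

lemma jstep_diff: "jstep n p q - jstep n p' q' = jstep n (p - p') (q - q')"
  unfolding jstep_def by (intro poly_eqI) (simp add: coeff_pCons algebra_simps split: nat.split)

text \<open>The coefficients of \<open>J\<close> are replaced by those of the free Jacobi matrix from index \<open>M\<close> on.\<close>

function jost_poly :: "nat \<Rightarrow> nat \<Rightarrow> complex poly" where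
  "jost_poly M n = (if M \<le> n then 1 else jstep n (jost_poly M (Suc n)) (jost_poly M (Suc (Suc n))))"
  by auto
termination by (relation "Wellfounded.measure (\<lambda>(M, n). M - n)") auto

declare jost_poly.simps [simp del]

lemma jost_poly_ge [simp]: "M \<le> n \<Longrightarrow> jost_poly M n = 1"
  by (simp add: jost_poly.simps)

lemma jost_poly_less:
  "n < M \<Longrightarrow> jost_poly M n = jstep n (jost_poly M (Suc n)) (jost_poly M (Suc (Suc n)))"
  by (subst jost_poly.simps) simp

definition growth :: real where
  "growth = exp (\<Sum>k. 2 * real (Suc k) * \<delta> k)"

lemma summable_growth: "summable (\<lambda>k. 2 * real (Suc k) * \<delta> k)"
  using summable_mult[OF summable_\<delta>[of 1], of 2] by (simp only: mult.assoc power_one_right)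

lemma growth_ge_1: "growth \<ge> 1"
  unfolding growth_def using suminf_nonneg[OF summable_growth] \<delta>_nonneg by simp

lemma growth_finite: "finite K \<Longrightarrow> exp (\<Sum>k\<in>K. 2 * real (Suc k) * \<delta> k) \<le> growth"
  unfolding growth_def using sum_le_suminf[OF summable_growth] \<delta>_nonneg by simp

text \<open>The weight \<open>n\<close> of the increment turns the two-step recursion into a one-step estimate.\<close>

lemma jstep_growth_step:
  assumes "y n = jstep n (y (Suc n)) (y (Suc (Suc n)))"
  shows "coeff_norm N (y n) + real n * coeff_norm N (y n - y (Suc n))
    \<le> (1 + 2 * real (Suc n) * \<delta> n)
        * (coeff_norm N (y (Suc n)) + real (Suc n) * coeff_norm N (y (Suc n) - y (Suc (Suc n))))"
proof -
  define A where "A = coeff_norm N (y (Suc n))"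
  define B where "B = coeff_norm N (y (Suc n) - y (Suc (Suc n)))"
  define W where "W = coeff_norm N (y n - y (Suc n))"
  let ?w = "y (Suc n) - y (Suc (Suc n))"
  have nn: "A \<ge> 0" "B \<ge> 0" "W \<ge> 0" by (simp_all add: A_def B_def W_def)
  have "y n - y (Suc n) = pCons 0 (pCons 0 ?w) - smult (2 * b n) (pCons 0 (y (Suc n)))
      + smult (1 - 4 * a n * c n) (pCons 0 (pCons 0 (y (Suc (Suc n)))))"
    by (subst assms) (simp add: jstep_def)
  then have "W \<le> coeff_norm N (pCons 0 (pCons 0 ?w)) + cmod (2 * b n) * coeff_norm N (pCons 0 (y (Suc n)))
      + cmod (1 - 4 * a n * c n) * coeff_norm N (pCons 0 (pCons 0 (y (Suc (Suc n)))))"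
    unfolding W_def
    by (smt (verit) coeff_norm_add coeff_norm_diff coeff_norm_smult)
  also have "\<dots> \<le> B + \<delta> n * A + \<delta> n * coeff_norm N (y (Suc (Suc n)))"
    unfolding A_def B_def using b[of n] ac[of n] \<delta>_nonneg[of n]
    by (intro add_mono mult_mono order.trans[OF coeff_norm_pCons_0] coeff_norm_pCons_0)
       (auto simp: norm_mult)
  also have "\<dots> \<le> B + \<delta> n * A + \<delta> n * (A + B)"
  proof -
    have "coeff_norm N (y (Suc (Suc n))) \<le> A + B"
      using coeff_norm_diff[of N "y (Suc n)" ?w] by (simp add: A_def B_def)
    then show ?thesis using \<delta>_nonneg[of n] by (intro add_left_mono mult_left_mono)
  qed
  finally have W: "W \<le> B + \<delta> n * A + \<delta> n * (A + B)" .
  have "coeff_norm N (y n) \<le> A + W"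
    using coeff_norm_add[of N "y (Suc n)" "y n - y (Suc n)"] by (simp add: A_def W_def)
  then have "coeff_norm N (y n) + real n * W \<le> A + real (Suc n) * W" by (simp add: algebra_simps)
  also have "\<dots> \<le> A + real (Suc n) * (B + \<delta> n * A + \<delta> n * (A + B))"
    using W by (intro add_left_mono mult_left_mono) auto
  also have "\<dots> \<le> A + real (Suc n) * B + 2 * real (Suc n) * \<delta> n * (A + real (Suc n) * B)"
  proof -
    have "B \<le> 2 * (real (Suc n) * B)" using nn by (simp add: algebra_simps)
    then have "A + (A + B) \<le> 2 * (A + real (Suc n) * B)" by (simp add: algebra_simps)
    then have "(real (Suc n) * \<delta> n) * (A + (A + B)) \<le> (real (Suc n) * \<delta> n) * (2 * (A + real (Suc n) * B))"
      using \<delta>_nonneg[of n] by (intro mult_left_mono) auto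
    then show ?thesis by (simp add: algebra_simps)
  qed
  finally show ?thesis unfolding A_def[symmetric] B_def[symmetric] W_def[symmetric]
    by (simp add: algebra_simps)
qed

lemma jstep_growth:
  assumes "\<And>n. n < M \<Longrightarrow> y n = jstep n (y (Suc n)) (y (Suc (Suc n)))" "n \<le> M"
  shows "coeff_norm N (y n) \<le> growth * (coeff_norm N (y M) + real M * coeff_norm N (y M - y (Suc M)))"
proof -
  define t where "t n = coeff_norm N (y n) + real n * coeff_norm N (y n - y (Suc n))" for n
  have t0: "t n \<ge> 0" for n by (simp add: t_def)
  have "t n \<le> exp (\<Sum>k=n..<M. 2 * real (Suc k) * \<delta> k) * t M"
    using assms(2)
  proof (induction n rule: inc_induct)
    case (step n)
    have "t n \<le> (1 + 2 * real (Suc n) * \<delta> n) * t (Suc n)"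
      unfolding t_def using step by (intro jstep_growth_step assms(1))
    also have "\<dots> \<le> exp (2 * real (Suc n) * \<delta> n) * (exp (\<Sum>k=Suc n..<M. 2 * real (Suc k) * \<delta> k) * t M)"
      using step t0 exp_ge_add_one_self by (intro mult_mono) auto
    also have "\<dots> = exp (\<Sum>k=n..<M. 2 * real (Suc k) * \<delta> k) * t M"
      using step by (simp add: sum.atLeast_Suc_lessThan exp_add)
    finally show ?case .
  qed simp
  also have "\<dots> \<le> growth * t M" by (intro mult_right_mono growth_finite t0) auto
  finally have "t n \<le> growth * t M" .
  moreover have "coeff_norm N (y n) \<le> t n" by (simp add: t_def)
  ultimately show ?thesis unfolding t_def[of M] by linarith
qed

lemma coeff_norm_jost_poly: "coeff_norm N (jost_poly M n) \<le> growth"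
proof (cases "n \<le> M")
  case True
  have "coeff_norm N (jost_poly M n) \<le> growth * (coeff_norm N (jost_poly M M)
      + real M * coeff_norm N (jost_poly M M - jost_poly M (Suc M)))"
    by (rule jstep_growth[OF jost_poly_less True])
  also have "\<dots> \<le> growth * 1"
    using growth_ge_1 coeff_norm_1_le by (intro mult_left_mono) auto
  finally show ?thesis by simp
qed (use growth_ge_1 coeff_norm_1_le order.trans in auto)

definition jost_err :: "nat \<Rightarrow> real" where
  "jost_err M = 2 * growth * (real (Suc M) * \<delta> M)"

lemma jost_err_nonneg: "jost_err M \<ge> 0"
  using growth_ge_1 \<delta>_nonneg by (simp add: jost_err_def)

text \<open>Below M the difference of the two truncations obeys the same linear recursion. It starts
  with 0 at \<open>Suc M\<close> and, at M, with the perturbation of a single step, of size at most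
  \<open>2 * \<delta> M\<close>; the weight of the increment accounts for the factor
  \<open>Suc M\<close>.\<close>

lemma coeff_norm_jost_poly_diff:
  "coeff_norm N (jost_poly (Suc M) n - jost_poly M n) \<le> jost_err M"
proof (cases "n \<le> M")
  case True
  define D where "D n = jost_poly (Suc M) n - jost_poly M n" for n
  have "coeff_norm N (D n) \<le> growth * (coeff_norm N (D M) + real M * coeff_norm N (D M - D (Suc M)))"
    by (rule jstep_growth[OF _ True]) (simp add: D_def jost_poly_less jstep_diff)
  also have "\<dots> = growth * (real (Suc M) * coeff_norm N (D M))"
    by (simp add: D_def algebra_simps)
  also have "coeff_norm N (D M) \<le> 2 * \<delta> M"
  proof -
    have "D M = smult (1 - 4 * a M * c M) (pCons 0 (pCons 0 1)) - smult (2 * b M) (pCons 0 1)"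
      by (simp add: D_def jost_poly_less jstep_def)
    then have "coeff_norm N (D M) \<le> cmod (1 - 4 * a M * c M) * coeff_norm N (pCons 0 (pCons 0 1))
        + cmod (2 * b M) * coeff_norm N (pCons 0 1)"
      using coeff_norm_diff coeff_norm_smult by metis
    also have "\<dots> \<le> \<delta> M * 1 + \<delta> M * 1"
      using b[of M] ac[of M] \<delta>_nonneg[of M]
      by (intro add_mono mult_mono order.trans[OF coeff_norm_pCons_0] coeff_norm_1_le
          order.trans[OF coeff_norm_pCons_0 coeff_norm_1_le]) (auto simp: norm_mult)
    finally show ?thesis by simp
  qed
  finally have "coeff_norm N (D n) \<le> growth * (real (Suc M) * (2 * \<delta> M))"
    using growth_ge_1 by (simp add: mult_left_mono)
  then show ?thesis by (simp add: D_def jost_err_def algebra_simps)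
qed (simp add: jost_err_nonneg)

lemma coeff_jost_poly_eq_0: "i > 2 * (M - n) \<Longrightarrow> coeff (jost_poly M n) i = 0"
proof (induction "M - n" arbitrary: n i rule: less_induct)
  case less
  show ?case
  proof (cases "M \<le> n")
    case False
    then obtain j where j: "i = Suc (Suc j)" using less.prems by (cases i; cases "i - 1") auto
    have "coeff (jost_poly M (Suc n)) k = 0" if "k \<ge> j" for k
      using False less.prems that j by (intro less.hyps) auto
    moreover have "coeff (jost_poly M (Suc (Suc n))) j = 0"
      using False less.prems j by (intro less.hyps) auto
    ultimately show ?thesis using False by (simp add: jost_poly_less jstep_def j)
  qed (use less.prems in \<open>simp add: coeff_1 of_bool_def\<close>)
qed

text \<open>For z in the open disk this is the perturbation determinant of the tail of J from index
  n on, relative to the free Jacobi matrix.\<close>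

definition jost :: "nat \<Rightarrow> complex \<Rightarrow> complex" where
  "jost n z = lim (\<lambda>M. poly (jost_poly M n) z)"

lemma summable_jost_err: "summable jost_err"
  unfolding jost_err_def using summable_mult[OF summable_\<delta>[of 1], of "2 * growth"] by simp

text \<open>The telescoping series is dominated by \<open>jost_err\<close>. It is applied both to
  the values on the closed disk and to the individual coefficients.\<close>

lemma tendsto_of_jost_err:
  fixes f :: "nat \<Rightarrow> complex"
  assumes "\<And>M. cmod (f (Suc M) - f M) \<le> jost_err M"
  shows "f \<longlonglongrightarrow> lim f" "lim f = f 0 + (\<Sum>M. f (Suc M) - f M)"
    "summable (\<lambda>M. cmod (f (Suc M) - f M))"
proof -
  show s: "summable (\<lambda>M. cmod (f (Suc M) - f M))"
    by (rule summable_comparison_test'[OF summable_jost_err, of 0]) (simp add: assms)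
  then have "(\<lambda>M. \<Sum>i<M. f (Suc i) - f i) \<longlonglongrightarrow> (\<Sum>M. f (Suc M) - f M)"
    by (rule summable_LIMSEQ[OF summable_norm_cancel])
  then have "(\<lambda>M. f M - f 0) \<longlonglongrightarrow> (\<Sum>M. f (Suc M) - f M)" by (simp add: sum_lessThan_telescope)
  from tendsto_add[OF this tendsto_const[of "f 0"]]
  have "f \<longlonglongrightarrow> f 0 + (\<Sum>M. f (Suc M) - f M)" by (simp add: add.commute)
  then show "f \<longlonglongrightarrow> lim f" "lim f = f 0 + (\<Sum>M. f (Suc M) - f M)" by (simp_all add: limI)
qed

lemma jost_tendsto:
  assumes "cmod z \<le> 1"
  shows "(\<lambda>M. poly (jost_poly M n) z) \<longlonglongrightarrow> jost n z"
  unfolding jost_def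
  by (rule tendsto_of_jost_err(1))
     (use norm_poly_le[OF coeff_norm_jost_poly_diff assms] in \<open>simp only: poly_diff\<close>)

lemma norm_jost_le: "cmod z \<le> 1 \<Longrightarrow> cmod (jost n z) \<le> growth"
  using norm_poly_le[OF coeff_norm_jost_poly]
  by (intro tendsto_upperbound[OF tendsto_norm[OF jost_tendsto[of z n]]] always_eventually) auto

lemma jost_rec:
  assumes "cmod z \<le> 1"
  shows "jost n z = (1 + z\<^sup>2 - 2 * z * b n) * jost (Suc n) z - 4 * a n * c n * z\<^sup>2 * jost (Suc (Suc n)) z"
proof (rule tendsto_unique[OF _ jost_tendsto[OF assms]])
  let ?p = "\<lambda>n M. poly (jost_poly M n) z"
  have "(\<lambda>M. (1 + z\<^sup>2 - 2 * z * b n) * ?p (Suc n) M - 4 * a n * c n * z\<^sup>2 * ?p (Suc (Suc n)) M)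
      \<longlonglongrightarrow> (1 + z\<^sup>2 - 2 * z * b n) * jost (Suc n) z - 4 * a n * c n * z\<^sup>2 * jost (Suc (Suc n)) z"
    by (intro tendsto_intros jost_tendsto assms)
  moreover have "\<forall>\<^sub>F M in sequentially.
      (1 + z\<^sup>2 - 2 * z * b n) * ?p (Suc n) M - 4 * a n * c n * z\<^sup>2 * ?p (Suc (Suc n)) M = ?p n M"
    using eventually_gt_at_top[of n]
    by eventually_elim (simp add: jost_poly_less jstep_def algebra_simps power2_eq_square)
  ultimately show "?p n \<longlonglongrightarrow>
      (1 + z\<^sup>2 - 2 * z * b n) * jost (Suc n) z - 4 * a n * c n * z\<^sup>2 * jost (Suc (Suc n)) z"
    by (rule Lim_transform_eventually)
qed simp

lemma jost_at_0: "jost n 0 = 1"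
proof -
  have step: "poly (jstep n p q) 0 = poly p 0" for n p q by (simp add: jstep_def)
  have "poly (jost_poly M n) 0 = 1" for M
  proof (induction "M - n" arbitrary: n rule: less_induct)
    case less
    then show ?case by (cases "M \<le> n") (simp_all add: jost_poly_less step)
  qed
  then have "(\<lambda>M. 1) \<longlonglongrightarrow> jost n 0" using jost_tendsto[of 0 n] by simp
  then show ?thesis by (simp add: LIMSEQ_const_iff)
qed

section \<open>Taylor coefficients of the Jost function\<close>

definition jost_coeff :: "nat \<Rightarrow> complex" where
  "jost_coeff m = lim (\<lambda>M. coeff (jost_poly M 0) m)"

definition jost_coeff_inc :: "nat \<Rightarrow> nat \<Rightarrow> complex" where
  "jost_coeff_inc M m = coeff (jost_poly (Suc M) 0) m - coeff (jost_poly M 0) m"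

lemma norm_jost_coeff_inc: "cmod (jost_coeff_inc M m) \<le> jost_err M"
  using order.trans[OF norm_coeff_le_coeff_norm coeff_norm_jost_poly_diff]
  by (simp add: jost_coeff_inc_def flip: coeff_diff)

text \<open>The increment has degree at most \<open>2 * Suc M\<close>, so every binomial weight that
  matters is bounded by the one at the top degree.\<close>

lemma sum_jost_coeff_inc_binomial:
  "(\<Sum>m<N. cmod (jost_coeff_inc M m) * real (m choose k)) \<le> jost_err M * real (2 * Suc M choose k)"
proof -
  have "(\<Sum>m<N. cmod (jost_coeff_inc M m) * real (m choose k))
      \<le> (\<Sum>m<N. cmod (jost_coeff_inc M m) * real (2 * Suc M choose k))"
  proof (rule sum_mono)
    fix m
    show "cmod (jost_coeff_inc M m) * real (m choose k) \<le> cmod (jost_coeff_inc M m) * real (2 * Suc M choose k)"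
    proof (cases "m \<le> 2 * Suc M")
      case True
      then show ?thesis by (intro mult_left_mono of_nat_mono binomial_right_mono) auto
    next
      case False
      then have "jost_coeff_inc M m = 0" by (simp add: jost_coeff_inc_def coeff_jost_poly_eq_0)
      then show ?thesis by simp
    qed
  qed
  also have "\<dots> = coeff_norm N (jost_poly (Suc M) 0 - jost_poly M 0) * real (2 * Suc M choose k)"
    by (simp only: coeff_norm_def jost_coeff_inc_def coeff_diff sum_distrib_right)
  also have "\<dots> \<le> jost_err M * real (2 * Suc M choose k)"
    by (intro mult_right_mono coeff_norm_jost_poly_diff) simp
  finally show ?thesis .
qed

text \<open>The binomial coefficient grows like the k-th power of M and \<open>jost_err\<close>
  carries one more factor \<open>Suc M\<close>; this is why \<open>summable_\<delta>\<close> is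
  demanded for all powers.\<close>

lemma summable_jost_err_binomial: "summable (\<lambda>M. jost_err M * real (2 * Suc M choose k))"
proof (rule summable_comparison_test'[of _ 0])
  show "summable (\<lambda>M. 2 * growth * 2 ^ k / fact k * (real (Suc M) ^ Suc k * \<delta> M))"
    by (intro summable_mult summable_\<delta>)
  fix M
  have "jost_err M * real (2 * Suc M choose k) \<le> jost_err M * (real (2 * Suc M) ^ k / fact k)"
    by (intro mult_left_mono binomial_le_fact jost_err_nonneg)
  also have "\<dots> = 2 * growth * 2 ^ k / fact k * (real (Suc M) ^ Suc k * \<delta> M)"
    unfolding jost_err_def of_nat_mult power_mult_distrib by (simp add: field_simps)
  finally show "norm (jost_err M * real (2 * Suc M choose k)) \<le> 2 * growth * 2 ^ k / fact k * (real (Suc M) ^ Suc k * \<delta> M)"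
    using jost_err_nonneg[of M] by simp
qed

text \<open>A common bound for the m-th coefficients of all truncations and of their limit, which
  allows limit and summation to be exchanged. The 1 at \<open>m = 0\<close> comes from the initial
  truncation, the constant polynomial 1.\<close>

definition jost_majorant :: "nat \<Rightarrow> real" where
  "jost_majorant m = (if m = 0 then 1 else 0) + (\<Sum>M. cmod (jost_coeff_inc M m))"

lemma jost_coeff_tendsto: "(\<lambda>M. coeff (jost_poly M 0) m) \<longlonglongrightarrow> jost_coeff m"
  and summable_jost_coeff_inc: "summable (\<lambda>M. cmod (jost_coeff_inc M m))"
  and norm_jost_coeff_le: "cmod (jost_coeff m) \<le> jost_majorant m"
proof -
  note * = tendsto_of_jost_err[of "\<lambda>M. coeff (jost_poly M 0) m",
      OF norm_jost_coeff_inc[unfolded jost_coeff_inc_def], folded jost_coeff_inc_def jost_coeff_def]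
  show "(\<lambda>M. coeff (jost_poly M 0) m) \<longlonglongrightarrow> jost_coeff m" by (rule *(1))
  show s: "summable (\<lambda>M. cmod (jost_coeff_inc M m))" by (rule *(3))
  have "cmod (jost_coeff m) \<le> cmod (coeff (jost_poly 0 0) m) + cmod (\<Sum>M. jost_coeff_inc M m)"
    unfolding *(2) by (rule norm_triangle_ineq)
  also have "\<dots> \<le> jost_majorant m"
    using summable_norm[OF s] by (cases "m = 0") (simp_all add: jost_majorant_def)
  finally show "cmod (jost_coeff m) \<le> jost_majorant m" .
qed

lemma norm_coeff_jost_poly_le: "cmod (coeff (jost_poly M 0) m) \<le> jost_majorant m"
proof -
  have "coeff (jost_poly M 0) m = coeff (jost_poly 0 0) m + (\<Sum>i<M. jost_coeff_inc i m)"
    unfolding jost_coeff_inc_def by (simp add: sum_lessThan_telescope[of "\<lambda>i. coeff (jost_poly i 0) m"])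
  then have "cmod (coeff (jost_poly M 0) m) \<le> cmod (coeff (jost_poly 0 0) m) + (\<Sum>i<M. cmod (jost_coeff_inc i m))"
    by (metis norm_triangle_mono norm_sum order_refl)
  also have "(\<Sum>i<M. cmod (jost_coeff_inc i m)) \<le> (\<Sum>i. cmod (jost_coeff_inc i m))"
    by (intro sum_le_suminf summable_jost_coeff_inc) auto
  finally show ?thesis by (cases "m = 0") (simp_all add: jost_majorant_def)
qed

lemma jost_majorant_nonneg: "jost_majorant m \<ge> 0"
  using order.trans[OF norm_ge_zero norm_jost_coeff_le] .

lemma jost_majorant_binomial:
  shows "summable (\<lambda>m. jost_majorant m * real (m choose k))"
    and "(\<Sum>m. jost_majorant m * real (m choose k)) \<le> 1 + (\<Sum>M. jost_err M * real (2 * Suc M choose k))"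
proof -
  have le: "(\<Sum>m<N. jost_majorant m * real (m choose k)) \<le> 1 + (\<Sum>M. jost_err M * real (2 * Suc M choose k))" for N
  proof -
    have s: "summable (\<lambda>M. cmod (jost_coeff_inc M m) * real (m choose k))" for m
      by (intro summable_mult2 summable_jost_coeff_inc)
    have "(\<Sum>m<N. jost_majorant m * real (m choose k))
        = (\<Sum>m<N. (if m = 0 then real (0 choose k) else 0)) + (\<Sum>m<N. \<Sum>M. cmod (jost_coeff_inc M m) * real (m choose k))"
      unfolding jost_majorant_def sum.distrib[symmetric] distrib_right
      by (intro sum.cong refl arg_cong2[where f="(+)"] suminf_mult2 summable_jost_coeff_inc) auto
    also have "(\<Sum>m<N. \<Sum>M. cmod (jost_coeff_inc M m) * real (m choose k))
        = (\<Sum>M. \<Sum>m<N. cmod (jost_coeff_inc M m) * real (m choose k))"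
      by (intro suminf_sum[symmetric] s)
    also have "\<dots> \<le> (\<Sum>M. jost_err M * real (2 * Suc M choose k))"
      by (intro suminf_le sum_jost_coeff_inc_binomial summable_sum s summable_jost_err_binomial)
    also have "(\<Sum>m<N. (if m = 0 then real (0 choose k) else 0)) \<le> 1"
      by (cases k) (auto simp: sum.delta)
    finally show ?thesis by simp
  qed
  show "summable (\<lambda>m. jost_majorant m * real (m choose k))"
    by (rule summableI_nonneg_bounded[OF _ le]) (simp add: jost_majorant_nonneg)
  then show "(\<Sum>m. jost_majorant m * real (m choose k)) \<le> 1 + (\<Sum>M. jost_err M * real (2 * Suc M choose k))"
    by (rule suminf_le_const[OF _ le])
qed

lemma jost_coeff_binomial:
  shows "summable (\<lambda>m. cmod (jost_coeff m) * real (m choose k))"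
    and "(\<Sum>m. cmod (jost_coeff m) * real (m choose k)) \<le> 1 + (\<Sum>M. jost_err M * real (2 * Suc M choose k))"
proof -
  have *: "cmod (jost_coeff m) * real (m choose k) \<le> jost_majorant m * real (m choose k)" for m
    by (intro mult_right_mono norm_jost_coeff_le) simp
  show "summable (\<lambda>m. cmod (jost_coeff m) * real (m choose k))"
    by (rule summable_comparison_test'[OF jost_majorant_binomial(1)[of k], of 0]) (use * in simp)
  from suminf_le[OF * this jost_majorant_binomial(1)] jost_majorant_binomial(2)[of k]
  show "(\<Sum>m. cmod (jost_coeff m) * real (m choose k)) \<le> 1 + (\<Sum>M. jost_err M * real (2 * Suc M choose k))"
    by linarith
qed

lemma summable_norm_jost_coeff: "summable (\<lambda>m. cmod (jost_coeff m))"
  using jost_coeff_binomial(1)[of 0] by simp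

lemma jost_power_series:
  assumes "cmod z \<le> 1"
  shows "jost 0 z = (\<Sum>m. jost_coeff m * z ^ m)"
proof -
  have eq: "poly (jost_poly M 0) z = (\<Sum>m. coeff (jost_poly M 0) m * z ^ m)" for M
    unfolding poly_altdef
    by (rule suminf_finite[symmetric]) (auto simp: coeff_eq_0)
  have "(\<lambda>M. \<Sum>m. coeff (jost_poly M 0) m * z ^ m) \<longlonglongrightarrow> (\<Sum>m. jost_coeff m * z ^ m)"
  proof (rule tannerys_theorem[where M=jost_majorant, THEN conjunct2, THEN conjunct2])
    show "\<forall>\<^sub>F (m, M) in at_top \<times>\<^sub>F sequentially. norm (coeff (jost_poly M 0) m * z ^ m) \<le> jost_majorant m"
    proof (intro always_eventually allI, clarify)
      fix m M
      have "norm (coeff (jost_poly M 0) m * z ^ m) \<le> cmod (coeff (jost_poly M 0) m)"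
        using assms by (simp add: norm_mult norm_power mult_left_le power_le_one)
      also have "\<dots> \<le> jost_majorant m" by (rule norm_coeff_jost_poly_le)
      finally show "norm (coeff (jost_poly M 0) m * z ^ m) \<le> jost_majorant m" .
    qed
    show "summable jost_majorant" using jost_majorant_binomial(1)[of 0] by simp
  qed (auto intro!: tendsto_intros jost_coeff_tendsto)
  then have "(\<lambda>M. poly (jost_poly M 0) z) \<longlonglongrightarrow> (\<Sum>m. jost_coeff m * z ^ m)" by (simp only: eq)
  from LIMSEQ_unique[OF jost_tendsto[OF assms] this] show ?thesis .
qed

end

section \<open>Green's kernel\<close>

text \<open>With truncated subtraction \<open>(m - n) + (n - m)\<close> is the distance of m and n;
  either side of m contributes at most one geometric series.\<close>

lemma sum_geometric_dist_le:
  fixes r :: real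
  assumes "0 \<le> r" "r < 1"
  shows "(\<Sum>n<N. r ^ ((m - n) + (n - m))) \<le> 2 / (1 - r)"
proof -
  have geo: "(\<Sum>j<k. r ^ j) \<le> 1 / (1 - r)" for k
    using sum_le_suminf[of "\<lambda>j. r ^ j" "{..<k}"] assms by (simp add: suminf_geometric)
  have "(\<Sum>n<N. r ^ ((m - n) + (n - m))) \<le> (\<Sum>n\<in>{..<Suc m} \<union> {m..<m + N}. r ^ ((m - n) + (n - m)))"
    using assms by (intro sum_mono2) auto
  also have "\<dots> \<le> (\<Sum>n<Suc m. r ^ ((m - n) + (n - m))) + (\<Sum>n=m..<m + N. r ^ ((m - n) + (n - m)))"
    using assms by (simp add: sum_Un sum_nonneg)
  also have "(\<Sum>n<Suc m. r ^ ((m - n) + (n - m))) = (\<Sum>n<Suc m. r ^ (Suc m - Suc n))"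
    by (intro sum.cong) auto
  also have "\<dots> = (\<Sum>j<Suc m. r ^ j)" by (rule sum.nat_diff_reindex)
  also have "(\<Sum>n=m..<m + N. r ^ ((m - n) + (n - m))) = (\<Sum>j<N. r ^ j)"
    using sum.shift_bounds_nat_ivl[of "\<lambda>n. r ^ ((m - n) + (n - m))" 0 m N]
    by (simp add: atLeast0LessThan add.commute)
  also have "(\<Sum>j<Suc m. r ^ j) + (\<Sum>j<N. r ^ j) \<le> 1 / (1 - r) + 1 / (1 - r)"
    by (intro add_mono geo)
  finally show ?thesis by simp
qed

lemma weighted_cauchy_schwarz:
  fixes w t :: "'a \<Rightarrow> real"
  assumes "\<And>i. i \<in> I \<Longrightarrow> w i \<ge> 0"
  shows "(\<Sum>i\<in>I. w i * t i)\<^sup>2 \<le> (\<Sum>i\<in>I. w i) * (\<Sum>i\<in>I. w i * (t i)\<^sup>2)"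
proof -
  have "(\<Sum>i\<in>I. sqrt (w i) * (sqrt (w i) * t i))\<^sup>2
      \<le> (\<Sum>i\<in>I. (sqrt (w i))\<^sup>2) * (\<Sum>i\<in>I. (sqrt (w i) * t i)\<^sup>2)"
    by (rule Cauchy_Schwarz_ineq_sum)
  moreover have "(\<Sum>i\<in>I. sqrt (w i) * (sqrt (w i) * t i)) = (\<Sum>i\<in>I. w i * t i)"
    using assms by (intro sum.cong) (auto simp flip: mult.assoc)
  moreover have "(\<Sum>i\<in>I. (sqrt (w i))\<^sup>2) = (\<Sum>i\<in>I. w i)"
    using assms by (intro sum.cong) auto
  moreover have "(\<Sum>i\<in>I. (sqrt (w i) * t i)\<^sup>2) = (\<Sum>i\<in>I. w i * (t i)\<^sup>2)"
    using assms by (intro sum.cong) (auto simp: power_mult_distrib)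
  ultimately show ?thesis by simp
qed

lemma ell2_bounded:
  assumes "x \<in> ell2"
  obtains B where "\<And>n. cmod (x n) \<le> B"
proof -
  have "summable (\<lambda>n. (cmod (x n))\<^sup>2)" using assms by (simp add: ell2_def)
  then have "cmod (x n) \<le> sqrt (\<Sum>n. (cmod (x n))\<^sup>2)" for n
    using sum_le_suminf[of "\<lambda>n. (cmod (x n))\<^sup>2" "{n}"] by (intro real_le_rsqrt) simp
  then show ?thesis using that by blast
qed

section \<open>Schur's test and two-sided inverses of tridiagonal operators\<close>

locale decaying_kernel =
  fixes H :: "nat \<Rightarrow> nat \<Rightarrow> complex" and K r :: real
  assumes r: "0 \<le> r" "r < 1" and K: "K \<ge> 0"
    and H_le: "\<And>m n. cmod (H m n) \<le> K * r ^ ((m - n) + (n - m))"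
begin

definition kernel_op :: "(nat \<Rightarrow> complex) \<Rightarrow> nat \<Rightarrow> complex" where
  "kernel_op x = (\<lambda>m. \<Sum>n. H m n * x n)"

lemma summable_kernel:
  assumes "\<And>n. cmod (x n) \<le> B"
  shows "summable (\<lambda>n. H m n * x n)"
proof (rule summable_comparison_test'[of _ 0])
  show "summable (\<lambda>n. K * r ^ ((m - n) + (n - m)) * B)"
    by (intro summable_mult2 summable_mult summableI_nonneg_bounded[OF _ sum_geometric_dist_le])
       (use r in auto)
  fix n
  show "norm (H m n * x n) \<le> K * r ^ ((m - n) + (n - m)) * B"
    unfolding norm_mult using K r by (intro mult_mono H_le assms) auto
qed

lemma summable_kernel_ell2: "x \<in> ell2 \<Longrightarrow> summable (\<lambda>n. H m n * x n)"
  by (metis ell2_bounded summable_kernel)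

text \<open>Schur's test: Cauchy-Schwarz with the weights \<open>r ^ ((m - n) + (n - m))\<close>
  uses their row sums, the subsequent sum over m uses their column sums, and both are at most
  \<open>2 / (1 - r)\<close>. Finite sections are estimated before passing to the limit.\<close>

lemma kernel_op_ell2:
  assumes x: "x \<in> ell2"
  shows "kernel_op x \<in> ell2" "ell2_norm (kernel_op x) \<le> K * (2 / (1 - r)) * ell2_norm x"
proof -
  define A where "A = 2 / (1 - r)"
  have A: "A \<ge> 0" using r by (simp add: A_def)
  have sx: "summable (\<lambda>n. (cmod (x n))\<^sup>2)" using x by (simp add: ell2_def)
  define X where "X = (\<Sum>n. (cmod (x n))\<^sup>2)"
  have X: "X \<ge> 0" unfolding X_def by (intro suminf_nonneg sx) auto
  let ?w = "\<lambda>m n. r ^ ((m - n) + (n - m))"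
  have fin: "(\<Sum>m<M. (cmod (\<Sum>n<N. H m n * x n))\<^sup>2) \<le> (K * A)\<^sup>2 * X" for M N
  proof -
    have "(\<Sum>m<M. (cmod (\<Sum>n<N. H m n * x n))\<^sup>2) \<le> (\<Sum>m<M. K\<^sup>2 * (A * (\<Sum>n<N. ?w m n * (cmod (x n))\<^sup>2)))"
    proof (rule sum_mono)
      fix m
      have "cmod (\<Sum>n<N. H m n * x n) \<le> (\<Sum>n<N. K * ?w m n * cmod (x n))"
        by (intro sum_norm_le) (simp add: norm_mult mult_right_mono H_le)
      also have "\<dots> = K * (\<Sum>n<N. ?w m n * cmod (x n))" by (simp add: sum_distrib_left mult.assoc)
      finally have "(cmod (\<Sum>n<N. H m n * x n))\<^sup>2 \<le> K\<^sup>2 * (\<Sum>n<N. ?w m n * cmod (x n))\<^sup>2"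
        by (simp add: power_mono flip: power_mult_distrib)
      also have "\<dots> \<le> K\<^sup>2 * ((\<Sum>n<N. ?w m n) * (\<Sum>n<N. ?w m n * (cmod (x n))\<^sup>2))"
        using r by (intro mult_left_mono weighted_cauchy_schwarz) auto
      also have "\<dots> \<le> K\<^sup>2 * (A * (\<Sum>n<N. ?w m n * (cmod (x n))\<^sup>2))"
        unfolding A_def using r
        by (intro mult_left_mono mult_right_mono sum_geometric_dist_le sum_nonneg) auto
      finally show "(cmod (\<Sum>n<N. H m n * x n))\<^sup>2 \<le> K\<^sup>2 * (A * (\<Sum>n<N. ?w m n * (cmod (x n))\<^sup>2))" .
    qed
    also have "\<dots> = K\<^sup>2 * (A * (\<Sum>n<N. (\<Sum>m<M. ?w n m) * (cmod (x n))\<^sup>2))"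
    proof -
      have "(\<Sum>m<M. \<Sum>n<N. ?w m n * (cmod (x n))\<^sup>2) = (\<Sum>n<N. \<Sum>m<M. ?w n m * (cmod (x n))\<^sup>2)"
        by (subst sum.swap) (simp add: add.commute)
      then show ?thesis by (simp add: sum_distrib_right flip: sum_distrib_left)
    qed
    also have "\<dots> \<le> K\<^sup>2 * (A * (\<Sum>n<N. A * (cmod (x n))\<^sup>2))"
      unfolding A_def using r by (intro mult_left_mono sum_mono mult_right_mono sum_geometric_dist_le) auto
    also have "\<dots> = (K * A)\<^sup>2 * (\<Sum>n<N. (cmod (x n))\<^sup>2)"
      by (simp add: sum_distrib_left[symmetric] power2_eq_square mult_ac)
    also have "\<dots> \<le> (K * A)\<^sup>2 * X"
      unfolding X_def by (intro mult_left_mono sum_le_suminf sx) auto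
    finally show ?thesis .
  qed
  have lim: "(\<Sum>m<M. (cmod (kernel_op x m))\<^sup>2) \<le> (K * A)\<^sup>2 * X" for M
  proof (rule tendsto_upperbound[OF _ always_eventually])
    show "(\<lambda>N. \<Sum>m<M. (cmod (\<Sum>n<N. H m n * x n))\<^sup>2) \<longlonglongrightarrow> (\<Sum>m<M. (cmod (kernel_op x m))\<^sup>2)"
      unfolding kernel_op_def
      by (intro tendsto_sum tendsto_power tendsto_norm summable_LIMSEQ summable_kernel_ell2 x)
  qed (use fin in auto)
  then have s: "summable (\<lambda>m. (cmod (kernel_op x m))\<^sup>2)"
    by (intro summableI_nonneg_bounded[OF _ lim]) auto
  then show "kernel_op x \<in> ell2" by (simp add: ell2_def)
  have "(\<Sum>m. (cmod (kernel_op x m))\<^sup>2) \<le> (K * A)\<^sup>2 * X" by (rule suminf_le_const[OF s lim])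
  then have "ell2_norm (kernel_op x) \<le> sqrt ((K * A)\<^sup>2 * X)"
    unfolding ell2_norm_def by (rule real_sqrt_le_mono)
  also have "\<dots> = K * A * ell2_norm x"
    using K A by (simp add: real_sqrt_mult ell2_norm_def X_def)
  finally show "ell2_norm (kernel_op x) \<le> K * (2 / (1 - r)) * ell2_norm x" by (simp add: A_def)
qed

lemma bounded_operator_kernel_op: "bounded_operator kernel_op"
  unfolding bounded_operator_def
proof (intro conjI ballI allI exI[of _ "K * (2 / (1 - r))"])
  fix x y assume "x \<in> ell2" "y \<in> ell2"
  then show "kernel_op (\<lambda>n. x n + y n) = (\<lambda>n. kernel_op x n + kernel_op y n)"
    by (simp add: kernel_op_def distrib_left suminf_add summable_kernel_ell2)
next
  fix z x assume "x \<in> ell2"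
  then show "kernel_op (\<lambda>n. z * x n) = (\<lambda>n. z * kernel_op x n)"
    by (simp add: kernel_op_def suminf_mult[symmetric] summable_kernel_ell2 mult.left_commute)
qed (use kernel_op_ell2 in auto)

text \<open>\<open>row\<close> and \<open>col\<close> say entrywise that H is a right and a left
  inverse of \<open>J - z\<close>. The right inverse involves only finite combinations of convergent
  series, whereas the left one needs a rearrangement by columns of J.\<close>

lemma not_in_spectrum:
  fixes J :: "nat \<Rightarrow> nat \<Rightarrow> complex"
  assumes J: "jacobi_matrix J" and bdd: "\<And>m n. cmod (J m n) \<le> B"
    and row: "\<And>m n. (if m = 0 then 0 else J m (m - 1) * H (m - 1) n) + (J m m - z) * H m n
      + J m (Suc m) * H (Suc m) n = (if m = n then 1 else 0)"
    and col: "\<And>m n. (if n = 0 then 0 else J (n - 1) n * H m (n - 1)) + (J n n - z) * H m n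
      + J (Suc n) n * H m (Suc n) = (if m = n then 1 else 0)"
  shows "z \<notin> op_spectrum (matrix_operator J)"
proof -
  have T: "matrix_operator J x m = (if m = 0 then 0 else J m (m - 1) * x (m - 1)) + J m m * x m
      + J m (Suc m) * x (Suc m)" for x m
  proof -
    have "matrix_operator J x m = (\<Sum>n\<in>{m - 1..Suc m}. J m n * x n)"
      unfolding matrix_operator_def using J by (intro suminf_finite) (auto simp: jacobi_matrix_def)
    also have "\<dots> = (if m = 0 then 0 else J m (m - 1) * x (m - 1)) + J m m * x m + J m (Suc m) * x (Suc m)"
      by (cases m) (simp_all add: atLeastAtMostSuc_conv)
    finally show ?thesis .
  qed
  have right: "matrix_operator J (kernel_op x) m - z * kernel_op x m = x m" if x: "x \<in> ell2" for x m
  proof -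
    have k: "(\<lambda>n. H m n * x n) sums kernel_op x m" for m
      unfolding kernel_op_def by (rule summable_sums[OF summable_kernel_ell2[OF x]])
    have "(\<lambda>n. (if m = 0 then 0 else J m (m - 1)) * (H (m - 1) n * x n) + (J m m - z) * (H m n * x n)
        + J m (Suc m) * (H (Suc m) n * x n)) sums
      ((if m = 0 then 0 else J m (m - 1)) * kernel_op x (m - 1) + (J m m - z) * kernel_op x m
        + J m (Suc m) * kernel_op x (Suc m))"
      by (intro sums_add sums_mult k)
    moreover have "(if m = 0 then 0 else J m (m - 1)) * (H (m - 1) n * x n) + (J m m - z) * (H m n * x n)
        + J m (Suc m) * (H (Suc m) n * x n)
      = ((if m = 0 then 0 else J m (m - 1) * H (m - 1) n) + (J m m - z) * H m n + J m (Suc m) * H (Suc m) n) * x n" for n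
      by (simp add: algebra_simps)
    moreover have "(if m = 0 then 0 else J m (m - 1)) * kernel_op x (m - 1) + (J m m - z) * kernel_op x m
        + J m (Suc m) * kernel_op x (Suc m) = matrix_operator J (kernel_op x) m - z * kernel_op x m"
      by (simp add: T algebra_simps)
    ultimately have "matrix_operator J (kernel_op x) m - z * kernel_op x m
        = (\<Sum>n. ((if m = 0 then 0 else J m (m - 1) * H (m - 1) n) + (J m m - z) * H m n + J m (Suc m) * H (Suc m) n) * x n)"
      by (simp only: sums_iff)
    also have "\<dots> = (\<Sum>n. if n = m then x n else 0)" unfolding row by (intro suminf_cong) auto
    also have "\<dots> = x m" using sums_single[of m x] by (simp add: sums_iff eq_commute)
    finally show ?thesis .
  qed
  have left: "kernel_op (\<lambda>n. matrix_operator J x n - z * x n) m = x m" if x: "x \<in> ell2" for x m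
  proof -
    obtain C where C: "\<And>n. cmod (x n) \<le> C" using ell2_bounded[OF x] by blast
    have JC: "cmod (J i j * x k) \<le> B * C" for i j k
      unfolding norm_mult using bdd C order.trans[OF norm_ge_zero bdd] by (intro mult_mono) auto
    \<comment> \<open>\<open>f1\<close> and \<open>f3\<close> shift the subdiagonal and
      superdiagonal terms by one index, with a 0 inserted at \<open>n = 0\<close>. Replacing one
      shifted form by the other leaves the sums unchanged and groups the terms by the index of
      x.\<close>
    define f1 where "f1 n = H m n * (if n = 0 then 0 else J n (n - 1) * x (n - 1))" for n
    define f3 where "f3 n = (if n = 0 then 0 else J (n - 1) n * H m (n - 1)) * x n" for n
    have "cmod (if n = 0 then 0 else J n (n - 1) * x (n - 1)) \<le> B * C" for n
      using JC[of n "n - 1" "n - 1"] order.trans[OF norm_ge_zero JC] by auto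
    then have "summable f1" unfolding f1_def by (rule summable_kernel)
    then have s0: "f1 sums (\<Sum>n. f1 n)" by (rule summable_sums)
    have s1: "(\<lambda>n. H m (Suc n) * (J (Suc n) n * x n)) sums (\<Sum>n. f1 n)"
      using s0 sums_Suc_iff[of f1 "\<Sum>n. f1 n"] by (simp add: f1_def)
    have s2: "(\<lambda>n. H m n * (J n n * x n)) sums (\<Sum>n. H m n * (J n n * x n))"
      by (rule summable_sums[OF summable_kernel[OF JC]])
    have s3: "(\<lambda>n. H m n * (J n (Suc n) * x (Suc n))) sums (\<Sum>n. H m n * (J n (Suc n) * x (Suc n)))"
      by (rule summable_sums[OF summable_kernel[OF JC]])
    then have s3': "f3 sums (\<Sum>n. H m n * (J n (Suc n) * x (Suc n)))"
      using sums_Suc_iff[of f3] by (simp add: f3_def mult_ac)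
    have s4: "(\<lambda>n. z * (H m n * x n)) sums (z * (\<Sum>n. H m n * x n))"
      by (intro sums_mult summable_sums summable_kernel_ell2 x)
    have "kernel_op (\<lambda>n. matrix_operator J x n - z * x n) m
        = (\<Sum>n. f1 n + H m n * (J n n * x n) + H m n * (J n (Suc n) * x (Suc n)) - z * (H m n * x n))"
      unfolding kernel_op_def T f1_def by (intro suminf_cong) (simp add: algebra_simps)
    also have "\<dots> = (\<Sum>n. f1 n) + (\<Sum>n. H m n * (J n n * x n)) + (\<Sum>n. H m n * (J n (Suc n) * x (Suc n)))
        - z * (\<Sum>n. H m n * x n)"
      by (rule sums_unique[symmetric, OF sums_diff[OF sums_add[OF sums_add[OF s0 s2] s3] s4]])
    also have "\<dots> = (\<Sum>n. H m (Suc n) * (J (Suc n) n * x n) + H m n * (J n n * x n) + f3 n - z * (H m n * x n))"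
      by (rule sums_unique[OF sums_diff[OF sums_add[OF sums_add[OF s1 s2] s3'] s4]])
    also have "\<dots> = (\<Sum>n. ((if n = 0 then 0 else J (n - 1) n * H m (n - 1)) + (J n n - z) * H m n
      + J (Suc n) n * H m (Suc n)) * x n)"
      unfolding f3_def by (intro suminf_cong) (simp add: algebra_simps)
    also have "\<dots> = (\<Sum>n. if n = m then x n else 0)" unfolding col by (intro suminf_cong) auto
    also have "\<dots> = x m" using sums_single[of m x] by (simp add: sums_iff eq_commute)
    finally show ?thesis .
  qed
  show ?thesis unfolding op_spectrum_def
    using bounded_operator_kernel_op left right by (auto intro!: exI[of _ kernel_op])
qed

end

section \<open>The left solution, the Wronskian and the resolvent\<close>

context decaying_jacobi
begin

text \<open>For nonzero z this is \<open>(2 * z) ^ n\<close> times the determinant of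
  \<open>(z + 1 / z) / 2\<close> minus the upper left n by n block of J, hence the solution adapted
  to the boundary at index 0.\<close>

fun left_sol :: "complex \<Rightarrow> nat \<Rightarrow> complex" where
  "left_sol z 0 = 1"
| "left_sol z (Suc 0) = 1 + z\<^sup>2 - 2 * z * b 0"
| "left_sol z (Suc (Suc n)) = (1 + z\<^sup>2 - 2 * z * b (Suc n)) * left_sol z (Suc n)
     - 4 * a n * c n * z\<^sup>2 * left_sol z n"

text \<open>The left-hand side is conserved by the two recursions, and at \<open>n = 0\<close> it is
  the recursion for \<open>jost 0\<close>. It supplies the diagonal entry of the equation for
  Green's kernel.\<close>

lemma wronskian:
  assumes "cmod z \<le> 1"
  shows "left_sol z (Suc n) * jost (Suc n) z - 4 * a n * c n * z\<^sup>2 * left_sol z n * jost (Suc (Suc n)) z = jost 0 z"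
proof (induction n)
  case 0
  then show ?case using jost_rec[OF assms, of 0] by simp
next
  case (Suc n)
  have "left_sol z (Suc (Suc n)) * jost (Suc (Suc n)) z
      - 4 * a (Suc n) * c (Suc n) * z\<^sup>2 * left_sol z (Suc n) * jost (Suc (Suc (Suc n))) z
    = left_sol z (Suc n) * ((1 + z\<^sup>2 - 2 * z * b (Suc n)) * jost (Suc (Suc n)) z
        - 4 * a (Suc n) * c (Suc n) * z\<^sup>2 * jost (Suc (Suc (Suc n))) z)
      - 4 * a n * c n * z\<^sup>2 * left_sol z n * jost (Suc (Suc n)) z"
    by (simp add: algebra_simps)
  then show ?case using Suc jost_rec[OF assms, of "Suc n"] by simp
qed

lemma summable_delta: "summable \<delta>"
  using summable_\<delta>[of 0] by simp

text \<open>In the free case the increments of the solution shrink by the factor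
  \<open>z\<^sup>2\<close> at each step. A value plus a multiple of the increment then grows only by
  factors whose logarithms are summable; the bound depends on z.\<close>

lemma left_sol_bounded:
  assumes z: "cmod z < 1"
  obtains B where "\<And>n. cmod (left_sol z n) \<le> B" 
proof -
  define p where "p = left_sol z"
  define \<rho> where "\<rho> = (cmod z)\<^sup>2"
  have rho: "0 \<le> \<rho>" "\<rho> < 1" using z by (simp_all add: \<rho>_def abs_square_less_1)
  \<comment> \<open>The new increment is counted once in the value and \<kappa> times in the weight;
    this choice makes \<open>(1 + \<kappa>) * \<rho> \<le> \<kappa>\<close>, so the free part causes
    no growth.\<close>
  define \<kappa> where "\<kappa> = 1 / (1 - \<rho>)"
  have kappa: "\<kappa> \<ge> 1" "(1 + \<kappa>) * \<rho> \<le> \<kappa>"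
  proof -
    show "\<kappa> \<ge> 1" using rho by (simp add: \<kappa>_def)
    have "\<kappa> * (1 - \<rho>) = 1" using rho by (simp add: \<kappa>_def)
    then show "(1 + \<kappa>) * \<rho> \<le> \<kappa>" using rho by (simp add: algebra_simps)
  qed
  define \<eta> where "\<eta> n = \<delta> n + \<delta> (Suc n)" for n
  have eta: "\<eta> n \<ge> 0" for n using \<delta>_nonneg by (simp add: \<eta>_def)
  have s\<eta>: "summable (\<lambda>n. (1 + \<kappa>) * \<eta> n)"
    unfolding \<eta>_def using summable_delta by (intro summable_mult summable_add) (simp_all add: summable_Suc_iff)
  define X where "X n = cmod (p (Suc n)) + \<kappa> * cmod (p (Suc n) - p n)" for n
  have X0: "X n \<ge> 0" for n using kappa by (simp add: X_def)
  have X_step: "X (Suc n) \<le> (1 + (1 + \<kappa>) * \<eta> n) * X n" for n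
  proof -
    define P where "P = cmod (p (Suc n))"
    define S where "S = cmod (p (Suc n) - p n)"
    define S' where "S' = cmod (p (Suc (Suc n)) - p (Suc n))"
    have nn: "P \<ge> 0" "S \<ge> 0" by (simp_all add: P_def S_def)
    have tri: "cmod (u - v + w) \<le> cmod u + cmod v + cmod w" for u v w :: complex
      using norm_triangle_ineq[of "u - v" w] norm_triangle_ineq4[of u v] by linarith
    have "p (Suc (Suc n)) - p (Suc n) = z\<^sup>2 * (p (Suc n) - p n) - z * (2 * b (Suc n) * p (Suc n))
        + z\<^sup>2 * ((1 - 4 * a n * c n) * p n)"
      by (simp add: p_def algebra_simps)
    then have "S' \<le> cmod (z\<^sup>2 * (p (Suc n) - p n)) + cmod (z * (2 * b (Suc n) * p (Suc n)))
        + cmod (z\<^sup>2 * ((1 - 4 * a n * c n) * p n))"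
      unfolding S'_def using tri by simp
    also have "\<dots> \<le> \<rho> * S + 1 * (\<delta> (Suc n) * P) + 1 * (\<delta> n * cmod (p n))"
      unfolding norm_mult norm_power \<rho>_def S_def P_def
      using z b[of "Suc n"] ac[of n] \<delta>_nonneg
      by (intro add_mono mult_mono order.refl) (auto simp: norm_mult power_le_one)
    also have "cmod (p n) \<le> P + S"
      using norm_triangle_ineq4[of "p (Suc n)" "p (Suc n) - p n"] by (simp add: P_def S_def)
    finally have S': "S' \<le> \<rho> * S + \<delta> (Suc n) * P + \<delta> n * (P + S)"
      using \<delta>_nonneg[of n] by (simp add: mult_left_mono)
    have "\<delta> (Suc n) * P \<le> \<delta> (Suc n) * (P + S)" using nn \<delta>_nonneg by (intro mult_left_mono) auto
    then have S': "S' \<le> \<rho> * S + \<eta> n * (P + S)" using S' by (simp add: \<eta>_def algebra_simps)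
    have "X (Suc n) \<le> P + (1 + \<kappa>) * S'"
      using norm_triangle_ineq[of "p (Suc n)" "p (Suc (Suc n)) - p (Suc n)"]
      by (simp add: X_def P_def S'_def algebra_simps)
    also have "\<dots> \<le> P + (1 + \<kappa>) * (\<rho> * S + \<eta> n * (P + S))"
      using S' kappa by (intro add_left_mono mult_left_mono) auto
    also have "\<dots> = P + (1 + \<kappa>) * \<rho> * S + (1 + \<kappa>) * \<eta> n * (P + S)" by (simp add: algebra_simps)
    also have "\<dots> \<le> P + \<kappa> * S + (1 + \<kappa>) * \<eta> n * (P + \<kappa> * S)"
      using kappa nn eta mult_right_mono[of 1 \<kappa> S]
      by (intro add_mono mult_right_mono mult_left_mono order.refl) auto
    also have "\<dots> = (1 + (1 + \<kappa>) * \<eta> n) * X n" by (simp add: X_def P_def S_def algebra_simps)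
    finally show ?thesis .
  qed
  have "X n \<le> exp (\<Sum>i<n. (1 + \<kappa>) * \<eta> i) * X 0" for n
  proof (induction n)
    case (Suc n)
    have "X (Suc n) \<le> (1 + (1 + \<kappa>) * \<eta> n) * X n" by (rule X_step)
    also have "\<dots> \<le> exp ((1 + \<kappa>) * \<eta> n) * (exp (\<Sum>i<n. (1 + \<kappa>) * \<eta> i) * X 0)"
      using Suc X0 exp_ge_add_one_self by (intro mult_mono) auto
    finally show ?case by (simp add: exp_add mult_ac)
  qed simp
  also have "exp (\<Sum>i<n. (1 + \<kappa>) * \<eta> i) * X 0 \<le> exp (\<Sum>i. (1 + \<kappa>) * \<eta> i) * X 0" for n
    using eta kappa X0 by (intro mult_right_mono) (auto intro!: sum_le_suminf s\<eta>)
  finally have XB: "X n \<le> exp (\<Sum>i. (1 + \<kappa>) * \<eta> i) * X 0" for n .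
  have "cmod (p n) \<le> max 1 (exp (\<Sum>i. (1 + \<kappa>) * \<eta> i) * X 0)" for n
  proof (cases n)
    case (Suc k)
    have "cmod (p (Suc k)) \<le> X k" using kappa by (simp add: X_def)
    then show ?thesis using XB[of k] Suc by simp
  qed (simp add: p_def)
  then show ?thesis using that unfolding p_def by blast
qed

text \<open>Here \<open>z\<close> is the variable of the disk. Green's kernel of \<open>(z + 1 / z) / 2 - J\<close> is
  \<open>2 * z / jost 0 z\<close> times \<open>half_green z c m n\<close> on and above the diagonal, and times
  \<open>half_green z a n m\<close> below it.\<close>

definition half_green :: "complex \<Rightarrow> (nat \<Rightarrow> complex) \<Rightarrow> nat \<Rightarrow> nat \<Rightarrow> complex" where
  "half_green z u m n = (\<Prod>i=m..<n. 2 * u i * z) * left_sol z m * jost (Suc n) z"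

definition green :: "complex \<Rightarrow> (nat \<Rightarrow> complex) \<Rightarrow> (nat \<Rightarrow> complex) \<Rightarrow> nat \<Rightarrow> nat \<Rightarrow> complex" where
  "green z u w m n = (if m \<le> n then half_green z w m n else half_green z u n m)"

text \<open>Carrying both off-diagonal sequences as parameters turns the column equations of the
  kernel into row equations with \<open>a\<close> and \<open>c\<close> exchanged.\<close>

lemma green_transpose: "green z u w m n = green z w u n m"
  by (auto simp: green_def half_green_def)

text \<open>Above the diagonal this is the recursion of \<open>left_sol\<close>, below it that of
  \<open>jost\<close>, and on it the Wronskian identity. Both recursions involve only the products
  \<open>a n * c n\<close>, which the hypothesis on u and w preserves.\<close>

lemma green_row:
  assumes z: "cmod z \<le> 1" and uw: "\<And>n. u n * w n = a n * c n"
  shows "(1 + z\<^sup>2 - 2 * z * b m) * green z u w m n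
      - (if m = 0 then 0 else 2 * z * u (m - 1) * green z u w (m - 1) n)
      - 2 * z * w m * green z u w (Suc m) n = (if m = n then jost 0 z else 0)"
proof -
  have uw4: "4 * a i * c i * z\<^sup>2 = (2 * z * u i) * (2 * z * w i)" for i
    using uw[of i] by (simp add: power2_eq_square algebra_simps)
  have left_rec: "(1 + z\<^sup>2 - 2 * z * b m) * left_sol z m
      - (if m = 0 then 0 else (2 * z * u (m - 1)) * (2 * z * w (m - 1)) * left_sol z (m - 1)) = left_sol z (Suc m)"
    by (cases m) (simp_all flip: uw4)
  consider "m < n" | "m = n" | "m > n" by linarith
  then show ?thesis
  proof cases
    case 1
    define Q where "Q = (\<Prod>i=Suc m..<n. 2 * w i * z) * jost (Suc n) z"
    have Q: "(\<Prod>i=m..<n. 2 * w i * z) * jost (Suc n) z = 2 * w m * z * Q"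
      using 1 by (simp add: prod.atLeast_Suc_lessThan Q_def)
    have g0: "green z u w m n = 2 * w m * z * Q * left_sol z m"
      using 1 Q by (simp add: green_def half_green_def mult_ac)
    have g1: "green z u w (Suc m) n = Q * left_sol z (Suc m)"
      using 1 by (simp add: green_def half_green_def Q_def mult_ac)
    have g2: "green z u w (m - 1) n = 2 * w (m - 1) * z * (2 * w m * z * Q) * left_sol z (m - 1)" if "m \<noteq> 0"
    proof -
      have "(\<Prod>i=m - 1..<n. 2 * w i * z) = 2 * w (m - 1) * z * (\<Prod>i=m..<n. 2 * w i * z)"
        using 1 that by (cases m) (simp_all add: prod.atLeast_Suc_lessThan)
      moreover have "m - 1 \<le> n" using 1 by simp
      ultimately show ?thesis using Q by (simp add: green_def half_green_def mult_ac)
    qed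
    have "(1 + z\<^sup>2 - 2 * z * b m) * green z u w m n
      - (if m = 0 then 0 else 2 * z * u (m - 1) * green z u w (m - 1) n)
      - 2 * z * w m * green z u w (Suc m) n
      = 2 * w m * z * Q * (((1 + z\<^sup>2 - 2 * z * b m) * left_sol z m
      - (if m = 0 then 0 else (2 * z * u (m - 1)) * (2 * z * w (m - 1)) * left_sol z (m - 1))) - left_sol z (Suc m))"
      unfolding g0 g1 using g2 by (simp add: algebra_simps)
    then show ?thesis using left_rec 1 by simp
  next
    case 2
    have g1: "green z u w (Suc m) n = 2 * u m * z * left_sol z m * jost (Suc (Suc m)) z"
      using 2 by (simp add: green_def half_green_def mult_ac)
    have g2: "green z u w (m - 1) n = 2 * w (m - 1) * z * left_sol z (m - 1) * jost (Suc m) z" if "m \<noteq> 0"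
      using that unfolding 2[symmetric] by (cases m) (simp_all add: green_def half_green_def mult_ac)
    have g0: "green z u w m n = left_sol z m * jost (Suc m) z"
      using 2 by (simp add: green_def half_green_def)
    have "(1 + z\<^sup>2 - 2 * z * b m) * green z u w m n
      - (if m = 0 then 0 else 2 * z * u (m - 1) * green z u w (m - 1) n)
      - 2 * z * w m * green z u w (Suc m) n
      = ((1 + z\<^sup>2 - 2 * z * b m) * left_sol z m
      - (if m = 0 then 0 else (2 * z * u (m - 1)) * (2 * z * w (m - 1)) * left_sol z (m - 1))) * jost (Suc m) z
      - (2 * z * u m) * (2 * z * w m) * left_sol z m * jost (Suc (Suc m)) z"
      unfolding g0 g1 using g2 by (simp add: algebra_simps)
    then show ?thesis using left_rec 2 wronskian[OF z, of m] by (simp add: uw4)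
  next
    case 3
    define Q where "Q = (\<Prod>i=n..<m - 1. 2 * u i * z) * left_sol z n"
    have Q: "(\<Prod>i=n..<m. 2 * u i * z) * left_sol z n = 2 * u (m - 1) * z * Q"
      using 3 by (cases m) (simp_all add: Q_def mult_ac)
    have m0: "m \<noteq> 0" using 3 by simp
    have g0: "green z u w m n = 2 * u (m - 1) * z * Q * jost (Suc m) z"
      using 3 Q by (simp add: green_def half_green_def)
    have g1: "green z u w (Suc m) n = 2 * u m * z * (2 * u (m - 1) * z * Q) * jost (Suc (Suc m)) z"
      using 3 Q by (simp add: green_def half_green_def mult_ac)
    have g2: "green z u w (m - 1) n = Q * jost m z"
      using 3 by (cases "m - 1 = n") (auto simp: green_def half_green_def Q_def)
    have "(1 + z\<^sup>2 - 2 * z * b m) * green z u w m n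
      - (if m = 0 then 0 else 2 * z * u (m - 1) * green z u w (m - 1) n)
      - 2 * z * w m * green z u w (Suc m) n
      = 2 * u (m - 1) * z * Q * ((1 + z\<^sup>2 - 2 * z * b m) * jost (Suc m) z
        - (2 * z * u m) * (2 * z * w m) * jost (Suc (Suc m)) z - jost m z)"
      unfolding g0 g1 g2 using m0 by (simp add: algebra_simps)
    then show ?thesis using jost_rec[OF z, of m] 3 by (simp add: uw4)
  qed
qed

lemma norm_prod_le:
  assumes "\<And>i. cmod (2 * u i - 1) \<le> \<delta> i"
  shows "cmod (\<Prod>i=m..<n. 2 * u i * z) \<le> exp (\<Sum>i. \<delta> i) * cmod z ^ (n - m)"
proof -
  have "cmod (\<Prod>i=m..<n. 2 * u i * z) = (\<Prod>i=m..<n. cmod (2 * u i)) * cmod z ^ (n - m)"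
    by (simp add: prod_norm[symmetric] norm_mult norm_power prod.distrib)
  also have "(\<Prod>i=m..<n. cmod (2 * u i)) \<le> (\<Prod>i=m..<n. exp (\<delta> i))"
  proof (intro prod_mono conjI)
    fix i
    have "cmod (2 * u i) \<le> cmod (2 * u i - 1) + 1"
      using norm_triangle_ineq[of "2 * u i - 1" 1] by simp
    also have "\<dots> \<le> exp (\<delta> i)" using assms[of i] exp_ge_add_one_self[of "\<delta> i"] by linarith
    finally show "cmod (2 * u i) \<le> exp (\<delta> i)" .
  qed simp
  also have "\<dots> = exp (\<Sum>i=m..<n. \<delta> i)" by (simp add: exp_sum)
  also have "\<dots> \<le> exp (\<Sum>i. \<delta> i)"
    using \<delta>_nonneg by (auto intro!: sum_le_suminf summable_delta)
  finally show ?thesis by (simp add: mult_right_mono)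
qed

lemma not_in_spectrum_of_jost_nonzero:
  assumes J: "jacobi_matrix J"
    and Ja: "\<And>n. J (Suc n) n = a n" and Jb: "\<And>n. J n n = b n" and Jc: "\<And>n. J n (Suc n) = c n"
    and z: "z \<noteq> 0" "cmod z < 1" and nz: "jost 0 z \<noteq> 0"
  shows "(z + 1 / z) / 2 \<notin> op_spectrum (matrix_operator J)"
proof -
  have z1: "cmod z \<le> 1" using z by simp
  \<comment> \<open>\<open>green_row\<close> is the equation for \<open>(z + 1 / z) / 2 - J\<close>
    multiplied by \<open>2 * z\<close>, with \<open>jost 0 z\<close> on the right; the sign passes
    to \<open>J - (z + 1 / z) / 2\<close>.\<close>
  define s where "s = - (2 * z / jost 0 z)"
  obtain B where B: "\<And>n. cmod (left_sol z n) \<le> B" using left_sol_bounded[OF z(2)] by blast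
  have B0: "B \<ge> 0" using order.trans[OF norm_ge_zero B] .
  have half: "cmod (half_green z u m n) \<le> exp (\<Sum>i. \<delta> i) * B * growth * cmod z ^ (n - m)"
    if "\<And>i. cmod (2 * u i - 1) \<le> \<delta> i" for u m n
  proof -
    have "cmod (half_green z u m n) \<le> exp (\<Sum>i. \<delta> i) * cmod z ^ (n - m) * B * growth"
      unfolding half_green_def norm_mult using B0
      by (intro mult_mono norm_prod_le that B norm_jost_le z1) auto
    then show ?thesis by (simp add: mult_ac)
  qed
  interpret decaying_kernel "\<lambda>m n. s * green z a c m n" "cmod s * (exp (\<Sum>i. \<delta> i) * B * growth)" "cmod z"
  proof
    show "0 \<le> cmod s * (exp (\<Sum>i. \<delta> i) * B * growth)"
      using B0 growth_ge_1 by simp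
    fix m n
    have "cmod (green z a c m n) \<le> exp (\<Sum>i. \<delta> i) * B * growth * cmod z ^ ((m - n) + (n - m))"
    proof (cases "m \<le> n")
      case True
      then show ?thesis using half[of c m n] c by (simp add: green_def)
    next
      case False
      then show ?thesis using half[of a n m] a by (simp add: green_def)
    qed
    then show "cmod (s * green z a c m n) \<le> cmod s * (exp (\<Sum>i. \<delta> i) * B * growth) * cmod z ^ ((m - n) + (n - m))"
      unfolding norm_mult mult.assoc by (intro mult_left_mono) (simp_all add: mult.assoc)
  qed (use z in auto)
  define D where "D = (\<Sum>i. \<delta> i) + 1"
  have D: "\<delta> i + 1 \<le> D" "\<delta> i \<ge> 0" for i
    using sum_le_suminf[OF summable_delta, of "{i}"] \<delta>_nonneg by (simp_all add: D_def)
  have half_le: "cmod w \<le> D" if "cmod (2 * w - 1) \<le> \<delta> i" for w i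
  proof -
    have "cmod (2 * w) \<le> cmod (2 * w - 1) + 1"
      using norm_triangle_ineq[of "2 * w - 1" 1] by simp
    then have "2 * cmod w \<le> D" using that D[of i] by (simp add: norm_mult)
    then show ?thesis using norm_ge_zero[of w] by linarith
  qed
  have "cmod (J m n) \<le> D" for m n
  proof -
    consider "m = Suc n" | "m = n" | "n = Suc m" | "m > Suc n \<or> n > Suc m" by linarith
    then show ?thesis
    proof cases
      case 1
      then show ?thesis using half_le[OF a] Ja by simp
    next
      case 2
      have "cmod (b n) \<le> D" using b[of n] D[of n] norm_ge_zero[of "b n"] by linarith
      then show ?thesis using 2 Jb by simp
    next
      case 3
      then show ?thesis using half_le[OF c] Jc by simp
    next
      case 4
      then have "J m n = 0" using J unfolding jacobi_matrix_def by blast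
      then show ?thesis using D[of 0] by simp
    qed
  qed
  moreover have sz: "s * (jost 0 z) = - 2 * z" using nz by (simp add: s_def)
  have eq: "x1 + (b m - (z + 1 / z) / 2) * x2 + x3 = - ((1 + z\<^sup>2 - 2 * z * b m) * x2 - 2 * z * x1 - 2 * z * x3) / (2 * z)"
    for m x1 x2 x3
    using z by (simp add: field_simps power2_eq_square)
  have "(if m = 0 then 0 else J m (m - 1) * (s * green z a c (m - 1) n))
      + (J m m - (z + 1 / z) / 2) * (s * green z a c m n)
      + J m (Suc m) * (s * green z a c (Suc m) n) = (if m = n then 1 else 0)" for m n
  proof -
    have "(if m = 0 then 0 else J m (m - 1) * (s * green z a c (m - 1) n))
      + (J m m - (z + 1 / z) / 2) * (s * green z a c m n)
      + J m (Suc m) * (s * green z a c (Suc m) n)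
      = - s * ((1 + z\<^sup>2 - 2 * z * b m) * green z a c m n
      - (if m = 0 then 0 else 2 * z * a (m - 1) * green z a c (m - 1) n)
      - 2 * z * c m * green z a c (Suc m) n) / (2 * z)"
    proof -
      have "J m (m - 1) = a (m - 1)" if "m \<noteq> 0" using Ja[of "m - 1"] that by simp
      then show ?thesis unfolding Jb Jc eq by (simp add: algebra_simps)
    qed
    also have "\<dots> = (if m = n then 1 else 0)"
      using green_row[OF z1, of a c m n] sz z by simp
    finally show ?thesis .
  qed
  moreover have "(if n = 0 then 0 else J (n - 1) n * (s * green z a c m (n - 1)))
      + (J n n - (z + 1 / z) / 2) * (s * green z a c m n)
      + J (Suc n) n * (s * green z a c m (Suc n)) = (if m = n then 1 else 0)" for m n
  proof -
    have "(if n = 0 then 0 else J (n - 1) n * (s * green z a c m (n - 1)))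
      + (J n n - (z + 1 / z) / 2) * (s * green z a c m n)
      + J (Suc n) n * (s * green z a c m (Suc n))
      = - s * ((1 + z\<^sup>2 - 2 * z * b n) * green z c a n m
      - (if n = 0 then 0 else 2 * z * c (n - 1) * green z c a (n - 1) m)
      - 2 * z * a n * green z c a (Suc n) m) / (2 * z)"
    proof -
      have "J (n - 1) n = c (n - 1)" if "n \<noteq> 0" using Jc[of "n - 1"] that by simp
      then show ?thesis unfolding Jb Ja eq green_transpose[of z a c] by (simp add: algebra_simps)
    qed
    also have "\<dots> = (if m = n then 1 else 0)"
      using green_row[OF z1, of c a n m] sz z by (auto simp: mult.commute)
    finally show ?thesis .
  qed
  ultimately show ?thesis by (intro not_in_spectrum[OF J]) 
qed

end

section \<open>Gevrey regularity and flatness\<close>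

text \<open>From \<open>ln s \<le> s - 1\<close> at \<open>s = y / p\<close> one gets
  \<open>(y / p) powr p \<le> exp y\<close>. Only half of \<tau> is spent, so that the other half
  remains for the summation over t.\<close>

lemma power_le_exp_powr:
  fixes t \<tau> \<beta> :: real
  assumes "t > 0" "\<tau> > 0" "\<beta> > 0" "k > 0"
  shows "t ^ k \<le> (2 * real k / (\<tau> * \<beta>)) powr (real k / \<beta>) * exp (\<tau> / 2 * t powr \<beta>)"
proof -
  define y where "y = \<tau> / 2 * t powr \<beta>"
  define p where "p = real k / \<beta>"
  have y: "y > 0" and p: "p > 0" using assms by (auto simp: y_def p_def)
  have "p * ln (y / p) \<le> p * (y / p - 1)"
    using p y by (intro mult_left_mono ln_le_minus_one) auto
  also have "\<dots> \<le> y" using p by (simp add: right_diff_distrib)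
  finally have "(y / p) powr p \<le> exp y" using y p by (simp add: powr_def)
  then have *: "p powr p * (y / p) powr p \<le> p powr p * exp y" by (intro mult_left_mono) auto
  have "p powr p * (y / p) powr p = y powr p" using y p by (simp flip: powr_mult)
  with * have yp: "y powr p \<le> p powr p * exp y" by simp
  have "t ^ k = (t powr \<beta>) powr p"
    using assms by (simp add: powr_powr p_def powr_realpow)
  also have "t powr \<beta> = 2 / \<tau> * y" using assms by (simp add: y_def)
  also have "(2 / \<tau> * y) powr p = (2 / \<tau>) powr p * y powr p"
    by (rule powr_mult)
  also have "\<dots> \<le> (2 / \<tau>) powr p * (p powr p * exp y)"
    by (intro mult_left_mono yp) auto
  also have "\<dots> = (2 / \<tau> * p) powr p * exp y"
    using assms p by (subst powr_mult) auto
  also have "2 / \<tau> * p = 2 * real k / (\<tau> * \<beta>)" by (simp add: p_def)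
  finally show ?thesis by (simp add: y_def p_def)
qed

text \<open>The preceding bound with \<open>k + 2\<close> in place of k gains the factor
  \<open>1 / n\<^sup>2\<close>.\<close>

lemma summable_power_exp_powr:
  fixes \<tau> \<beta> :: real
  assumes "\<tau> > 0" "\<beta> > 0"
  shows "summable (\<lambda>n. real (Suc n) ^ k * exp (- \<tau> * real (Suc n) powr \<beta>))"
proof (rule summable_comparison_test'[of _ 0])
  define C where "C = (2 * real (k + 2) / (\<tau> * \<beta>)) powr (real (k + 2) / \<beta>)"
  have "summable (\<lambda>n. inverse (real (Suc n) ^ 2))"
    using inverse_power_summable[of 2, where 'a=real] by (subst summable_Suc_iff) simp
  then show "summable (\<lambda>n. C * inverse (real (Suc n) ^ 2))" by (rule summable_mult)
  fix n
  define t where "t = real (Suc n)"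
  have t: "t > 0" by (simp add: t_def)
  have "t ^ k * t\<^sup>2 \<le> C * exp (\<tau> / 2 * t powr \<beta>)"
    using power_le_exp_powr[OF t assms, of "k + 2"] by (simp add: C_def power2_eq_square mult_ac)
  also have "\<dots> \<le> C * exp (\<tau> * t powr \<beta>)"
    using assms by (intro mult_left_mono) (auto simp: C_def)
  finally have "t ^ k * t\<^sup>2 * exp (- \<tau> * t powr \<beta>) \<le> C"
    by (simp add: exp_minus field_simps)
  then have "t ^ k * exp (- \<tau> * t powr \<beta>) \<le> C * inverse (t\<^sup>2)"
    using t by (simp add: field_simps)
  then show "norm (real (Suc n) ^ k * exp (- \<tau> * real (Suc n) powr \<beta>)) \<le> C * inverse (real (Suc n) ^ 2)"
    by (simp add: t_def)
qed

text \<open>Passing from n to \<open>Suc n\<close> avoids the base 0, at the cost of a smaller rate: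
  \<open>Suc n / 2 \<le> n\<close> for positive n, and the factor \<open>exp \<tau>\<close> absorbs
  \<open>n = 0\<close>.\<close>

lemma exp_powr_shift:
  fixes \<tau> \<beta> :: real
  assumes "\<tau> > 0" "\<beta> > 0"
  shows "exp (- \<tau> * real n powr \<beta>) \<le> exp \<tau> * exp (- (\<tau> / 2 powr \<beta>) * real (Suc n) powr \<beta>)"
proof -
  have "(real (Suc n) / 2) powr \<beta> \<le> real n powr \<beta> + 1"
  proof (cases "n = 0")
    case True
    then show ?thesis using assms powr_le1[of \<beta> "1/2"] by simp
  next
    case False
    then have "(real (Suc n) / 2) powr \<beta> \<le> real n powr \<beta>"
      using assms by (intro powr_mono2) auto
    then show ?thesis by simp
  qed
  then have "\<tau> * (real (Suc n) powr \<beta> / 2 powr \<beta>) \<le> \<tau> * (real n powr \<beta> + 1)"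
    using assms by (intro mult_left_mono) (auto simp: powr_divide)
  then show ?thesis by (simp add: algebra_simps flip: exp_add)
qed

lemma power_self_le_fact_exp: "real k ^ k \<le> fact k * exp (real k)"
proof -
  have "(\<Sum>n\<in>{k}. real k ^ n /\<^sub>R fact n) \<le> (\<Sum>n. real k ^ n /\<^sub>R fact n)"
    by (intro sum_le_suminf summable_exp_generic) auto
  then have "real k ^ k / fact k \<le> exp (real k)"
    by (simp add: exp_def divide_inverse mult.commute)
  then show ?thesis by (simp add: field_simps)
qed

text \<open>A Gevrey bound of order \<open>1 / \<beta>\<close>: the binomial coefficients stand for derivatives divided by
  factorials.\<close>

lemma binomial_exp_powr_bound:
  fixes \<tau> \<beta> :: real
  assumes "\<tau> > 0" "\<beta> > 0" "k > 0" "t > 0"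
  defines "A \<equiv> 2 * exp 1 * (2 / (\<tau> * \<beta>)) powr (1 / \<beta>)"
  shows "real (2 * t choose k) * exp (- \<tau> * real t powr \<beta>)
    \<le> (A * real k powr (1 / \<beta> - 1)) ^ k * exp (- (\<tau> / 2) * real t powr \<beta>)"
proof -
  have kk: "real k ^ k > 0" using assms by simp
  have "real (2 * t choose k) \<le> real (2 * t) ^ k / fact k" by (rule binomial_le_fact)
  also have "\<dots> = real (2 * t) ^ k * (1 / fact k)" by simp
  \<comment> \<open>Trading the factorial for \<open>real k ^ k\<close> is what lowers the exponent
    of k from \<open>1 / \<beta>\<close> to \<open>1 / \<beta> - 1\<close>.\<close>
  also have "1 / fact k \<le> exp (real k) / real k ^ k"
    using power_self_le_fact_exp[of k] kk by (simp add: field_simps)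
  finally have "real (2 * t choose k) \<le> real (2 * t) ^ k * (exp (real k) / real k ^ k)"
    by (simp add: mult_left_mono)
  also have "\<dots> = real t ^ k * (2 ^ k * exp (real k) / real k ^ k)" by (simp add: power_mult_distrib)
  also have "\<dots> \<le> (2 * real k / (\<tau> * \<beta>)) powr (real k / \<beta>) * exp (\<tau> / 2 * real t powr \<beta>)
      * (2 ^ k * exp (real k) / real k ^ k)"
    using assms by (intro mult_right_mono power_le_exp_powr) auto
  also have "(2 * real k / (\<tau> * \<beta>)) powr (real k / \<beta>)
      = ((2 / (\<tau> * \<beta>)) powr (1 / \<beta>) * real k powr (1 / \<beta>)) ^ k"
  proof -
    have "2 * real k / (\<tau> * \<beta>) = 2 / (\<tau> * \<beta>) * real k" by simp
    then have "(2 * real k / (\<tau> * \<beta>)) powr (1 / \<beta>) = (2 / (\<tau> * \<beta>)) powr (1 / \<beta>) * real k powr (1 / \<beta>)"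
      by (simp only: powr_mult)
    moreover have "(2 * real k / (\<tau> * \<beta>)) powr (real k / \<beta>) = ((2 * real k / (\<tau> * \<beta>)) powr (1 / \<beta>)) ^ k"
      using assms by (subst powr_realpow[symmetric]) (auto simp: powr_powr)
    ultimately show ?thesis by simp
  qed
  finally have "real (2 * t choose k) * exp (- \<tau> * real t powr \<beta>)
    \<le> ((2 / (\<tau> * \<beta>)) powr (1 / \<beta>) * real k powr (1 / \<beta>)) ^ k * exp (\<tau> / 2 * real t powr \<beta>)
      * (2 ^ k * exp (real k) / real k ^ k) * exp (- \<tau> * real t powr \<beta>)"
    by (intro mult_right_mono) auto
  also have "\<dots> = ((2 / (\<tau> * \<beta>)) powr (1 / \<beta>) * real k powr (1 / \<beta>)) ^ k * (2 ^ k * exp (real k) / real k ^ k)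
      * (exp (\<tau> / 2 * real t powr \<beta>) * exp (- \<tau> * real t powr \<beta>))"
    by (simp only: mult_ac)
  also have "exp (\<tau> / 2 * real t powr \<beta>) * exp (- \<tau> * real t powr \<beta>) = exp (- (\<tau> / 2) * real t powr \<beta>)"
    by (simp flip: exp_add)
  also have "((2 / (\<tau> * \<beta>)) powr (1 / \<beta>) * real k powr (1 / \<beta>)) ^ k * (2 ^ k * exp (real k) / real k ^ k)
      = (A * real k powr (1 / \<beta> - 1)) ^ k"
  proof -
    have "exp (real k) = exp 1 ^ k" using exp_of_nat_mult[of k "1::real"] by simp
    moreover have "real k powr (1 / \<beta> - 1) = real k powr (1 / \<beta>) / real k"
      using assms by (simp add: powr_diff)
    ultimately show ?thesis by (simp add: A_def power_mult_distrib power_divide)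
  qed
  finally show ?thesis .
qed

text \<open>The optimal number of zeros to divide out at distance \<open>R\<close> is about
  \<open>(exp 1 * A * R) powr (- 1 / \<sigma>)\<close>.\<close>

lemma flat_optimize:
  fixes A C R r \<sigma> x :: real
  assumes "A > 0" "\<sigma> > 0" "C \<ge> 0" "0 \<le> r" "r \<le> R" "R > 0"
    and "x \<le> C" and le: "\<And>k. k > 0 \<Longrightarrow> x \<le> C * (A * real k powr \<sigma> * r) ^ k"
  shows "x \<le> C * exp (1 - (exp 1 * A) powr (- (1 / \<sigma>)) * R powr (- (1 / \<sigma>)))"
proof -
  define Y where "Y = (exp 1 * A * R) powr (- (1 / \<sigma>))"
  have Y: "Y = (exp 1 * A) powr (- (1 / \<sigma>)) * R powr (- (1 / \<sigma>))"
    unfolding Y_def by (rule powr_mult)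
  have Y0: "Y > 0" using assms by (simp add: Y_def)
  define k where "k = nat \<lfloor>Y\<rfloor>"
  have k: "real k \<le> Y" "Y < real k + 1" using Y0 by (auto simp: k_def)
  have "x \<le> C * exp (1 - Y)"
  \<comment> \<open>If \<open>k = 0\<close> then \<open>Y < 1\<close> and the plain bound C
    suffices. Otherwise every one of the k factors is at most \<open>exp (-1)\<close>, and rounding
    Y down to k costs the 1 in the exponent.\<close>
  proof (cases "k = 0")
    case True
    then have "1 \<le> exp (1 - Y)" using k by simp
    then have "C * 1 \<le> C * exp (1 - Y)" using assms by (intro mult_left_mono)
    then show ?thesis using assms by simp
  next
    case False
    have "real k powr \<sigma> \<le> Y powr \<sigma>" using k assms by (intro powr_mono2) auto
    also have "\<dots> = (exp 1 * A * R) powr (-1)" using assms by (simp add: Y_def powr_powr)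
    also have "\<dots> = 1 / (exp 1 * A * R)" using assms by (simp add: powr_minus_divide)
    finally have "A * real k powr \<sigma> * r \<le> A * (1 / (exp 1 * A * R)) * R"
      using assms by (intro mult_mono) auto
    also have "\<dots> = exp (-1)" using assms by (simp add: exp_minus field_simps)
    finally have "(A * real k powr \<sigma> * r) ^ k \<le> exp (-1) ^ k"
      using assms by (intro power_mono) auto
    also have "\<dots> = exp (- real k)" using exp_of_nat_mult[of k "-1::real"] by simp
    also have "\<dots> \<le> exp (1 - Y)" using k by simp
    finally have "C * (A * real k powr \<sigma> * r) ^ k \<le> C * exp (1 - Y)" using assms by (intro mult_left_mono)
    moreover have "x \<le> C * (A * real k powr \<sigma> * r) ^ k" using False by (intro le) simp
    ultimately show ?thesis by linarith
  qed
  then show ?thesis by (simp add: Y)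
qed

section \<open>Flatness of the Jost function at limit points of its zeros\<close>

context decaying_jacobi
begin

lemma jost_holomorphic: "jost 0 holomorphic_on ball 0 1"
proof (rule power_series_holomorphic)
  fix z :: complex assume "z \<in> ball 0 1"
  then have z: "cmod z \<le> 1" by simp
  show "(\<lambda>n. jost_coeff n * (z - 0) ^ n) sums jost 0 z"
    using summable_sums[OF summable_power_series_cball(1)[OF summable_norm_jost_coeff z]]
    by (simp add: jost_power_series[OF z])
qed

lemma jost_continuous: "continuous_on (cball 0 1) (jost 0)"
proof -
  have "continuous_on (cball 0 1) (\<lambda>z. \<Sum>m. jost_coeff m * z ^ m)"
  proof (rule uniform_limit_theorem)
    show "uniform_limit (cball 0 1) (\<lambda>n z. \<Sum>m<n. jost_coeff m * z ^ m) (\<lambda>z. \<Sum>m. jost_coeff m * z ^ m) sequentially"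
      by (rule Weierstrass_m_test[OF _ summable_norm_jost_coeff])
         (auto simp: norm_mult norm_power mult_left_le power_le_one)
  qed (auto intro!: always_eventually continuous_intros)
  then show ?thesis by (rule continuous_on_cong[THEN iffD1, rotated 2]) (auto simp: jost_power_series)
qed

lemma jost_zeros_flat:
  assumes "w islimpt {z \<in> ball 0 1. jost 0 z = 0}" "cmod x \<le> 1"
  shows "cmod (jost 0 x) \<le> cmod (x - w) ^ k * (1 + (\<Sum>M. jost_err M * real (2 * Suc M choose k)))"
proof -
  have "cmod (\<Sum>m. jost_coeff m * x ^ m) \<le> cmod (x - w) ^ k * (\<Sum>m. cmod (jost_coeff m) * real (m choose k))"
    by (rule power_series_flat_at_limit_of_zeros[OF jost_coeff_binomial(1) _ _ assms])
       (auto simp: jost_power_series)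
  also have "\<dots> \<le> cmod (x - w) ^ k * (1 + (\<Sum>M. jost_err M * real (2 * Suc M choose k)))"
    by (intro mult_left_mono jost_coeff_binomial) auto
  finally show ?thesis by (simp add: jost_power_series[OF assms(2)])
qed

end

lemma jost_function_of_jacobi_class:
  assumes J: "J \<in> jacobi_class \<beta>" and \<beta>: "0 < \<beta>" "\<beta> < 1"
  obtains f :: "complex \<Rightarrow> complex" and L \<kappa> :: real where
    "continuous_on (cball 0 1) f" "f holomorphic_on ball 0 1" "f 0 = 1" "\<kappa> > 0"
    "\<And>z. z \<noteq> 0 \<Longrightarrow> cmod z < 1 \<Longrightarrow> f z \<noteq> 0 \<Longrightarrow> (z + 1 / z) / 2 \<notin> op_spectrum (matrix_operator J)"
    "\<And>x. cmod x \<le> 1 \<Longrightarrow> cmod (f x) \<le> exp L"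
    "\<And>w x R. w islimpt {z \<in> ball 0 1. f z = 0} \<Longrightarrow> cmod x \<le> 1 \<Longrightarrow> cmod (x - w) \<le> R \<Longrightarrow> R > 0 \<Longrightarrow>
       cmod (f x) \<le> exp (L - \<kappa> * R powr (- (\<beta> / (1 - \<beta>))))"
proof -
  from J obtain C1 C2 where jm: "jacobi_matrix J" and C: "C1 > 0" "C2 > 0"
    and le: "\<And>n. cmod (J (Suc n) n - 1/2) + cmod (J n (Suc n) - 1/2) + cmod (J n n)
              \<le> C1 * exp (- C2 * real n powr \<beta>)"
    unfolding jacobi_class_def by blast
  \<comment> \<open>With u and v the deviations of the off-diagonal entries from 1/2,
    \<open>1 - 4 * a n * c n\<close> is \<open>- (2 * u + 2 * v + 4 * u * v)\<close>; the quadratic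
    term is at most \<open>4 * C1\<close> times the decaying bound.\<close>
  define D where "D = (2 + 4 * C1) * C1"
  have D: "D > 0" using C by (simp add: D_def)
  define \<delta> where "\<delta> n = D * exp (- C2 * real n powr \<beta>)" for n
  define \<tau> where "\<tau> = C2 / 2 powr \<beta>"
  have \<tau>: "\<tau> > 0" using C by (simp add: \<tau>_def)
  have \<delta>_le: "\<delta> n \<le> D * exp C2 * exp (- \<tau> * real (Suc n) powr \<beta>)" for n
    using exp_powr_shift[OF C(2) \<beta>(1), of n] D by (simp add: \<delta>_def \<tau>_def mult.assoc)
  have \<delta>_ge: "2 * (C1 * exp (- C2 * real n powr \<beta>)) \<le> \<delta> n" for n
    using C unfolding \<delta>_def D_def mult.assoc[symmetric] by (intro mult_right_mono) (auto simp: algebra_simps)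
  interpret decaying_jacobi "\<lambda>n. J (Suc n) n" "\<lambda>n. J n n" "\<lambda>n. J n (Suc n)" \<delta>
  proof
    fix n
    define u where "u = J (Suc n) n - 1/2"
    define v where "v = J n (Suc n) - 1/2"
    define \<eta> where "\<eta> = C1 * exp (- C2 * real n powr \<beta>)"
    have le: "cmod u + cmod v + cmod (J n n) \<le> \<eta>" using le[of n] by (simp add: u_def v_def \<eta>_def)
    have ge: "2 * \<eta> \<le> \<delta> n" using \<delta>_ge by (simp add: \<eta>_def)
    show "2 * cmod (J n n) \<le> \<delta> n" using le ge norm_ge_zero[of u] norm_ge_zero[of v] by linarith
    have "2 * J (Suc n) n - 1 = 2 * u" "2 * J n (Suc n) - 1 = 2 * v" by (simp_all add: u_def v_def)
    then have "cmod (2 * J (Suc n) n - 1) = 2 * cmod u" "cmod (2 * J n (Suc n) - 1) = 2 * cmod v"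
      by (simp_all add: norm_mult)
    then show "cmod (2 * J (Suc n) n - 1) \<le> \<delta> n" "cmod (2 * J n (Suc n) - 1) \<le> \<delta> n"
      using le ge norm_ge_zero[of u] norm_ge_zero[of v] norm_ge_zero[of "J n n"] by linarith+
    have "1 - 4 * J (Suc n) n * J n (Suc n) = - (2 * u + 2 * v + 4 * u * v)"
      by (simp add: u_def v_def algebra_simps)
    then have "cmod (1 - 4 * J (Suc n) n * J n (Suc n)) = cmod (2 * u + 2 * v + 4 * u * v)"
      by (simp only: norm_minus_cancel)
    also have "\<dots> \<le> cmod (2 * u) + cmod (2 * v) + cmod (4 * u * v)"
      by (intro norm_triangle_mono order.refl)
    also have "\<dots> = 2 * (cmod u + cmod v) + 4 * (cmod u * cmod v)" by (simp add: norm_mult)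
    also have "\<dots> \<le> 2 * \<eta> + 4 * (C1 * \<eta>)"
    proof -
      have "\<eta> \<le> C1" using C by (simp add: \<eta>_def)
      moreover have "cmod u \<le> \<eta>" "cmod v \<le> \<eta>" "cmod u + cmod v \<le> \<eta>"
        using le norm_ge_zero[of u] norm_ge_zero[of v] norm_ge_zero[of "J n n"] by linarith+
      ultimately show ?thesis using C by (intro add_mono mult_left_mono mult_mono) auto
    qed
    also have "\<dots> = \<delta> n" by (simp add: \<eta>_def \<delta>_def D_def algebra_simps)
    finally show "cmod (1 - 4 * J (Suc n) n * J n (Suc n)) \<le> \<delta> n" .
  next
    fix k
    show "summable (\<lambda>n. real (Suc n) ^ k * \<delta> n)"
    proof (rule summable_comparison_test'[of _ 0])
      show "summable (\<lambda>n. D * exp C2 * (real (Suc n) ^ k * exp (- \<tau> * real (Suc n) powr \<beta>)))"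
        by (intro summable_mult summable_power_exp_powr \<tau> \<beta>)
      fix n
      have "real (Suc n) ^ k * \<delta> n \<le> real (Suc n) ^ k * (D * exp C2 * exp (- \<tau> * real (Suc n) powr \<beta>))"
        by (intro mult_left_mono \<delta>_le) simp
      then show "norm (real (Suc n) ^ k * \<delta> n) \<le> D * exp C2 * (real (Suc n) ^ k * exp (- \<tau> * real (Suc n) powr \<beta>))"
        using D by (simp add: \<delta>_def mult_ac)
    qed
  qed
  define \<sigma> where "\<sigma> = 1 / \<beta> - 1"
  have \<sigma>: "\<sigma> > 0" "1 / \<sigma> = \<beta> / (1 - \<beta>)" using \<beta> by (simp_all add: \<sigma>_def field_simps)
  define A0 where "A0 = 2 * exp 1 * (2 / (\<tau> * \<beta>)) powr (1 / \<beta>)"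
  \<comment> \<open>A lower bound of 1 makes \<open>(A * real k powr \<sigma>) ^ k\<close> at least
    1, so that it absorbs the summand 1 coming from the constant coefficient.\<close>
  define A where "A = max 1 A0"
  have A0: "A0 > 0" and A: "A \<ge> 1" "A0 \<le> A" using \<tau> \<beta> by (auto simp: A0_def A_def)
  have s: "summable (\<lambda>M. real (Suc M) * exp (- (\<tau> / 2) * real (Suc M) powr \<beta>))"
    using summable_power_exp_powr[of "\<tau> / 2" \<beta> 1] \<tau> \<beta> by simp
  define B where "B = 2 * growth * (D * exp C2) * (\<Sum>M. real (Suc M) * exp (- (\<tau> / 2) * real (Suc M) powr \<beta>))"
  have B: "B \<ge> 0" unfolding B_def using growth_ge_1 D by (intro mult_nonneg_nonneg suminf_nonneg s) auto
  have Bk: "(\<Sum>M. jost_err M * real (2 * Suc M choose k)) \<le> B * (A0 * real k powr \<sigma>) ^ k" if k: "k > 0" for k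
  proof -
    have "jost_err M * real (2 * Suc M choose k)
        \<le> 2 * growth * (D * exp C2) * (A0 * real k powr \<sigma>) ^ k * (real (Suc M) * exp (- (\<tau> / 2) * real (Suc M) powr \<beta>))" for M
    proof -
      have "jost_err M * real (2 * Suc M choose k)
          \<le> 2 * growth * (real (Suc M) * (D * exp C2 * exp (- \<tau> * real (Suc M) powr \<beta>))) * real (2 * Suc M choose k)"
        unfolding jost_err_def using growth_ge_1 by (intro mult_right_mono mult_left_mono \<delta>_le) auto
      also have "\<dots> = 2 * growth * (D * exp C2) * (real (Suc M) * (real (2 * Suc M choose k) * exp (- \<tau> * real (Suc M) powr \<beta>)))"
        by (simp only: mult_ac)
      also have "\<dots> \<le> 2 * growth * (D * exp C2) * (real (Suc M) * ((A0 * real k powr \<sigma>) ^ k * exp (- (\<tau> / 2) * real (Suc M) powr \<beta>)))"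
        unfolding A0_def \<sigma>_def using growth_ge_1 D
        by (intro mult_left_mono binomial_exp_powr_bound \<tau> \<beta> k) auto
      finally show ?thesis by (simp only: mult_ac)
    qed
    then have "(\<Sum>M. jost_err M * real (2 * Suc M choose k))
        \<le> (\<Sum>M. 2 * growth * (D * exp C2) * (A0 * real k powr \<sigma>) ^ k * (real (Suc M) * exp (- (\<tau> / 2) * real (Suc M) powr \<beta>)))"
      by (intro suminf_le summable_mult s summable_jost_err_binomial)
    also have "\<dots> = B * (A0 * real k powr \<sigma>) ^ k"
      unfolding suminf_mult[OF s] B_def by (simp only: mult_ac)
    finally show ?thesis .
  qed
  define C where "C = max (growth) (1 + B)"
  have C1: "C \<ge> 1" "growth \<le> C" using growth_ge_1 by (auto simp: C_def)
  define L where "L = ln C + 1"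
  have CL: "C * exp (1 - y) = exp (L - y)" for y
    using C1 by (simp add: L_def exp_add exp_diff)
  define \<kappa> where "\<kappa> = (exp 1 * A) powr (- (1 / \<sigma>))"
  show ?thesis
  proof (rule that[of "jost 0" \<kappa> L])
    show "\<kappa> > 0" using A by (simp add: \<kappa>_def)
    show "(z + 1 / z) / 2 \<notin> op_spectrum (matrix_operator J)" if "z \<noteq> 0" "cmod z < 1" "jost 0 z \<noteq> 0" for z
      using not_in_spectrum_of_jost_nonzero[OF jm _ _ _ that] by simp
    fix x :: complex assume x: "cmod x \<le> 1"
    have fC: "cmod (jost 0 x) \<le> C" using norm_jost_le[OF x, of 0] C1 by linarith
    also have "C \<le> C * exp (1 - 0)" using C1 by simp
    also have "\<dots> = exp L" by (subst CL) simp
    finally show "cmod (jost 0 x) \<le> exp L" .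
    fix w R assume w: "w islimpt {z \<in> ball 0 1. jost 0 z = 0}" and R: "cmod (x - w) \<le> R" "R > 0"
    have "cmod (jost 0 x) \<le> C * exp (1 - (exp 1 * A) powr (- (1 / \<sigma>)) * R powr (- (1 / \<sigma>)))"
    proof (rule flat_optimize[OF _ \<sigma>(1) _ _ R fC])
      fix k :: nat assume k: "k > 0"
      have "1 \<le> (A * real k powr \<sigma>) ^ k"
        using A k \<sigma> by (intro one_le_power mult_ge1_I ge_one_powr_ge_zero) auto
      moreover have "(A0 * real k powr \<sigma>) ^ k \<le> (A * real k powr \<sigma>) ^ k"
        using A A0 by (intro power_mono mult_right_mono) auto
      then have "B * (A0 * real k powr \<sigma>) ^ k \<le> B * (A * real k powr \<sigma>) ^ k" using B by (intro mult_left_mono)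
      ultimately have "1 + (\<Sum>M. jost_err M * real (2 * Suc M choose k)) \<le> (1 + B) * (A * real k powr \<sigma>) ^ k"
        using Bk[OF k] by (simp add: distrib_right)
      also have "\<dots> \<le> C * (A * real k powr \<sigma>) ^ k"
        using A by (intro mult_right_mono) (auto simp: C_def)
      finally have "cmod (x - w) ^ k * (1 + (\<Sum>M. jost_err M * real (2 * Suc M choose k)))
          \<le> cmod (x - w) ^ k * (C * (A * real k powr \<sigma>) ^ k)" by (intro mult_left_mono) auto
      then show "cmod (jost 0 x) \<le> C * (A * real k powr \<sigma> * cmod (x - w)) ^ k"
        using jost_zeros_flat[OF w x, of k] by (simp add: power_mult_distrib mult_ac)
    qed (use A C1 in auto)
    then show "cmod (jost 0 x) \<le> exp (L - \<kappa> * R powr (- (\<beta> / (1 - \<beta>))))"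
      by (simp only: CL \<kappa>_def \<sigma>(2))
  qed (simp_all add: jost_continuous jost_holomorphic jost_at_0)
qed

section \<open>Limit points of the discrete spectrum\<close>

lemma norm_cis_diff_le: "cmod (cis x - cis y) \<le> \<bar>x - y\<bar>"
proof -
  have "cis x - cis y = cis y * (exp (\<i> * of_real (x - y)) - 1)"
    by (simp add: cis_conv_exp[symmetric] right_diff_distrib cis_mult del: of_real_diff)
  then have "cmod (cis x - cis y) = 2 * \<bar>sin ((x - y) / 2)\<bar>"
    by (simp only: norm_mult norm_cis dist_exp_i_1 mult_1)
  also have "\<dots> \<le> 2 * \<bar>(x - y) / 2\<bar>" by (intro mult_left_mono abs_sin_x_le_abs_x) auto
  finally show ?thesis by simp
qed

text \<open>The two solutions are \<open>z - s\<close> and \<open>z + s\<close>, with product 1.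
  Either one of them lies in the open disk or both lie on the circle; in the latter case they are
  conjugate and z is their common real part, a point of \<open>{-1..1}\<close>.\<close>

lemma joukowski_preimage:
  fixes z :: complex
  assumes "z \<notin> complex_of_real ` {-1..1}"
  obtains w where "w \<noteq> 0" "cmod w < 1" "z = (w + 1 / w) / 2"
proof -
  define s where "s = csqrt (z\<^sup>2 - 1)"
  have prod: "(z - s) * (z + s) = 1"
    using power2_csqrt[of "z\<^sup>2 - 1"] by (simp add: s_def algebra_simps power2_eq_square)
  have nz: "z - s \<noteq> 0" "z + s \<noteq> 0" using prod by auto
  have inv: "1 / (z - s) = z + s" "1 / (z + s) = z - s" using prod nz by (simp_all add: field_simps)
  consider "cmod (z - s) < 1" | "cmod (z - s) > 1" | "cmod (z - s) = 1" by linarith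
  then show ?thesis
  proof cases
    case 1
    then show ?thesis using nz inv by (intro that[of "z - s"]) auto
  next
    case 2
    have "cmod (z - s) * cmod (z + s) = 1" using prod by (metis norm_mult norm_one)
    then have "cmod (z + s) < 1" using 2 nz by (smt (verit) mult_le_cancel_left1 zero_less_norm_iff)
    then show ?thesis using nz inv by (intro that[of "z + s"]) auto
  next
    case 3
    have "(z - s) * cnj (z - s) = 1" using complex_norm_square[of "z - s"] 3 by simp
    then have "cnj (z - s) = z + s" using prod nz by (metis mult_left_cancel)
    then have "2 * z = (z - s) + cnj (z - s)" by simp
    also have "\<dots> = of_real (2 * Re (z - s))" by (rule complex_add_cnj)
    finally have "2 * z = 2 * of_real (Re (z - s))" by (simp only: of_real_mult of_real_numeral)
    then have "z = of_real (Re (z - s))" by (rule mult_left_cancel[THEN iffD1, rotated]) simp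
    moreover have "Re (z - s) \<in> {-1..1}" using abs_Re_le_cmod[of "z - s"] 3 by (auto simp: abs_le_iff)
    ultimately show ?thesis using assms by blast
  qed
qed

lemma norm_islimpt_zeros:
  assumes "continuous_on (cball 0 1) f" "f holomorphic_on ball 0 1" "f 0 \<noteq> 0"
    and w: "w islimpt {z \<in> ball 0 1. f z = (0::complex)}"
  shows "cmod w = 1"
proof -
  have "w islimpt cball 0 1" using w by (rule islimpt_subset) auto
  then have "w \<in> cball 0 1" using closed_cball closed_limpt by blast
  moreover have "\<not> cmod w < 1"
  proof
    assume "cmod w < 1"
    then have "f 0 = 0"
      by (intro analytic_continuation[OF assms(2) _ _ _ _ w, of 0]) auto
    then show False using assms(3) by simp
  qed
  ultimately show ?thesis by simp
qed

text \<open>Preimages of a sequence tending to x accumulate at some w in the closed disk. There f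
  vanishes, so w is not the pole 0 of the map and the limit can be taken; on the circle the map is
  the real part.\<close>

lemma islimpt_joukowski_image:
  assumes cont: "continuous_on (cball 0 1) f" and hol: "f holomorphic_on ball 0 1" and f0: "f 0 \<noteq> 0"
    and S: "S \<subseteq> (\<lambda>z. (z + 1 / z) / 2) ` {z \<in> ball 0 1. f z = (0::complex)}"
    and x: "x islimpt S"
  obtains w where "w islimpt {z \<in> ball 0 1. f z = 0}" "x = complex_of_real (Re w)"
proof -
  let ?Z = "{z \<in> ball 0 1. f z = 0}" and ?j = "\<lambda>z::complex. (z + 1 / z) / 2"
  obtain u where u: "\<And>n. u n \<in> S - {x}" "u \<longlonglongrightarrow> x"
    using x by (auto simp: islimpt_sequential)
  have "\<forall>n. \<exists>v\<in>?Z. u n = ?j v" using u(1) S by blast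
  then obtain v where v: "\<And>n. v n \<in> ?Z" "\<And>n. u n = ?j (v n)" by metis
  have "compact (cball (0::complex) 1)" by simp
  moreover have "\<forall>n. v n \<in> cball 0 1" using v(1) by (auto simp: less_imp_le)
  ultimately obtain w r where w: "w \<in> cball 0 1" "strict_mono (r :: nat \<Rightarrow> nat)" "(v \<circ> r) \<longlonglongrightarrow> w"
    by (metis compact_def)
  have "(\<lambda>n. f ((v \<circ> r) n)) \<longlonglongrightarrow> f w"
    using continuous_on_tendsto_compose[OF cont w(3,1)] v(1) by (auto simp: less_imp_le)
  moreover have "(\<lambda>n. f ((v \<circ> r) n)) = (\<lambda>n. 0)" using v(1) by auto
  ultimately have "f w = 0" by (simp add: LIMSEQ_const_iff)
  then have "w \<noteq> 0" using f0 by auto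
  then have "(\<lambda>n. ?j ((v \<circ> r) n)) \<longlonglongrightarrow> ?j w" by (intro tendsto_intros w(3)) auto
  moreover have "(\<lambda>n. ?j ((v \<circ> r) n)) = u \<circ> r" using v(2) by auto
  ultimately have jw: "x = ?j w"
    using LIMSEQ_unique[OF LIMSEQ_subseq_LIMSEQ[OF u(2) w(2)]] by simp
  have "v (r n) \<noteq> w" for n using u(1)[of "r n"] v(2)[of "r n"] jw by auto
  then have lim: "w islimpt ?Z"
    unfolding islimpt_sequential using v(1) w(3) by (intro exI[of _ "v \<circ> r"]) auto
  then have "cmod w = 1" by (rule norm_islimpt_zeros[OF cont hol f0])
  then have "w * cnj w = 1" using complex_norm_square[of w] by simp
  then have "1 / w = cnj w" using \<open>w \<noteq> 0\<close> by (simp add: field_simps)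
  then have "x = of_real (Re w)" using jw by (simp add: complex_add_cnj)
  then show ?thesis using that lim by blast
qed

lemma (in flat_on_circle) flat_on_circle_subset:
  "\<Theta>' \<subseteq> \<Theta> \<Longrightarrow> flat_on_circle g \<Theta>' \<gamma> A c"
  using cont hol g0 c bound flat by unfold_locales auto

text \<open>Multiplying \<open>f\<close> by its reflection makes the flatness symmetric with respect to the real axis,
  so that it can be expressed in terms of the real parts of the limit points of zeros.\<close>

lemma jacobi_class_flat_on_circle:
  assumes J: "J \<in> jacobi_class \<beta>" and \<beta>: "0 < \<beta>" "\<beta> < 1"
  obtains Z g A c where
    "flat_on_circle g {y \<in> {0..pi}. \<exists>w. w islimpt Z \<and> Re w = cos y} (\<beta> / (1 - \<beta>)) A c"
    "bounded Z" "discrete_spectrum J \<subseteq> (\<lambda>z. (z + 1 / z) / 2) ` Z"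
    "\<And>w. w islimpt Z \<Longrightarrow> cmod w = 1"
    "\<And>x. x \<in> spectral_limit_set J \<Longrightarrow> \<exists>w. w islimpt Z \<and> x = complex_of_real (Re w)"
proof -
  obtain f L \<kappa> where cont: "continuous_on (cball 0 1) f" and hol: "f holomorphic_on ball 0 1"
    and f0: "f 0 = 1" and \<kappa>: "\<kappa> > 0"
    and resolvent: "\<And>z. z \<noteq> 0 \<Longrightarrow> cmod z < 1 \<Longrightarrow> f z \<noteq> 0 \<Longrightarrow> (z + 1 / z) / 2 \<notin> op_spectrum (matrix_operator J)"
    and bound: "\<And>x. cmod x \<le> 1 \<Longrightarrow> cmod (f x) \<le> exp L"
    and flat: "\<And>w x R. w islimpt {z \<in> ball 0 1. f z = 0} \<Longrightarrow> cmod x \<le> 1 \<Longrightarrow> cmod (x - w) \<le> R \<Longrightarrow> R > 0 \<Longrightarrow>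
       cmod (f x) \<le> exp (L - \<kappa> * R powr (- (\<beta> / (1 - \<beta>))))"
    by (rule jost_function_of_jacobi_class[OF assms], rule that)
  define Z where "Z = {z \<in> ball 0 1. f z = 0}"
  define \<Theta> where "\<Theta> = {y \<in> {0..pi}. \<exists>w. w islimpt Z \<and> Re w = cos y}"
  have ds: "discrete_spectrum J \<subseteq> (\<lambda>z. (z + 1 / z) / 2) ` Z"
  proof
    fix x assume x: "x \<in> discrete_spectrum J"
    then obtain w where w: "w \<noteq> 0" "cmod w < 1" "x = (w + 1 / w) / 2"
      using joukowski_preimage[of x] by (auto simp: discrete_spectrum_def)
    have "f w = 0"
      using resolvent[OF w(1,2)] x unfolding w(3)[symmetric] by (auto simp: discrete_spectrum_def)
    then show "x \<in> (\<lambda>z. (z + 1 / z) / 2) ` Z" using w by (auto simp: Z_def)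
  qed
  have one: "cmod w = 1" if "w islimpt Z" for w
    using norm_islimpt_zeros[OF cont hol _ that[unfolded Z_def]] f0 by simp
  have lim: "\<exists>w. w islimpt Z \<and> x = complex_of_real (Re w)" if "x \<in> spectral_limit_set J" for x
  proof -
    have "x islimpt discrete_spectrum J" using that by (simp add: spectral_limit_set_def)
    from islimpt_joukowski_image[OF cont hol _ ds[unfolded Z_def] this] f0 show ?thesis
      unfolding Z_def by (metis one_neq_zero)
  qed
  have flat_on: "flat_on_circle (\<lambda>z. f z * cnj (f (cnj z))) \<Theta> (\<beta> / (1 - \<beta>)) (2 * L) \<kappa>"
  proof
    show "continuous_on (cball 0 1) (\<lambda>z. f z * cnj (f (cnj z)))"
      by (intro continuous_intros cont continuous_on_compose2[OF cont]) auto
    have "(cnj \<circ> f \<circ> cnj) holomorphic_on ball 0 1"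
    proof -
      have "cnj ` ball 0 1 = ball 0 1"
        by (auto simp: image_iff intro!: bexI[of _ "cnj _"])
      then show ?thesis using hol by (simp add: holomorphic_on_compose_cnj_cnj)
    qed
    then show "(\<lambda>z. f z * cnj (f (cnj z))) holomorphic_on ball 0 1"
      using hol by (auto simp: o_def intro: holomorphic_on_mult)
    show "cmod (f 0 * cnj (f (cnj 0))) \<ge> 1" by (simp add: f0)
    show "\<kappa> > 0" by (rule \<kappa>)
    have prod: "cmod (f (cis x) * cnj (f (cnj (cis x)))) = cmod (f (cis x)) * cmod (f (cis (- x)))" for x
      by (simp add: norm_mult cis_cnj)
    show "cmod (f (cis x) * cnj (f (cnj (cis x)))) \<le> exp (2 * L)" for x
    proof -
      have "cmod (f (cis x)) * cmod (f (cis (- x))) \<le> exp L * exp L"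
        by (intro mult_mono bound) auto
      then show ?thesis unfolding prod by (simp flip: exp_add)
    qed
    fix x y R assume y: "y \<in> \<Theta>" and R: "\<bar>x - y\<bar> \<le> R" "R > 0"
    \<comment> \<open>The point w is \<open>cis y\<close> or its conjugate, so one of the two
      factors is flat at this place and the other is bounded by \<open>exp L\<close>.\<close>
    obtain w where w: "w islimpt Z" "Re w = cos y" using y by (auto simp: \<Theta>_def)
    have "(Re w)\<^sup>2 + (Im w)\<^sup>2 = 1" using one[OF w(1)] by (simp add: cmod_power2[symmetric])
    then have "(Im w)\<^sup>2 = (sin y)\<^sup>2" using w(2) sin_cos_squared_add[of y] by (simp only:)
    then have "Im w = sin y \<or> Im w = - sin y" by (simp add: power2_eq_iff)
    then have "w = cis y \<or> w = cis (- y)" using w(2) by (auto simp: complex_eq_iff)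
    moreover have "cmod (cis x - cis y) \<le> R" "cmod (cis (- x) - cis (- y)) \<le> R"
      using norm_cis_diff_le[of x y] norm_cis_diff_le[of "- x" "- y"] R by linarith+
    ultimately have "cmod (f (cis x)) \<le> exp (L - \<kappa> * R powr (- (\<beta> / (1 - \<beta>)))) \<or>
        cmod (f (cis (- x))) \<le> exp (L - \<kappa> * R powr (- (\<beta> / (1 - \<beta>))))"
      using flat[OF w(1)[unfolded Z_def] _ _ R(2), of "cis x"] flat[OF w(1)[unfolded Z_def] _ _ R(2), of "cis (- x)"]
      by (auto simp: norm_cis)
    then have "cmod (f (cis x)) * cmod (f (cis (- x))) \<le> exp (L - \<kappa> * R powr (- (\<beta> / (1 - \<beta>)))) * exp L"
    proof
      assume "cmod (f (cis x)) \<le> exp (L - \<kappa> * R powr (- (\<beta> / (1 - \<beta>))))"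
      then show ?thesis by (intro mult_mono bound) auto
    next
      assume "cmod (f (cis (- x))) \<le> exp (L - \<kappa> * R powr (- (\<beta> / (1 - \<beta>))))"
      then have "cmod (f (cis (- x))) * cmod (f (cis x)) \<le> exp (L - \<kappa> * R powr (- (\<beta> / (1 - \<beta>)))) * exp L"
        by (intro mult_mono bound) auto
      then show ?thesis by (simp add: mult.commute)
    qed
    then show "cmod (f (cis x) * cnj (f (cnj (cis x)))) \<le> exp (2 * L - \<kappa> * R powr (- (\<beta> / (1 - \<beta>))))"
      unfolding prod by (simp add: algebra_simps flip: exp_add)
  qed
  have "bounded Z" by (rule bounded_subset[of "ball 0 1"]) (auto simp: Z_def)
  from that[OF flat_on[unfolded \<Theta>_def] this ds one lim] show ?thesis .
qed

lemma jacobi_class_less_half: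
  assumes J: "J \<in> jacobi_class \<beta>" and \<beta>: "0 < \<beta>" "\<beta> < 1/2"
  defines "F \<equiv> {x::real. complex_of_real x \<in> spectral_limit_set J}"
  shows "spectral_limit_set J \<subseteq> complex_of_real ` {-1..1}"
    and "closed (spectral_limit_set J)"
    and "F \<in> null_sets lborel"
    and "hausdorff_dim (spectral_limit_set J) \<le> convergence_exponent F"
    and "convergence_exponent F \<le> ereal ((1 - 2 * \<beta>) / (1 - \<beta>))"
proof -
  have \<beta>1: "\<beta> < 1" using \<beta> by simp
  obtain Z g A c where
    flat: "flat_on_circle g {y \<in> {0..pi}. \<exists>w. w islimpt Z \<and> Re w = cos y} (\<beta> / (1 - \<beta>)) A c"
    and "bounded Z" "discrete_spectrum J \<subseteq> (\<lambda>z. (z + 1 / z) / 2) ` Z"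
    and one: "\<And>w. w islimpt Z \<Longrightarrow> cmod w = 1"
    and lim: "\<And>x. x \<in> spectral_limit_set J \<Longrightarrow> \<exists>w. w islimpt Z \<and> x = complex_of_real (Re w)"
    by (rule jacobi_class_flat_on_circle[OF J \<beta>(1) \<beta>1], rule that)
  \<comment> \<open>A limit point of Z need not come from the spectrum, since only an inclusion is
    available. Restricting the angles makes the cosine image equal to F itself.\<close>
  define \<Theta> where "\<Theta> = {y \<in> {0..pi}. cos y \<in> F}"
  show sub: "spectral_limit_set J \<subseteq> complex_of_real ` {-1..1}"
  proof
    fix x assume "x \<in> spectral_limit_set J"
    then obtain w where w: "w islimpt Z" "x = complex_of_real (Re w)" using lim by blast
    then show "x \<in> complex_of_real ` {-1..1}"
      using abs_Re_le_cmod[of w] one[OF w(1)] by (intro image_eqI[of _ _ "Re w"]) (auto simp: abs_le_iff)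
  qed
  show closed: "closed (spectral_limit_set J)"
    unfolding spectral_limit_set_def by (rule closed_limpts)
  have F1: "F \<subseteq> {-1..1}" using sub by (auto simp: F_def)
  have "closed F" unfolding F_def
    using continuous_closed_vimage[OF closed, of complex_of_real] by (simp add: vimage_def)
  have img: "spectral_limit_set J = complex_of_real ` F" using sub by (auto simp: F_def)
  have cosF: "cos ` \<Theta> = F"
  proof
    show "F \<subseteq> cos ` \<Theta>"
    proof
      fix x assume "x \<in> F"
      then show "x \<in> cos ` \<Theta>"
        using F1 by (intro image_eqI[of _ _ "arccos x"]) (auto simp: \<Theta>_def arccos_lbound arccos_ubound)
    qed
  qed (auto simp: \<Theta>_def)
  have "\<Theta> \<subseteq> {y \<in> {0..pi}. \<exists>w. w islimpt Z \<and> Re w = cos y}"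
  proof
    fix y assume y: "y \<in> \<Theta>"
    then obtain w where "w islimpt Z" "complex_of_real (cos y) = complex_of_real (Re w)"
      using lim[of "complex_of_real (cos y)"] by (auto simp: \<Theta>_def F_def)
    then show "y \<in> {y \<in> {0..pi}. \<exists>w. w islimpt Z \<and> Re w = cos y}" using y by (auto simp: \<Theta>_def)
  qed
  then interpret flat_on_circle g \<Theta> "\<beta> / (1 - \<beta>)" A c
    by (rule flat_on_circle.flat_on_circle_subset[OF flat])
  have \<gamma>: "0 < \<beta> / (1 - \<beta>)" "\<beta> / (1 - \<beta>) < 1" using \<beta> by (auto simp: field_simps)
  have \<Theta>: "\<Theta> \<subseteq> {0..pi}" "closed (cos ` \<Theta>)" using \<open>closed F\<close> cosF by (auto simp: \<Theta>_def)
  show null: "F \<in> null_sets lborel"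
    using null_sets_cos_image[OF \<gamma>(1) \<Theta>] by (simp only: cosF)
  show "hausdorff_dim (spectral_limit_set J) \<le> convergence_exponent F"
    unfolding img using \<open>closed F\<close> F1 null by (rule hausdorff_dim_le_convergence_exponent)
  have "1 - \<beta> / (1 - \<beta>) = (1 - 2 * \<beta>) / (1 - \<beta>)" using \<beta> by (simp add: field_simps)
  then show "convergence_exponent F \<le> ereal ((1 - 2 * \<beta>) / (1 - \<beta>))"
    using convergence_exponent_le[OF \<gamma> \<Theta>] by (simp only: cosF)
qed

text \<open>Here the exponent \<gamma> is 1, so no angle can belong to a limit point of Z. A bounded
  set without limit points is finite, and Z covers the discrete spectrum.\<close>

lemma jacobi_class_half:
  assumes J: "J \<in> jacobi_class (1/2)"
  shows "finite (discrete_spectrum J)" "spectral_limit_set J = {}"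
proof -
  have half: "(0::real) < 1/2" "(1/2::real) < 1" by simp_all
  obtain Z g A c where
    flat: "flat_on_circle g {y \<in> {0..pi}. \<exists>w. w islimpt Z \<and> Re w = cos y} ((1/2) / (1 - 1/2)) A c"
    and Z: "bounded Z" "discrete_spectrum J \<subseteq> (\<lambda>z. (z + 1 / z) / 2) ` Z"
    and one: "\<And>w. w islimpt Z \<Longrightarrow> cmod w = 1"
    and "\<And>x. x \<in> spectral_limit_set J \<Longrightarrow> \<exists>w. w islimpt Z \<and> x = complex_of_real (Re w)"
    by (rule jacobi_class_flat_on_circle[OF J half], rule that)
  have empty: "{y \<in> {0..pi}. \<exists>w. w islimpt Z \<and> Re w = cos y} = {}"
    by (rule flat_on_circle.exponent_one_imp_empty[OF flat]) auto
  have "\<not> w islimpt Z" for w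
  proof
    assume w: "w islimpt Z"
    have "\<bar>Re w\<bar> \<le> 1" using abs_Re_le_cmod[of w] one[OF w] by simp
    then have "arccos (Re w) \<in> {0..pi}" "Re w = cos (arccos (Re w))"
      by (auto simp: abs_le_iff arccos_lbound arccos_ubound)
    then show False using w empty by blast
  qed
  then have "finite Z" using bounded_infinite_imp_islimpt[of Z] Z(1) by blast
  then show fin: "finite (discrete_spectrum J)" using Z(2) finite_surj by blast
  then show "spectral_limit_set J = {}"
    by (auto simp: spectral_limit_set_def islimpt_finite)
qed

theorem theorem1:
  fixes J :: "nat \<Rightarrow> nat \<Rightarrow> complex"
  assumes "jacobi_matrix J"
  shows "(\<forall>\<beta>::real. 0 < \<beta> \<and> \<beta> < 1/2 \<and> J \<in> jacobi_class \<beta> \<longrightarrow>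
            spectral_limit_set J \<subseteq> complex_of_real ` {-1..1} \<and>
            closed (spectral_limit_set J) \<and>
            {x::real. complex_of_real x \<in> spectral_limit_set J} \<in> null_sets lborel \<and>
            hausdorff_dim (spectral_limit_set J)
              \<le> convergence_exponent {x::real. complex_of_real x \<in> spectral_limit_set J} \<and>
            convergence_exponent {x::real. complex_of_real x \<in> spectral_limit_set J}
              \<le> ereal ((1 - 2 * \<beta>) / (1 - \<beta>))) \<and>
         (J \<in> jacobi_class (1/2) \<longrightarrow>
            spectral_limit_set J = {} \<and> finite (discrete_spectrum J))"
  using jacobi_class_less_half jacobi_class_half by blast

end
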